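(* The theory $V^0$ proves that the following two statements (each universally quantified over $n$ and the sets/points involved) are equivalent: (a) If $B$ is a set of edges forming a curve, $p_1$ and $p_2$ are two points on different sides of $B$, and $R$ is a set of edges that connects $p_1$ and $p_2$, then $B$ and $R$ intersect. (b) If $B$ is a set of edges that connects $(0,n)$ and $(n,0)$, and $R$ is a set of edges that connects $(0,0)$ and $(n,n)$, then $B$ and $R$ intersect.
   Context: Grid: fix $n$; grid points are $(x,y)$ with $0\le x,y\le n$; an edge joins two points differing by exactly 1 in exactly one coordinate. For a set $E$ of edges, the $E$-degree of a point is the number of edges of $E$ incident to it. A curve is a nonempty set $E$ of edges in which every point has $E$-degree $0$ or $2$. $E$ connects $p_1,p_2$ if $p_1,p_2$ have $E$-degree 1 and all other points have $E$-degree $0$ or $2$. $E_1,E_2$ intersect if some point has $E_1$-degree $\ge1$ and $E_2$-degree $\ge1$. $p_1,p_2$ are on different sides of $E$ if $x(p_1)=x(p_2)$, $|y(p_1)-y(p_2)|=2$, both have $E$-degree $0$, and the point $(x(p_1),\frac12(y(p_1)+y(p_2)))$ has $E$-degree $2$. $V^0$ is the two-sorted first-order theory (numbers and finite subsets of $\mathbb N$) over $0,1,+,\cdot,\le,=,|X|,\in$ axiomatized by 2-BASIC plus $\Sigma^B_0$-comprehension ($\Sigma^B_0$: bounded number quantifiers, no set quantifiers). *)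

theory Defs
  imports Main
begin

section \<open>Two-sorted first-order logic over the vocabulary of \<open>V\<^sup>0\<close>\<close>

text \<open>
  Both sorts of variables are de Bruijn indices, numbered independently: a number quantifier
  shifts only the number variables, a set quantifier only the set variables. A set variable is
  written as its index; \<open>Len i\<close> is the term $|X_i|$ and \<open>Mem t i\<close> the formula $t \in X_i$.
\<close>

datatype nterm =
    NVar nat
  | Zero
  | One
  | Add nterm nterm (infixl \<open>\<^bold>+\<close> 65)
  | Mul nterm nterm (infixl \<open>\<^bold>*\<close> 70)
  | Len nat

datatype form =
    Fls
  | EqN nterm nterm (infix \<open>\<^bold>=\<close> 50)
  | Le nterm nterm (infix \<open>\<^bold>\<le>\<close> 50)
  | EqS nat nat
  | Mem nterm nat (infix \<open>\<^bold>\<in>\<close> 50)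
  | Imp form form (infixr \<open>\<^bold>\<rightarrow>\<close> 25)
  | And form form (infixr \<open>\<^bold>\<and>\<close> 35)
  | Or form form (infixr \<open>\<^bold>\<or>\<close> 30)
  | AllN form
  | ExN form
  | AllS form
  | ExS form

definition Neg :: "form \<Rightarrow> form" (\<open>\<^bold>\<not> _\<close> [40] 40) where
  "(\<^bold>\<not> \<phi>) = (\<phi> \<^bold>\<rightarrow> Fls)"

definition Iff :: "form \<Rightarrow> form \<Rightarrow> form" (infixr \<open>\<^bold>\<leftrightarrow>\<close> 25) where
  "(\<phi> \<^bold>\<leftrightarrow> \<psi>) = ((\<phi> \<^bold>\<rightarrow> \<psi>) \<^bold>\<and> (\<psi> \<^bold>\<rightarrow> \<phi>))"

definition Lt :: "nterm \<Rightarrow> nterm \<Rightarrow> form" (infix \<open>\<^bold><\<close> 50) where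
  "(s \<^bold>< t) = (s \<^bold>\<le> t \<^bold>\<and> \<^bold>\<not> s \<^bold>= t)"

primrec tsub :: "(nat \<Rightarrow> nterm) \<Rightarrow> (nat \<Rightarrow> nat) \<Rightarrow> nterm \<Rightarrow> nterm" where
  "tsub \<sigma> \<rho> (NVar i) = \<sigma> i"
| "tsub \<sigma> \<rho> Zero = Zero"
| "tsub \<sigma> \<rho> One = One"
| "tsub \<sigma> \<rho> (s \<^bold>+ t) = tsub \<sigma> \<rho> s \<^bold>+ tsub \<sigma> \<rho> t"
| "tsub \<sigma> \<rho> (s \<^bold>* t) = tsub \<sigma> \<rho> s \<^bold>* tsub \<sigma> \<rho> t"
| "tsub \<sigma> \<rho> (Len i) = Len (\<rho> i)"

definition up :: "nat \<Rightarrow> nterm \<Rightarrow> nterm" where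
  "up k = tsub (\<lambda>i. NVar (i + k)) id"

primrec sub :: "(nat \<Rightarrow> nterm) \<Rightarrow> (nat \<Rightarrow> nat) \<Rightarrow> form \<Rightarrow> form" where
  "sub \<sigma> \<rho> Fls = Fls"
| "sub \<sigma> \<rho> (s \<^bold>= t) = (tsub \<sigma> \<rho> s \<^bold>= tsub \<sigma> \<rho> t)"
| "sub \<sigma> \<rho> (s \<^bold>\<le> t) = (tsub \<sigma> \<rho> s \<^bold>\<le> tsub \<sigma> \<rho> t)"
| "sub \<sigma> \<rho> (EqS i j) = EqS (\<rho> i) (\<rho> j)"
| "sub \<sigma> \<rho> (t \<^bold>\<in> i) = (tsub \<sigma> \<rho> t \<^bold>\<in> \<rho> i)"
| "sub \<sigma> \<rho> (\<phi> \<^bold>\<rightarrow> \<psi>) = (sub \<sigma> \<rho> \<phi> \<^bold>\<rightarrow> sub \<sigma> \<rho> \<psi>)"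
| "sub \<sigma> \<rho> (\<phi> \<^bold>\<and> \<psi>) = (sub \<sigma> \<rho> \<phi> \<^bold>\<and> sub \<sigma> \<rho> \<psi>)"
| "sub \<sigma> \<rho> (\<phi> \<^bold>\<or> \<psi>) = (sub \<sigma> \<rho> \<phi> \<^bold>\<or> sub \<sigma> \<rho> \<psi>)"
| "sub \<sigma> \<rho> (AllN \<phi>) = AllN (sub (case_nat (NVar 0) (up 1 \<circ> \<sigma>)) \<rho> \<phi>)"
| "sub \<sigma> \<rho> (ExN \<phi>) = ExN (sub (case_nat (NVar 0) (up 1 \<circ> \<sigma>)) \<rho> \<phi>)"
| "sub \<sigma> \<rho> (AllS \<phi>) = AllS (sub (tsub NVar Suc \<circ> \<sigma>) (case_nat 0 (Suc \<circ> \<rho>)) \<phi>)"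
| "sub \<sigma> \<rho> (ExS \<phi>) = ExS (sub (tsub NVar Suc \<circ> \<sigma>) (case_nat 0 (Suc \<circ> \<rho>)) \<phi>)"

definition liftN :: "form \<Rightarrow> form" where "liftN = sub (NVar \<circ> Suc) id"
definition liftS :: "form \<Rightarrow> form" where "liftS = sub NVar Suc"
definition instN :: "nterm \<Rightarrow> form \<Rightarrow> form" where "instN t = sub (case_nat t NVar) id"
definition instS :: "nat \<Rightarrow> form \<Rightarrow> form" where "instS j = sub NVar (case_nat j id)"

text \<open>
  Classical natural deduction with equality. The formulas in \<open>T\<close> are non-logical axioms; their
  free variables are implicitly universally quantified, so rule \<open>Ax\<close> is available in every
  context. The variables of the hypotheses \<open>\<Gamma>\<close> are parameters: the eigenvariable condition
  appears as a shift of \<open>\<Gamma>\<close>.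
\<close>

inductive derives :: "form set \<Rightarrow> form list \<Rightarrow> form \<Rightarrow> bool" (\<open>_; _ \<turnstile> _\<close> [45, 45, 20] 20)
  for T :: "form set" where
  Ax: "\<phi> \<in> T \<Longrightarrow> T; \<Gamma> \<turnstile> \<phi>"
| Hyp: "\<phi> \<in> set \<Gamma> \<Longrightarrow> T; \<Gamma> \<turnstile> \<phi>"
| Classical: "T; (\<^bold>\<not> \<phi>) # \<Gamma> \<turnstile> Fls \<Longrightarrow> T; \<Gamma> \<turnstile> \<phi>"
| ImpI: "T; \<phi> # \<Gamma> \<turnstile> \<psi> \<Longrightarrow> T; \<Gamma> \<turnstile> \<phi> \<^bold>\<rightarrow> \<psi>"
| ImpE: "T; \<Gamma> \<turnstile> \<phi> \<^bold>\<rightarrow> \<psi> \<Longrightarrow> T; \<Gamma> \<turnstile> \<phi> \<Longrightarrow> T; \<Gamma> \<turnstile> \<psi>"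
| AndI: "T; \<Gamma> \<turnstile> \<phi> \<Longrightarrow> T; \<Gamma> \<turnstile> \<psi> \<Longrightarrow> T; \<Gamma> \<turnstile> \<phi> \<^bold>\<and> \<psi>"
| AndE1: "T; \<Gamma> \<turnstile> \<phi> \<^bold>\<and> \<psi> \<Longrightarrow> T; \<Gamma> \<turnstile> \<phi>"
| AndE2: "T; \<Gamma> \<turnstile> \<phi> \<^bold>\<and> \<psi> \<Longrightarrow> T; \<Gamma> \<turnstile> \<psi>"
| OrI1: "T; \<Gamma> \<turnstile> \<phi> \<Longrightarrow> T; \<Gamma> \<turnstile> \<phi> \<^bold>\<or> \<psi>"
| OrI2: "T; \<Gamma> \<turnstile> \<psi> \<Longrightarrow> T; \<Gamma> \<turnstile> \<phi> \<^bold>\<or> \<psi>"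
| OrE: "T; \<Gamma> \<turnstile> \<phi> \<^bold>\<or> \<psi> \<Longrightarrow> T; \<phi> # \<Gamma> \<turnstile> \<chi> \<Longrightarrow> T; \<psi> # \<Gamma> \<turnstile> \<chi> \<Longrightarrow> T; \<Gamma> \<turnstile> \<chi>"
| AllNI: "T; map liftN \<Gamma> \<turnstile> \<phi> \<Longrightarrow> T; \<Gamma> \<turnstile> AllN \<phi>"
| AllNE: "T; \<Gamma> \<turnstile> AllN \<phi> \<Longrightarrow> T; \<Gamma> \<turnstile> instN t \<phi>"
| ExNI: "T; \<Gamma> \<turnstile> instN t \<phi> \<Longrightarrow> T; \<Gamma> \<turnstile> ExN \<phi>"
| ExNE: "T; \<Gamma> \<turnstile> ExN \<phi> \<Longrightarrow> T; \<phi> # map liftN \<Gamma> \<turnstile> liftN \<chi> \<Longrightarrow> T; \<Gamma> \<turnstile> \<chi>"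
| AllSI: "T; map liftS \<Gamma> \<turnstile> \<phi> \<Longrightarrow> T; \<Gamma> \<turnstile> AllS \<phi>"
| AllSE: "T; \<Gamma> \<turnstile> AllS \<phi> \<Longrightarrow> T; \<Gamma> \<turnstile> instS j \<phi>"
| ExSI: "T; \<Gamma> \<turnstile> instS j \<phi> \<Longrightarrow> T; \<Gamma> \<turnstile> ExS \<phi>"
| ExSE: "T; \<Gamma> \<turnstile> ExS \<phi> \<Longrightarrow> T; \<phi> # map liftS \<Gamma> \<turnstile> liftS \<chi> \<Longrightarrow> T; \<Gamma> \<turnstile> \<chi>"
| ReflN: "T; \<Gamma> \<turnstile> t \<^bold>= t"
| SubstN: "T; \<Gamma> \<turnstile> s \<^bold>= t \<Longrightarrow> T; \<Gamma> \<turnstile> instN s \<phi> \<Longrightarrow> T; \<Gamma> \<turnstile> instN t \<phi>"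
| ReflS: "T; \<Gamma> \<turnstile> EqS i i"
| SubstS: "T; \<Gamma> \<turnstile> EqS i j \<Longrightarrow> T; \<Gamma> \<turnstile> instS i \<phi> \<Longrightarrow> T; \<Gamma> \<turnstile> instS j \<phi>"

definition proves :: "form set \<Rightarrow> form \<Rightarrow> bool" where
  "proves T \<phi> \<longleftrightarrow> (T; [] \<turnstile> \<phi>)"


section \<open>The theory \<open>V\<^sup>0\<close>\<close>

text \<open>Bounded quantifiers; shifting \<open>t\<close> means that the bound variable does not occur in it.\<close>

definition BAll :: "nterm \<Rightarrow> form \<Rightarrow> form" where
  "BAll t \<phi> = AllN (NVar 0 \<^bold>\<le> up 1 t \<^bold>\<rightarrow> \<phi>)"

definition BEx :: "nterm \<Rightarrow> form \<Rightarrow> form" where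
  "BEx t \<phi> = ExN (NVar 0 \<^bold>\<le> up 1 t \<^bold>\<and> \<phi>)"

inductive Sigma0B :: "form \<Rightarrow> bool" where
  "Sigma0B Fls"
| "Sigma0B (s \<^bold>= t)"
| "Sigma0B (s \<^bold>\<le> t)"
| "Sigma0B (EqS i j)"
| "Sigma0B (t \<^bold>\<in> i)"
| "Sigma0B \<phi> \<Longrightarrow> Sigma0B \<psi> \<Longrightarrow> Sigma0B (\<phi> \<^bold>\<rightarrow> \<psi>)"
| "Sigma0B \<phi> \<Longrightarrow> Sigma0B \<psi> \<Longrightarrow> Sigma0B (\<phi> \<^bold>\<and> \<psi>)"
| "Sigma0B \<phi> \<Longrightarrow> Sigma0B \<psi> \<Longrightarrow> Sigma0B (\<phi> \<^bold>\<or> \<psi>)"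
| "Sigma0B \<phi> \<Longrightarrow> Sigma0B (BAll t \<phi>)"
| "Sigma0B \<phi> \<Longrightarrow> Sigma0B (BEx t \<phi>)"

text \<open>In the order B1--B12, L1, L2, SE of Cook and Nguyen, with \<open>x = NVar 0\<close>, \<open>y = NVar 1\<close>.\<close>

definition two_BASIC :: "form set" where
  "two_BASIC = (let x = NVar 0; y = NVar 1 in
   { \<^bold>\<not> x \<^bold>+ One \<^bold>= Zero,
     x \<^bold>+ One \<^bold>= y \<^bold>+ One \<^bold>\<rightarrow> x \<^bold>= y,
     x \<^bold>+ Zero \<^bold>= x,
     x \<^bold>+ (y \<^bold>+ One) \<^bold>= (x \<^bold>+ y) \<^bold>+ One,
     x \<^bold>* Zero \<^bold>= Zero,
     x \<^bold>* (y \<^bold>+ One) \<^bold>= (x \<^bold>* y) \<^bold>+ x,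
     x \<^bold>\<le> y \<^bold>\<and> y \<^bold>\<le> x \<^bold>\<rightarrow> x \<^bold>= y,
     x \<^bold>\<le> x \<^bold>+ y,
     Zero \<^bold>\<le> x,
     x \<^bold>\<le> y \<^bold>\<or> y \<^bold>\<le> x,
     x \<^bold>\<le> y \<^bold>\<leftrightarrow> x \<^bold>< y \<^bold>+ One,
     \<^bold>\<not> x \<^bold>= Zero \<^bold>\<rightarrow> BEx x (NVar 0 \<^bold>+ One \<^bold>= NVar 1),
     y \<^bold>\<in> 0 \<^bold>\<rightarrow> y \<^bold>< Len 0,
     y \<^bold>+ One \<^bold>= Len 0 \<^bold>\<rightarrow> y \<^bold>\<in> 0,
     Len 0 \<^bold>= Len 1 \<^bold>\<and> AllN (NVar 0 \<^bold>< Len 0 \<^bold>\<rightarrow> (NVar 0 \<^bold>\<in> 0 \<^bold>\<leftrightarrow> NVar 0 \<^bold>\<in> 1))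
       \<^bold>\<rightarrow> EqS 0 1 })"

text \<open>
  \<open>comprehension \<phi>\<close> is $\exists X (|X| \le y \land \forall z < y\, (z \in X \leftrightarrow \varphi(z)))$.
  In \<open>\<phi>\<close>, \<open>z\<close> is \<open>NVar 0\<close> and \<open>y\<close> is \<open>NVar 1\<close>; the remaining variables of either sort are
  parameters, and \<open>liftS\<close> keeps \<open>X\<close> out of \<open>\<phi>\<close>.
\<close>

definition comprehension :: "form \<Rightarrow> form" where
  "comprehension \<phi> =
     ExS (Len 0 \<^bold>\<le> NVar 0 \<^bold>\<and> AllN (NVar 0 \<^bold>< NVar 1 \<^bold>\<rightarrow> (NVar 0 \<^bold>\<in> 0 \<^bold>\<leftrightarrow> liftS \<phi>)))"

definition V0 :: "form set" where
  "V0 = two_BASIC \<union> {comprehension \<phi> | \<phi>. Sigma0B \<phi>}"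


section \<open>Grid points, sets of edges and curves, as formulas\<close>

text \<open>
  Points are given by two number terms. The undirected edge joining \<open>p\<close> and \<open>q\<close> is coded by the
  single number \<open>\<langle>p, q\<rangle>\<close>, where \<open>p\<close> is the endpoint with the smaller coordinate, a point \<open>(x, y)\<close>
  is coded by \<open>\<langle>x, y\<rangle>\<close>, and $\langle x, y\rangle = (x+y)(x+y+1)+2y$ is the pairing function
  of Cook and Nguyen. Arguments \<open>n, x, y, \<dots>\<close> are terms outside the quantifiers of the formula
  being defined and are shifted (\<open>up\<close>) under them.
\<close>

definition pair :: "nterm \<Rightarrow> nterm \<Rightarrow> nterm" where
  "pair s t = (s \<^bold>+ t) \<^bold>* (s \<^bold>+ t \<^bold>+ One) \<^bold>+ (One \<^bold>+ One) \<^bold>* t"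

definition edge_code :: "nterm \<Rightarrow> nterm \<Rightarrow> nterm \<Rightarrow> nterm \<Rightarrow> nterm \<Rightarrow> form" where
  "edge_code e x y u v =
     ((u \<^bold>= x \<^bold>+ One \<^bold>\<and> v \<^bold>= y \<^bold>\<or> u \<^bold>= x \<^bold>\<and> v \<^bold>= y \<^bold>+ One)
      \<^bold>\<and> e \<^bold>= pair (pair x y) (pair u v))"

definition edge_set :: "nterm \<Rightarrow> nat \<Rightarrow> form" where
  "edge_set n E = BAll (Len E) (NVar 0 \<^bold>\<in> E \<^bold>\<rightarrow>
     BEx (up 1 n) (BEx (up 2 n) (BEx (up 3 n) (BEx (up 4 n)
       (edge_code (NVar 4) (NVar 3) (NVar 2) (NVar 1) (NVar 0))))))"

text \<open>\<open>e\<close> is an element of \<open>E\<close> incident to the point \<open>(x, y)\<close>.\<close>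

definition inc :: "nterm \<Rightarrow> nat \<Rightarrow> nterm \<Rightarrow> nterm \<Rightarrow> nterm \<Rightarrow> form" where
  "inc n E e x y = (e \<^bold>\<in> E \<^bold>\<and> BEx n (BEx (up 1 n)
     (edge_code (up 2 e) (up 2 x) (up 2 y) (NVar 1) (NVar 0) \<^bold>\<or>
      edge_code (up 2 e) (NVar 1) (NVar 0) (up 2 x) (up 2 y))))"

text \<open>The \<open>E\<close>-degree of the point \<open>(x, y)\<close> is \<open>0\<close>, \<open>1\<close>, \<open>2\<close>, at least \<open>1\<close>.\<close>

definition deg0 :: "nterm \<Rightarrow> nat \<Rightarrow> nterm \<Rightarrow> nterm \<Rightarrow> form" where
  "deg0 n E x y = BAll (Len E) (\<^bold>\<not> inc (up 1 n) E (NVar 0) (up 1 x) (up 1 y))"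

definition deg1 :: "nterm \<Rightarrow> nat \<Rightarrow> nterm \<Rightarrow> nterm \<Rightarrow> form" where
  "deg1 n E x y = BEx (Len E) (inc (up 1 n) E (NVar 0) (up 1 x) (up 1 y) \<^bold>\<and>
     BAll (Len E) (inc (up 2 n) E (NVar 0) (up 2 x) (up 2 y) \<^bold>\<rightarrow> NVar 0 \<^bold>= NVar 1))"

definition deg2 :: "nterm \<Rightarrow> nat \<Rightarrow> nterm \<Rightarrow> nterm \<Rightarrow> form" where
  "deg2 n E x y = BEx (Len E) (BEx (Len E)
     (\<^bold>\<not> NVar 0 \<^bold>= NVar 1 \<^bold>\<and>
      inc (up 2 n) E (NVar 0) (up 2 x) (up 2 y) \<^bold>\<and>
      inc (up 2 n) E (NVar 1) (up 2 x) (up 2 y) \<^bold>\<and>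
      BAll (Len E) (inc (up 3 n) E (NVar 0) (up 3 x) (up 3 y) \<^bold>\<rightarrow>
        NVar 0 \<^bold>= NVar 1 \<^bold>\<or> NVar 0 \<^bold>= NVar 2)))"

definition deg_ge1 :: "nterm \<Rightarrow> nat \<Rightarrow> nterm \<Rightarrow> nterm \<Rightarrow> form" where
  "deg_ge1 n E x y = BEx (Len E) (inc (up 1 n) E (NVar 0) (up 1 x) (up 1 y))"

definition curve :: "nterm \<Rightarrow> nat \<Rightarrow> form" where
  "curve n E = (edge_set n E \<^bold>\<and> BEx (Len E) (NVar 0 \<^bold>\<in> E) \<^bold>\<and>
     BAll n (BAll (up 1 n)
       (deg0 (up 2 n) E (NVar 1) (NVar 0) \<^bold>\<or> deg2 (up 2 n) E (NVar 1) (NVar 0))))"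

definition connects :: "nterm \<Rightarrow> nat \<Rightarrow> nterm \<Rightarrow> nterm \<Rightarrow> nterm \<Rightarrow> nterm \<Rightarrow> form" where
  "connects n E x1 y1 x2 y2 = (edge_set n E \<^bold>\<and> deg1 n E x1 y1 \<^bold>\<and> deg1 n E x2 y2 \<^bold>\<and>
     BAll n (BAll (up 1 n)
       (\<^bold>\<not> (NVar 1 \<^bold>= up 2 x1 \<^bold>\<and> NVar 0 \<^bold>= up 2 y1) \<^bold>\<and>
        \<^bold>\<not> (NVar 1 \<^bold>= up 2 x2 \<^bold>\<and> NVar 0 \<^bold>= up 2 y2) \<^bold>\<rightarrow>
        deg0 (up 2 n) E (NVar 1) (NVar 0) \<^bold>\<or> deg2 (up 2 n) E (NVar 1) (NVar 0))))"

definition intersect :: "nterm \<Rightarrow> nat \<Rightarrow> nat \<Rightarrow> form" where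
  "intersect n E1 E2 = BEx n (BEx (up 1 n)
     (deg_ge1 (up 2 n) E1 (NVar 1) (NVar 0) \<^bold>\<and> deg_ge1 (up 2 n) E2 (NVar 1) (NVar 0)))"

definition different_sides ::
    "nterm \<Rightarrow> nat \<Rightarrow> nterm \<Rightarrow> nterm \<Rightarrow> nterm \<Rightarrow> nterm \<Rightarrow> form" where
  "different_sides n E x1 y1 x2 y2 =
     (x1 \<^bold>= x2 \<^bold>\<and> (y1 \<^bold>= y2 \<^bold>+ (One \<^bold>+ One) \<^bold>\<or> y2 \<^bold>= y1 \<^bold>+ (One \<^bold>+ One)) \<^bold>\<and>
      deg0 n E x1 y1 \<^bold>\<and> deg0 n E x2 y2 \<^bold>\<and>
      BEx n (NVar 0 \<^bold>+ NVar 0 \<^bold>= up 1 y1 \<^bold>+ up 1 y2 \<^bold>\<and>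
             deg2 (up 1 n) E (up 1 x1) (NVar 0)))"

text \<open>
  The two sentences. The set variables are \<open>B = 1\<close> and \<open>R = 0\<close>. In the first sentence
  \<open>n = NVar 4\<close> and the points are \<open>(NVar 3, NVar 2)\<close> and \<open>(NVar 1, NVar 0)\<close>.
\<close>

definition JCT_curve :: form where
  "JCT_curve = AllN (AllS (AllS
     (BAll (NVar 0) (BAll (NVar 1) (BAll (NVar 2) (BAll (NVar 3)
       (let n = NVar 4; x1 = NVar 3; y1 = NVar 2; x2 = NVar 1; y2 = NVar 0; B = 1; R = 0 in
        curve n B \<^bold>\<and> different_sides n B x1 y1 x2 y2 \<^bold>\<and> connects n R x1 y1 x2 y2
          \<^bold>\<rightarrow> intersect n B R)))))))"

definition JCT_corners :: form where
  "JCT_corners = AllN (AllS (AllS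
     (let n = NVar 0; B = 1; R = 0 in
      connects n B Zero n n Zero \<^bold>\<and> connects n R Zero Zero n n \<^bold>\<rightarrow> intersect n B R)))"

end

(*
  The calculus is complete for two-sorted structures with a congruence as equality (Henkin), so it
  suffices to prove the equivalence in one model of V0 that refutes it if it is not provable. In
  that model the numbers generate a discretely ordered ring; a set of edges is a pair of predicates
  on that ring, and every picture defined from given ones by a bounded formula is again a set of
  the model.

  From (a) to (b): given disjoint corner paths, close B by a path around the corner (0,0) outside
  of the grid and prolong R around the opposite corner and below that path.

  From (b) to (a): the grid is recentred at a face next to the middle point of p1 and p2 and turned
  inside out. Each of the four quadrants is reflected in its antidiagonal, which moves the face to
  the outside, and an edge crossing an axis at distance j becomes an arc around the two quadrants it
  used to join; small j gives an outer arc. Cutting B next to the middle point then leaves two ends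
  of B and two of R in alternating order on the outer boundary, where they reach the corners. All
  of this is local, so no connectedness or counting is involved.
*)
theory Submission
  imports Defs "HOL-Library.Countable" "HOL-Library.Nat_Bijection"
begin

text \<open>Bounded comprehension gives no means to count crossings, to follow a curve or to speak
  of its interior. What remains is surgery: an edge of a new picture is decided by comparisons and
  by finitely many old edges whose places are piecewise linear in the new coordinates. Before the
  ends are prolonged, each new degree depends on one old point or one old edge, by a rule that is
  the same for both paths, so evenness and disjointness carry over pointwise. The obstacle is that a
  closed curve has no ends at the boundary. Deleting an edge makes two, but side by side in the
  middle, with the ends of the other path above and below; hence the inversion. A lattice has no
  smooth inversion. Treating the quadrants separately gives an exact bijection on their points, and
  all that is torn apart lies on the axes. An empty row and column are inserted beforehand, so that
  the axes are only crossed and the arcs that repair the tears are nested. A type cannot depend on a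
  hypothesis of a proof, which is why one model is chosen globally before its ring is
  formed.\<close>

section \<open>Substitution\<close>

text \<open>Otherwise \<open>up 1\<close> is rewritten to \<open>up (Suc 0)\<close>.\<close>

declare One_nat_def [simp del]

lemma tsub_tsub: "tsub \<sigma> \<rho> (tsub \<sigma>' \<rho>' t) = tsub (tsub \<sigma> \<rho> \<circ> \<sigma>') (\<rho> \<circ> \<rho>') t"
  by (induction t) auto

lemma tsub_id [simp]: "tsub NVar id t = t"
  by (induction t) auto

lemma tsub_ident [simp]: "tsub NVar (\<lambda>i. i) t = t"
  by (induction t) auto

lemma up_1: "up 1 = tsub (\<lambda>i. NVar (Suc i)) id"
  by (simp add: up_def One_nat_def)

lemma case_nat_up: "tsub (case_nat a (up 1 \<circ> \<sigma>)) \<rho> \<circ> case_nat (NVar 0) (up 1 \<circ> \<sigma>')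
    = case_nat a (up 1 \<circ> (tsub \<sigma> \<rho> \<circ> \<sigma>'))"
proof
  fix i
  show "(tsub (case_nat a (up 1 \<circ> \<sigma>)) \<rho> \<circ> case_nat (NVar 0) (up 1 \<circ> \<sigma>')) i
    = case_nat a (up 1 \<circ> (tsub \<sigma> \<rho> \<circ> \<sigma>')) i"
    by (cases i) (auto simp: up_1 tsub_tsub comp_def)
qed

lemma case_nat_shiftS: "tsub (tsub NVar Suc \<circ> \<sigma>) (case_nat j (Suc \<circ> \<rho>)) \<circ> (tsub NVar Suc \<circ> \<sigma>')
    = tsub NVar Suc \<circ> (tsub \<sigma> \<rho> \<circ> \<sigma>')"
  by (auto simp: fun_eq_iff tsub_tsub comp_def)

lemma case_nat_comp: "case_nat j (Suc \<circ> \<rho>) \<circ> case_nat 0 (Suc \<circ> \<rho>') = case_nat j (Suc \<circ> (\<rho> \<circ> \<rho>'))"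
  by (auto simp: fun_eq_iff split: nat.split)

lemma sub_sub: "sub \<sigma> \<rho> (sub \<sigma>' \<rho>' \<phi>) = sub (tsub \<sigma> \<rho> \<circ> \<sigma>') (\<rho> \<circ> \<rho>') \<phi>"
  by (induction \<phi> arbitrary: \<sigma> \<rho> \<sigma>' \<rho>') (simp_all add: tsub_tsub case_nat_up case_nat_shiftS case_nat_comp)

lemma case_nat_NVar: "case_nat (NVar 0) (up 1 \<circ> NVar) = NVar"
  by (auto simp: fun_eq_iff up_def split: nat.split)

lemma case_nat_id: "case_nat 0 (Suc \<circ> id) = id"
  by (auto simp: fun_eq_iff split: nat.split)

lemma case_nat_Suc: "case_nat 0 Suc = id"
  by (auto simp: fun_eq_iff split: nat.split)

lemma tsub_comp_NVar: "tsub NVar \<rho> \<circ> NVar = NVar"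
  by (auto simp: fun_eq_iff)

lemma sub_id [simp]: "sub NVar id \<phi> = \<phi>"
proof (induction \<phi>)
  case (AllN \<phi>)
  then show ?case by (simp only: sub.simps case_nat_NVar)
next
  case (ExN \<phi>)
  then show ?case by (simp only: sub.simps case_nat_NVar)
next
  case (AllS \<phi>)
  then show ?case by (simp only: sub.simps case_nat_id tsub_comp_NVar)
next
  case (ExS \<phi>)
  then show ?case by (simp only: sub.simps case_nat_id tsub_comp_NVar)
qed (simp_all flip: id_def)

lemma sub_ident [simp]: "sub NVar (\<lambda>i. i) \<phi> = \<phi>"
  using sub_id unfolding id_def .

lemma sub_Neg [simp]: "sub \<sigma> \<rho> (\<^bold>\<not> \<phi>) = (\<^bold>\<not> sub \<sigma> \<rho> \<phi>)"
  by (simp add: Neg_def)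

lemma map_sub_liftN:
  "map (sub (case_nat (NVar 0) (up 1 \<circ> \<sigma>)) \<rho>) (map liftN \<Gamma>) = map liftN (map (sub \<sigma> \<rho>) \<Gamma>)"
  "sub (case_nat (NVar 0) (up 1 \<circ> \<sigma>)) \<rho> (liftN \<phi>) = liftN (sub \<sigma> \<rho> \<phi>)"
  by (simp_all add: liftN_def sub_sub comp_def up_1)

lemma map_sub_liftS:
  "map (sub (tsub NVar Suc \<circ> \<sigma>) (case_nat 0 (Suc \<circ> \<rho>))) (map liftS \<Gamma>) = map liftS (map (sub \<sigma> \<rho>) \<Gamma>)"
  "sub (tsub NVar Suc \<circ> \<sigma>) (case_nat 0 (Suc \<circ> \<rho>)) (liftS \<phi>) = liftS (sub \<sigma> \<rho> \<phi>)"
  by (simp_all add: liftS_def sub_sub comp_def)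

lemma case_nat_instN: "tsub (case_nat a NVar) id \<circ> case_nat (NVar 0) (up 1 \<circ> \<sigma>) = case_nat a \<sigma>"
proof
  fix i
  show "(tsub (case_nat a NVar) id \<circ> case_nat (NVar 0) (up 1 \<circ> \<sigma>)) i = case_nat a \<sigma> i"
    by (cases i) (simp_all add: up_1 tsub_tsub comp_def)
qed

lemma instN_sub: "instN a (sub (case_nat (NVar 0) (up 1 \<circ> \<sigma>)) \<rho> \<phi>) = sub (case_nat a \<sigma>) \<rho> \<phi>"
  by (simp add: instN_def sub_sub case_nat_instN)

lemma instS_sub:
  "instS j (sub (tsub NVar Suc \<circ> \<sigma>) (case_nat 0 (Suc \<circ> \<rho>)) \<phi>) = sub \<sigma> (case_nat j \<rho>) \<phi>"
proof -
  have "tsub NVar (case_nat j id) \<circ> (tsub NVar Suc \<circ> \<sigma>) = \<sigma>"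
    by (auto simp: fun_eq_iff tsub_tsub comp_def simp flip: id_def)
  moreover have "case_nat j id \<circ> case_nat 0 (Suc \<circ> \<rho>) = case_nat j \<rho>"
    by (auto simp: fun_eq_iff split: nat.split)
  ultimately show ?thesis
    by (simp add: instS_def sub_sub)
qed

lemma sub_instN: "sub \<sigma> \<rho> (instN t \<phi>) = instN (tsub \<sigma> \<rho> t) (sub (case_nat (NVar 0) (up 1 \<circ> \<sigma>)) \<rho> \<phi>)"
proof -
  have "tsub \<sigma> \<rho> \<circ> case_nat t NVar = case_nat (tsub \<sigma> \<rho> t) \<sigma>"
    by (auto simp: fun_eq_iff split: nat.split)
  then show ?thesis
    by (simp add: instN_sub) (simp add: instN_def sub_sub)
qed

lemma sub_instS:
  "sub \<sigma> \<rho> (instS j \<phi>) = instS (\<rho> j) (sub (tsub NVar Suc \<circ> \<sigma>) (case_nat 0 (Suc \<circ> \<rho>)) \<phi>)"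
proof -
  have "tsub \<sigma> \<rho> \<circ> NVar = \<sigma>" "\<rho> \<circ> case_nat j id = case_nat (\<rho> j) \<rho>"
    by (auto simp: fun_eq_iff split: nat.split)
  then show ?thesis
    by (simp add: instS_sub) (simp add: instS_def sub_sub)
qed

lemma tsub_cong_bound: "\<exists>k. \<forall>\<sigma> \<sigma>' \<rho> \<rho>'. (\<forall>i<k. \<sigma> i = \<sigma>' i \<and> \<rho> i = \<rho>' i) \<longrightarrow> tsub \<sigma> \<rho> t = tsub \<sigma>' \<rho>' t"
proof (induction t)
  case (Add s t)
  then obtain k l where "\<forall>\<sigma> \<sigma>' \<rho> \<rho>'. (\<forall>i<k. \<sigma> i = \<sigma>' i \<and> \<rho> i = \<rho>' i) \<longrightarrow> tsub \<sigma> \<rho> s = tsub \<sigma>' \<rho>' s"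
    "\<forall>\<sigma> \<sigma>' \<rho> \<rho>'. (\<forall>i<l. \<sigma> i = \<sigma>' i \<and> \<rho> i = \<rho>' i) \<longrightarrow> tsub \<sigma> \<rho> t = tsub \<sigma>' \<rho>' t" by blast
  then show ?case by (intro exI[of _ "max k l"]) (simp; blast)
next
  case (Mul s t)
  then obtain k l where "\<forall>\<sigma> \<sigma>' \<rho> \<rho>'. (\<forall>i<k. \<sigma> i = \<sigma>' i \<and> \<rho> i = \<rho>' i) \<longrightarrow> tsub \<sigma> \<rho> s = tsub \<sigma>' \<rho>' s"
    "\<forall>\<sigma> \<sigma>' \<rho> \<rho>'. (\<forall>i<l. \<sigma> i = \<sigma>' i \<and> \<rho> i = \<rho>' i) \<longrightarrow> tsub \<sigma> \<rho> t = tsub \<sigma>' \<rho>' t" by blast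
  then show ?case by (intro exI[of _ "max k l"]) (simp; blast)
qed (auto intro: exI[of _ "Suc _"])

text \<open>Says that the free variables of both sorts have index below \<open>k\<close>, but
  through substitution. This is the form in which freshness is used, and no function for free
  variables is required.\<close>

definition fresh :: "nat \<Rightarrow> form \<Rightarrow> bool" where
  "fresh k \<phi> \<longleftrightarrow> (\<forall>\<sigma> \<sigma>' \<rho> \<rho>'. (\<forall>i<k. \<sigma> i = \<sigma>' i \<and> \<rho> i = \<rho>' i) \<longrightarrow> sub \<sigma> \<rho> \<phi> = sub \<sigma>' \<rho>' \<phi>)"

lemma fresh_mono: "fresh k \<phi> \<Longrightarrow> k \<le> l \<Longrightarrow> fresh l \<phi>"
  unfolding fresh_def by (meson order_less_le_trans)

lemma freshD: "fresh k \<phi> \<Longrightarrow> (\<And>i. i < k \<Longrightarrow> \<sigma> i = \<sigma>' i) \<Longrightarrow> (\<And>i. i < k \<Longrightarrow> \<rho> i = \<rho>' i) \<Longrightarrow>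
    sub \<sigma> \<rho> \<phi> = sub \<sigma>' \<rho>' \<phi>"
  unfolding fresh_def by blast

lemma ex_fresh2:
  assumes "\<exists>k. fresh k \<phi>" "\<exists>k. fresh k \<psi>"
  shows "\<exists>k. fresh k \<phi> \<and> fresh k \<psi>"
  using assms by (meson fresh_mono max.cobounded1 max.cobounded2)

lemma ex_tfresh2:
  "\<exists>k. \<forall>\<sigma> \<sigma>' \<rho> \<rho>'. (\<forall>i<k. \<sigma> i = \<sigma>' i \<and> \<rho> i = \<rho>' i) \<longrightarrow> tsub \<sigma> \<rho> s = tsub \<sigma>' \<rho>' s \<and> tsub \<sigma> \<rho> t = tsub \<sigma>' \<rho>' t"
  using tsub_cong_bound[of "s \<^bold>+ t"] by simp

lemma ex_fresh: "\<exists>k. fresh k \<phi>"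
proof (induction \<phi>)
  case (Le s t)
  then show ?case using ex_tfresh2[of s t] unfolding fresh_def sub.simps by blast
next
  case (EqN s t)
  then show ?case using ex_tfresh2[of s t] unfolding fresh_def sub.simps by blast
next
  case (EqS i j)
  show ?case unfolding fresh_def by (rule exI[of _ "Suc (i + j)"]) simp
next
  case (Mem t j)
  obtain k where "\<forall>\<sigma> \<sigma>' \<rho> \<rho>'. (\<forall>i<k. \<sigma> i = \<sigma>' i \<and> \<rho> i = \<rho>' i) \<longrightarrow> tsub \<sigma> \<rho> t = tsub \<sigma>' \<rho>' t"
    using tsub_cong_bound by blast
  then show ?case unfolding fresh_def by (intro exI[of _ "max k (Suc j)"]) (simp; blast)
next
  case (Imp \<phi> \<psi>)
  then obtain k where "fresh k \<phi>" "fresh k \<psi>" using ex_fresh2 by blast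
  then have "fresh k (Imp \<phi> \<psi>)" unfolding fresh_def sub.simps by metis
  then show ?case ..
next
  case (And \<phi> \<psi>)
  then obtain k where "fresh k \<phi>" "fresh k \<psi>" using ex_fresh2 by blast
  then have "fresh k (And \<phi> \<psi>)" unfolding fresh_def sub.simps by metis
  then show ?case ..
next
  case (Or \<phi> \<psi>)
  then obtain k where "fresh k \<phi>" "fresh k \<psi>" using ex_fresh2 by blast
  then have "fresh k (Or \<phi> \<psi>)" unfolding fresh_def sub.simps by metis
  then show ?case ..
next
  case (AllN \<phi>)
  then obtain k where "fresh k \<phi>" by blast
  then show ?case unfolding fresh_def[of _ "AllN _"]
    by (intro exI[of _ k] allI impI) (auto intro!: freshD[OF \<open>fresh k \<phi>\<close>] split: nat.split)
next
  case (ExN \<phi>)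
  then obtain k where "fresh k \<phi>" by blast
  then show ?case unfolding fresh_def[of _ "ExN _"]
    by (intro exI[of _ k] allI impI) (auto intro!: freshD[OF \<open>fresh k \<phi>\<close>] split: nat.split)
next
  case (AllS \<phi>)
  then obtain k where "fresh k \<phi>" by blast
  then show ?case unfolding fresh_def[of _ "AllS _"]
    by (intro exI[of _ k] allI impI) (auto intro!: freshD[OF \<open>fresh k \<phi>\<close>] split: nat.split)
next
  case (ExS \<phi>)
  then obtain k where "fresh k \<phi>" by blast
  then show ?case unfolding fresh_def[of _ "ExS _"]
    by (intro exI[of _ k] allI impI) (auto intro!: freshD[OF \<open>fresh k \<phi>\<close>] split: nat.split)
qed (auto simp: fresh_def)

lemma ex_fresh_list: "\<exists>k. \<forall>\<phi>\<in>set \<Gamma>. fresh k \<phi>"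
proof (induction \<Gamma>)
  case (Cons \<phi> \<Gamma>)
  then obtain k l where "fresh k \<phi>" "\<forall>\<psi>\<in>set \<Gamma>. fresh l \<psi>" using ex_fresh by blast
  then show ?case
    by (intro exI[of _ "max k l"]) (auto intro: fresh_mono)
qed simp


section \<open>Structural properties of derivations\<close>

lemma weakening: "T; \<Gamma> \<turnstile> \<phi> \<Longrightarrow> set \<Gamma> \<subseteq> set \<Delta> \<Longrightarrow> T; \<Delta> \<turnstile> \<phi>"
proof (induction arbitrary: \<Delta> rule: derives.induct)
  case (Hyp \<phi> \<Gamma>)
  then show ?case by (auto intro: derives.Hyp)
next
  case (Classical \<phi> \<Gamma>)
  show ?case by (rule derives.Classical, rule Classical.IH) (use Classical.prems in auto)
next
  case (ImpI \<phi> \<Gamma> \<psi>)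
  show ?case by (rule derives.ImpI, rule ImpI.IH) (use ImpI.prems in auto)
next
  case (ImpE \<Gamma> \<phi> \<psi>)
  then show ?case by (blast intro: derives.ImpE)
next
  case (AndE1 \<Gamma> \<phi> \<psi>)
  then show ?case by (blast intro: derives.AndE1)
next
  case (AndE2 \<Gamma> \<phi> \<psi>)
  then show ?case by (blast intro: derives.AndE2)
next
  case (OrE \<Gamma> \<phi> \<psi> \<chi>)
  show ?case by (rule derives.OrE[OF OrE.IH(1) OrE.IH(2) OrE.IH(3)]) (use OrE.prems in auto)
next
  case (AllNI \<Gamma> \<phi>)
  show ?case by (rule derives.AllNI, rule AllNI.IH) (use AllNI.prems in auto)
next
  case (AllNE \<Gamma> \<phi> t)
  then show ?case by (blast intro: derives.AllNE)
next
  case (ExNI \<Gamma> t \<phi>)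
  then show ?case by (blast intro: derives.ExNI)
next
  case (ExNE \<Gamma> \<phi> \<chi>)
  show ?case by (rule derives.ExNE[OF ExNE.IH(1) ExNE.IH(2)]) (use ExNE.prems in auto)
next
  case (AllSI \<Gamma> \<phi>)
  show ?case by (rule derives.AllSI, rule AllSI.IH) (use AllSI.prems in auto)
next
  case (AllSE \<Gamma> \<phi> j)
  then show ?case by (blast intro: derives.AllSE)
next
  case (ExSI \<Gamma> j \<phi>)
  then show ?case by (blast intro: derives.ExSI)
next
  case (ExSE \<Gamma> \<phi> \<chi>)
  show ?case by (rule derives.ExSE[OF ExSE.IH(1) ExSE.IH(2)]) (use ExSE.prems in auto)
next
  case (SubstN \<Gamma> s t \<phi>)
  show ?case by (rule derives.SubstN[OF SubstN.IH[OF SubstN.prems]])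
next
  case (SubstS \<Gamma> i j \<phi>)
  show ?case by (rule derives.SubstS[OF SubstS.IH[OF SubstS.prems]])
qed (simp_all add: derives.Ax derives.AndI derives.OrI1 derives.OrI2 derives.ReflN derives.ReflS)

text \<open>A quantifier rule instantiates one variable at a time, so a substitution is carried out
  in \<open>k\<close> rounds of generalising and instantiating variable 0. Each round lowers the
  remaining indices by one, whence the tail \<open>NVar (i - k)\<close>. Derivability in all
  contexts allows the generalisation, since shifted hypotheses are a context again.\<close>

lemma sub_cut_N:
  assumes "\<And>\<Gamma>. T; \<Gamma> \<turnstile> \<phi>"
  shows "T; \<Gamma> \<turnstile> sub (\<lambda>i. if i < k then \<sigma> i else NVar (i - k)) id \<phi>"
  using assms
proof (induction k arbitrary: \<sigma> \<phi> \<Gamma>)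
  case 0
  then show ?case by simp
next
  case (Suc k)
  \<comment> \<open>The \<open>k\<close> rounds that follow lower the variables of this term, so it
    is shifted up by \<open>k\<close> beforehand.\<close>
  have "T; \<Gamma> \<turnstile> instN (up k (\<sigma> 0)) \<phi>" for \<Gamma>
    by (rule derives.AllNE, rule derives.AllNI, rule Suc.prems)
  then have "T; \<Gamma> \<turnstile> sub (\<lambda>i. if i < k then \<sigma> (Suc i) else NVar (i - k)) id (instN (up k (\<sigma> 0)) \<phi>)"
    by (rule Suc.IH)
  moreover have "tsub (\<lambda>i. if i < k then \<sigma> (Suc i) else NVar (i - k)) id \<circ> case_nat (up k (\<sigma> 0)) NVar
      = (\<lambda>i. if i < Suc k then \<sigma> i else NVar (i - Suc k))"
  proof
    fix i
    show "(tsub (\<lambda>i. if i < k then \<sigma> (Suc i) else NVar (i - k)) id \<circ> case_nat (up k (\<sigma> 0)) NVar) i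
      = (if i < Suc k then \<sigma> i else NVar (i - Suc k))"
      by (cases i) (simp_all add: up_def tsub_tsub comp_def flip: id_def)
  qed
  ultimately show ?case by (simp only: instN_def sub_sub id_o)
qed

lemma sub_cut_S:
  assumes "\<And>\<Gamma>. T; \<Gamma> \<turnstile> \<phi>"
  shows "T; \<Gamma> \<turnstile> sub NVar (\<lambda>i. if i < k then \<rho> i else i - k) \<phi>"
  using assms
proof (induction k arbitrary: \<rho> \<phi> \<Gamma>)
  case 0
  have id: "(\<lambda>i. if i < 0 then \<rho> i else i - 0) = id" by auto
  show ?case unfolding id sub_id by (rule 0)
next
  case (Suc k)
  have "T; \<Gamma> \<turnstile> instS (\<rho> 0 + k) \<phi>" for \<Gamma>
    by (rule derives.AllSE, rule derives.AllSI, rule Suc.prems)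
  then have "T; \<Gamma> \<turnstile> sub NVar (\<lambda>i. if i < k then \<rho> (Suc i) else i - k) (instS (\<rho> 0 + k) \<phi>)"
    by (rule Suc.IH)
  moreover have "(\<lambda>i. if i < k then \<rho> (Suc i) else i - k) \<circ> case_nat (\<rho> 0 + k) id
      = (\<lambda>i. if i < Suc k then \<rho> i else i - Suc k)"
    by (auto simp: fun_eq_iff split: nat.split)
  moreover have "tsub NVar \<rho>' \<circ> NVar = NVar" for \<rho>' by auto
  ultimately show ?case by (simp add: instS_def sub_sub)
qed

text \<open>Axioms hold in every context, so their variables can be generalised and then instantiated.\<close>

lemma derives_axiom_sub:
  assumes "\<phi> \<in> T"
  shows "T; \<Gamma> \<turnstile> sub \<sigma> \<rho> \<phi>"
proof -
  obtain k where k: "fresh k \<phi>" using ex_fresh by blast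
  obtain l where l: "fresh l (sub NVar (\<lambda>i. if i < k then \<rho> i else i - k) \<phi>)" using ex_fresh by blast
  have "T; \<Gamma> \<turnstile> sub (\<lambda>i. if i < max k l then \<sigma> i else NVar (i - max k l)) id
      (sub NVar (\<lambda>i. if i < k then \<rho> i else i - k) \<phi>)"
    by (intro sub_cut_N sub_cut_S derives.Ax assms)
  also have "\<dots> = sub \<sigma> \<rho> \<phi>"
    unfolding sub_sub by (rule freshD[OF k]) (auto simp: comp_def)
  finally show ?thesis by simp
qed

lemma derives_sub: "T; \<Gamma> \<turnstile> \<phi> \<Longrightarrow> T; map (sub \<sigma> \<rho>) \<Gamma> \<turnstile> sub \<sigma> \<rho> \<phi>"
proof (induction arbitrary: \<sigma> \<rho> rule: derives.induct)
  case (Ax \<phi> \<Gamma>)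
  then show ?case by (rule derives_axiom_sub)
next
  case (Hyp \<phi> \<Gamma>)
  then show ?case by (auto intro: derives.Hyp)
next
  case (Classical \<phi> \<Gamma>)
  show ?case by (rule derives.Classical) (use Classical.IH[of \<sigma> \<rho>] in simp)
next
  case (ImpI \<phi> \<Gamma> \<psi>)
  then show ?case by (auto intro!: derives.ImpI)
next
  case (ImpE \<Gamma> \<phi> \<psi>)
  then show ?case by (metis derives.ImpE sub.simps(6))
next
  case (AndE1 \<Gamma> \<phi> \<psi>)
  then show ?case by (metis derives.AndE1 sub.simps(7))
next
  case (AndE2 \<Gamma> \<phi> \<psi>)
  then show ?case by (metis derives.AndE2 sub.simps(7))
next
  case (OrE \<Gamma> \<phi> \<psi> \<chi>)
  show ?case by (rule derives.OrE[of T _ "sub \<sigma> \<rho> \<phi>" "sub \<sigma> \<rho> \<psi>"]) (use OrE.IH[of \<sigma> \<rho>] in simp_all)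
next
  case (AllNI \<Gamma> \<phi>)
  show ?case unfolding sub.simps
    by (rule derives.AllNI) (use AllNI.IH[of "case_nat (NVar 0) (up 1 \<circ> \<sigma>)" \<rho>] in \<open>simp only: map_sub_liftN\<close>)
next
  case (AllNE \<Gamma> \<phi> t)
  show ?case unfolding sub_instN by (rule derives.AllNE) (use AllNE.IH[of \<sigma> \<rho>] in simp)
next
  case (ExNI \<Gamma> t \<phi>)
  show ?case unfolding sub.simps by (rule derives.ExNI) (use ExNI.IH[of \<sigma> \<rho>] in \<open>simp add: sub_instN\<close>)
next
  case (ExNE \<Gamma> \<phi> \<chi>)
  show ?case
    by (rule derives.ExNE[OF ExNE.IH(1)[of \<sigma> \<rho>, unfolded sub.simps]])
      (use ExNE.IH(2)[of "case_nat (NVar 0) (up 1 \<circ> \<sigma>)" \<rho>] in \<open>simp only: list.map(2) map_sub_liftN\<close>)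
next
  case (AllSI \<Gamma> \<phi>)
  show ?case unfolding sub.simps
    by (rule derives.AllSI) (use AllSI.IH[of "tsub NVar Suc \<circ> \<sigma>" "case_nat 0 (Suc \<circ> \<rho>)"] in \<open>simp only: map_sub_liftS\<close>)
next
  case (AllSE \<Gamma> \<phi> j)
  show ?case unfolding sub_instS by (rule derives.AllSE) (use AllSE.IH[of \<sigma> \<rho>] in simp)
next
  case (ExSI \<Gamma> j \<phi>)
  show ?case unfolding sub.simps by (rule derives.ExSI) (use ExSI.IH[of \<sigma> \<rho>] in \<open>simp add: sub_instS\<close>)
next
  case (ExSE \<Gamma> \<phi> \<chi>)
  show ?case
    by (rule derives.ExSE[OF ExSE.IH(1)[of \<sigma> \<rho>, unfolded sub.simps]])
      (use ExSE.IH(2)[of "tsub NVar Suc \<circ> \<sigma>" "case_nat 0 (Suc \<circ> \<rho>)"] in \<open>simp only: list.map(2) map_sub_liftS\<close>)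
next
  case (SubstN \<Gamma> s t \<phi>)
  then show ?case unfolding sub_instN
    by (metis derives.SubstN sub.simps(2))
next
  case (SubstS \<Gamma> i j \<phi>)
  then show ?case unfolding sub_instS
    by (metis derives.SubstS sub.simps(4))
qed (auto intro: derives.intros)

section \<open>Derived classical rules and fresh variables as witnesses\<close>

lemma cut: "T; \<phi> # \<Gamma> \<turnstile> \<psi> \<Longrightarrow> T; \<Gamma> \<turnstile> \<phi> \<Longrightarrow> T; \<Gamma> \<turnstile> \<psi>"
  by (meson derives.ImpE derives.ImpI)

lemma derives_NegI: "T; \<phi> # \<Gamma> \<turnstile> Fls \<Longrightarrow> T; \<Gamma> \<turnstile> \<^bold>\<not> \<phi>"
  unfolding Neg_def by (rule derives.ImpI)

lemma derives_NegE: "T; \<Gamma> \<turnstile> \<^bold>\<not> \<phi> \<Longrightarrow> T; \<Gamma> \<turnstile> \<phi> \<Longrightarrow> T; \<Gamma> \<turnstile> Fls"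
  unfolding Neg_def by (rule derives.ImpE)

lemma derives_FlsE: "T; \<Gamma> \<turnstile> Fls \<Longrightarrow> T; \<Gamma> \<turnstile> \<phi>"
  by (rule derives.Classical, erule weakening) auto

lemma liftN_Fls [simp]: "liftN Fls = Fls" by (simp add: liftN_def)
lemma liftS_Fls [simp]: "liftS Fls = Fls" by (simp add: liftS_def)

text \<open>The Henkin construction provides witnesses for existential formulas only. Through this
  duality a universal formula that fails gets a counterexample.\<close>

lemma derives_NegAllN:
  assumes "T; \<Gamma> \<turnstile> \<^bold>\<not> AllN \<phi>"
  shows "T; \<Gamma> \<turnstile> ExN (\<^bold>\<not> \<phi>)"
proof (rule derives.Classical)
  let ?G = "(\<^bold>\<not> ExN (\<^bold>\<not> \<phi>)) # \<Gamma>"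
  have "instN (NVar 0) (sub (case_nat (NVar 0) (up 1 \<circ> (NVar \<circ> Suc))) id (\<^bold>\<not> \<phi>)) = (\<^bold>\<not> \<phi>)"
  proof -
    have "case_nat (NVar 0) (NVar \<circ> Suc) = NVar"
      by (auto simp: fun_eq_iff split: nat.split)
    then show ?thesis unfolding instN_sub by simp
  qed
  then have *: "T; (\<^bold>\<not> \<phi>) # map liftN ?G \<turnstile> liftN (ExN (\<^bold>\<not> \<phi>))"
    unfolding liftN_def sub.simps by (intro derives.ExNI[of _ _ "NVar 0"] derives.Hyp) simp
  have "T; (\<^bold>\<not> \<phi>) # map liftN ?G \<turnstile> Fls"
    by (rule derives_NegE[OF _ *]) (simp add: derives.Hyp liftN_def)
  then have "T; ?G \<turnstile> AllN \<phi>"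
    by - (rule derives.AllNI, rule derives.Classical)
  moreover have "T; ?G \<turnstile> \<^bold>\<not> AllN \<phi>"
    using assms by (rule weakening) auto
  ultimately show "T; ?G \<turnstile> Fls" by (metis derives_NegE)
qed

lemma derives_NegAllS:
  assumes "T; \<Gamma> \<turnstile> \<^bold>\<not> AllS \<phi>"
  shows "T; \<Gamma> \<turnstile> ExS (\<^bold>\<not> \<phi>)"
proof (rule derives.Classical)
  let ?G = "(\<^bold>\<not> ExS (\<^bold>\<not> \<phi>)) # \<Gamma>"
  have "instS 0 (sub (tsub NVar Suc \<circ> NVar) (case_nat 0 (Suc \<circ> Suc)) (\<^bold>\<not> \<phi>)) = (\<^bold>\<not> \<phi>)"
    unfolding instS_sub by (simp add: case_nat_Suc)
  then have *: "T; (\<^bold>\<not> \<phi>) # map liftS ?G \<turnstile> liftS (ExS (\<^bold>\<not> \<phi>))"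
    unfolding liftS_def sub.simps by (intro derives.ExSI[of _ _ 0] derives.Hyp) simp
  have "T; (\<^bold>\<not> \<phi>) # map liftS ?G \<turnstile> Fls"
    by (rule derives_NegE[OF _ *]) (simp add: derives.Hyp liftS_def)
  then have "T; ?G \<turnstile> AllS \<phi>"
    by - (rule derives.AllSI, rule derives.Classical)
  moreover have "T; ?G \<turnstile> \<^bold>\<not> AllS \<phi>"
    using assms by (rule weakening) auto
  ultimately show "T; ?G \<turnstile> Fls" by (metis derives_NegE)
qed

text \<open>Variable \<open>k\<close> plays the role of a new constant. Renaming it to 0 and every
  other variable to its successor turns the hypotheses, which do not contain it, into their lifts,
  and the derivation into the second premise of \<open>ExNE\<close>.\<close>

lemma witness_N:
  assumes "\<forall>\<psi>\<in>set \<Gamma>. fresh k \<psi>" "fresh k \<chi>"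
    and "T; instN (NVar k) \<chi> # \<Gamma> \<turnstile> Fls" "T; \<Gamma> \<turnstile> ExN \<chi>"
  shows "T; \<Gamma> \<turnstile> Fls"
proof -
  let ?\<sigma> = "\<lambda>i. if i = k then NVar 0 else NVar (Suc i)"
  have "T; map (sub ?\<sigma> id) (instN (NVar k) \<chi> # \<Gamma>) \<turnstile> sub ?\<sigma> id Fls"
    using assms(3) by (rule derives_sub)
  moreover have "map (sub ?\<sigma> id) \<Gamma> = map liftN \<Gamma>"
    using assms(1) by (auto simp: liftN_def intro!: freshD)
  moreover have "sub ?\<sigma> id (instN (NVar k) \<chi>) = sub NVar id \<chi>"
    unfolding instN_def sub_sub using assms(2)
    by (rule freshD) (auto split: nat.split)
  ultimately have "T; \<chi> # map liftN \<Gamma> \<turnstile> liftN Fls" by simp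
  then show ?thesis by (rule derives.ExNE[OF assms(4)])
qed

lemma witness_S:
  assumes "\<forall>\<psi>\<in>set \<Gamma>. fresh k \<psi>" "fresh k \<chi>"
    and "T; instS k \<chi> # \<Gamma> \<turnstile> Fls" "T; \<Gamma> \<turnstile> ExS \<chi>"
  shows "T; \<Gamma> \<turnstile> Fls"
proof -
  let ?\<rho> = "\<lambda>i. if i = k then 0 else Suc i"
  have "T; map (sub NVar ?\<rho>) (instS k \<chi> # \<Gamma>) \<turnstile> sub NVar ?\<rho> Fls"
    using assms(3) by (rule derives_sub)
  moreover have "map (sub NVar ?\<rho>) \<Gamma> = map liftS \<Gamma>"
    using assms(1) by (auto simp: liftS_def intro!: freshD)
  moreover have "sub NVar ?\<rho> (instS k \<chi>) = sub NVar id \<chi>"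
    unfolding instS_def sub_sub using assms(2)
    by (rule freshD) (auto split: nat.split)
  ultimately have "T; \<chi> # map liftS \<Gamma> \<turnstile> liftS Fls" by simp
  then show ?thesis by (rule derives.ExSE[OF assms(4)])
qed


section \<open>Completeness\<close>

instance nterm :: countable
  by countable_datatype

instance form :: countable
  by countable_datatype

locale henkin_set =
  fixes T :: "form set" and H :: "form \<Rightarrow> bool"
  assumes H_derives: "(\<And>\<psi>. \<psi> \<in> set \<Delta> \<Longrightarrow> H \<psi>) \<Longrightarrow> T; \<Delta> \<turnstile> \<phi> \<Longrightarrow> H \<phi>"
    and H_Fls: "\<not> H Fls"
    and H_complete: "H \<phi> \<or> H (\<^bold>\<not> \<phi>)"
    and H_witness_N: "H (ExN \<phi>) \<Longrightarrow> \<exists>t. H (instN t \<phi>)"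
    and H_witness_S: "H (ExS \<phi>) \<Longrightarrow> \<exists>j. H (instS j \<phi>)"

lemma henkin_step:
  assumes "\<not> (T; \<Gamma> \<turnstile> Fls)"
  shows "\<exists>\<Delta>. \<not> (T; \<Delta> \<turnstile> Fls) \<and> set \<Gamma> \<subseteq> set \<Delta> \<and> (\<not> (T; \<psi> # \<Gamma> \<turnstile> Fls) \<longrightarrow> \<psi> \<in> set \<Delta> \<and>
    (\<forall>\<chi>. \<psi> = ExN \<chi> \<longrightarrow> (\<exists>t. instN t \<chi> \<in> set \<Delta>)) \<and> (\<forall>\<chi>. \<psi> = ExS \<chi> \<longrightarrow> (\<exists>j. instS j \<chi> \<in> set \<Delta>)))"
proof (cases "T; \<psi> # \<Gamma> \<turnstile> Fls")
  case True
  then show ?thesis using assms by blast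
next
  case False
  consider (N) \<chi> where "\<psi> = ExN \<chi>" | (S) \<chi> where "\<psi> = ExS \<chi>" | (other) "\<And>\<chi>. \<psi> \<noteq> ExN \<chi>" "\<And>\<chi>. \<psi> \<noteq> ExS \<chi>"
    by blast
  then show ?thesis
  proof cases
    case N
    obtain k where "\<forall>\<phi>\<in>set (\<chi> # \<psi> # \<Gamma>). fresh k \<phi>" using ex_fresh_list by blast
    moreover have "T; \<psi> # \<Gamma> \<turnstile> ExN \<chi>"
      using N by (simp add: derives.Hyp)
    ultimately have "\<not> (T; instN (NVar k) \<chi> # \<psi> # \<Gamma> \<turnstile> Fls)"
      using False witness_N[of "\<psi> # \<Gamma>" k \<chi> T] by auto
    then show ?thesis
      using N by (intro exI[of _ "instN (NVar k) \<chi> # \<psi> # \<Gamma>"]) auto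
  next
    case S
    obtain k where "\<forall>\<phi>\<in>set (\<chi> # \<psi> # \<Gamma>). fresh k \<phi>" using ex_fresh_list by blast
    moreover have "T; \<psi> # \<Gamma> \<turnstile> ExS \<chi>"
      using S by (simp add: derives.Hyp)
    ultimately have "\<not> (T; instS k \<chi> # \<psi> # \<Gamma> \<turnstile> Fls)"
      using False witness_S[of "\<psi> # \<Gamma>" k \<chi> T] by auto
    then show ?thesis
      using S by (intro exI[of _ "instS k \<chi> # \<psi> # \<Gamma>"]) auto
  next
    case other
    then show ?thesis
      using False by (intro exI[of _ "\<psi> # \<Gamma>"]) auto
  qed
qed

text \<open>Stage \<open>n\<close> treats the formula with number \<open>n\<close>: it is added if
  this is consistent, together with a witness. Stages are finite lists, so fresh variables of both
  sorts are left at each of them and serve as witnesses in place of new constants.\<close>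

lemma henkin_extension:
  assumes "\<not> (T; \<Gamma>\<^sub>0 \<turnstile> Fls)"
  obtains H where "henkin_set T H" "\<And>\<phi>. \<phi> \<in> set \<Gamma>\<^sub>0 \<Longrightarrow> H \<phi>"
proof -
  let ?Q = "\<lambda>n \<Gamma> \<Delta>. set \<Gamma> \<subseteq> set \<Delta> \<and> (\<not> (T; from_nat n # \<Gamma> \<turnstile> Fls) \<longrightarrow> from_nat n \<in> set \<Delta> \<and>
    (\<forall>\<chi>. from_nat n = ExN \<chi> \<longrightarrow> (\<exists>t. instN t \<chi> \<in> set \<Delta>)) \<and>
    (\<forall>\<chi>. from_nat n = ExS \<chi> \<longrightarrow> (\<exists>j. instS j \<chi> \<in> set \<Delta>)))"
  let ?P = "\<lambda>n \<Delta>. \<not> (T; \<Delta> \<turnstile> Fls) \<and> (n = 0 \<longrightarrow> \<Delta> = \<Gamma>\<^sub>0)"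
  have "\<exists>G. \<forall>n. ?P n (G n) \<and> ?Q n (G n) (G (Suc n))"
  proof (rule dependent_nat_choice)
    show "\<exists>\<Delta>. ?P 0 \<Delta>" using assms by blast
    show "\<exists>\<Delta>. ?P (Suc n) \<Delta> \<and> ?Q n \<Gamma> \<Delta>" if "?P n \<Gamma>" for n \<Gamma>
      using henkin_step[of T \<Gamma> "from_nat n"] that by auto
  qed
  then obtain G where "\<forall>n. ?P n (G n) \<and> ?Q n (G n) (G (Suc n))" ..
  then have G: "\<And>n. \<not> (T; G n \<turnstile> Fls)" "G 0 = \<Gamma>\<^sub>0"
    "\<And>n. set (G n) \<subseteq> set (G (Suc n))"
    "\<And>n. \<not> (T; from_nat n # G n \<turnstile> Fls) \<Longrightarrow> from_nat n \<in> set (G (Suc n))"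
    "\<And>n \<chi>. \<not> (T; from_nat n # G n \<turnstile> Fls) \<Longrightarrow> from_nat n = ExN \<chi> \<Longrightarrow> \<exists>t. instN t \<chi> \<in> set (G (Suc n))"
    "\<And>n \<chi>. \<not> (T; from_nat n # G n \<turnstile> Fls) \<Longrightarrow> from_nat n = ExS \<chi> \<Longrightarrow> \<exists>j. instS j \<chi> \<in> set (G (Suc n))"
    by metis+
  have mono: "set (G m) \<subseteq> set (G n)" if "m \<le> n" for m n
    using lift_Suc_mono_le[of "\<lambda>n. set (G n)", OF G(3) that] .
  define H where "H \<phi> \<longleftrightarrow> (\<exists>n. \<phi> \<in> set (G n))" for \<phi>
  \<comment> \<open>A contradiction at the stage of \<open>\<phi>\<close> would persist at all later
    stages, among them one at which \<open>\<phi>\<close> is derivable, and that stage would be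
    inconsistent.\<close>
  have added: "\<not> (T; from_nat (to_nat \<phi>) # G (to_nat \<phi>) \<turnstile> Fls)" if "T; G n \<turnstile> \<phi>" for n and \<phi> :: form
  proof
    let ?k = "max n (to_nat \<phi>)"
    assume "T; from_nat (to_nat \<phi>) # G (to_nat \<phi>) \<turnstile> Fls"
    then have "T; \<phi> # G ?k \<turnstile> Fls"
      by (rule weakening) (use mono[of "to_nat \<phi>" ?k] in auto)
    moreover have "T; G ?k \<turnstile> \<phi>"
      using that by (rule weakening) (use mono[of n ?k] in auto)
    ultimately show False using cut G(1) by blast
  qed
  have closed: "H \<phi>" if "T; G n \<turnstile> \<phi>" for n \<phi>
    using G(4)[OF added[OF that]] unfolding H_def by auto
  have H_hyp: "T; G n \<turnstile> \<phi>" if "\<phi> \<in> set (G n)" for n \<phi>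
    using that by (rule derives.Hyp)
  have "henkin_set T H"
  proof
    fix \<Delta> \<phi>
    assume hyps: "\<And>\<psi>. \<psi> \<in> set \<Delta> \<Longrightarrow> H \<psi>" and d: "T; \<Delta> \<turnstile> \<phi>"
    from hyps have "\<exists>n. set \<Delta> \<subseteq> set (G n)"
    proof (induction \<Delta>)
      case (Cons \<psi> \<Delta>)
      then have "\<exists>n. set \<Delta> \<subseteq> set (G n)" "H \<psi>" by auto
      then obtain m n where "set \<Delta> \<subseteq> set (G m)" "\<psi> \<in> set (G n)"
        unfolding H_def by blast
      then show ?case
        using mono[of m "max m n"] mono[of n "max m n"] by (intro exI[of _ "max m n"]) auto
    qed simp
    then show "H \<phi>" using weakening[OF d] closed by blast
  next
    show "\<not> H Fls" unfolding H_def using G(1) by (auto dest: H_hyp)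
  next
    fix \<phi>
    show "H \<phi> \<or> H (\<^bold>\<not> \<phi>)"
    proof (cases "T; \<phi> # G (to_nat \<phi>) \<turnstile> Fls")
      case True
      then show ?thesis using closed[OF derives_NegI] by blast
    next
      case False
      then show ?thesis using G(4)[of "to_nat \<phi>"] by (auto simp: H_def)
    qed
  next
    fix \<phi>
    assume "H (ExN \<phi>)"
    then obtain n where "T; G n \<turnstile> ExN \<phi>" by (auto simp: H_def intro: H_hyp)
    from G(5)[OF added[OF this]] show "\<exists>t. H (instN t \<phi>)" by (auto simp: H_def)
  next
    fix \<phi>
    assume "H (ExS \<phi>)"
    then obtain n where "T; G n \<turnstile> ExS \<phi>" by (auto simp: H_def intro: H_hyp)
    from G(6)[OF added[OF this]] show "\<exists>j. H (instS j \<phi>)" by (auto simp: H_def)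
  qed
  then show thesis
    using that[of H] G(2) unfolding H_def by metis
qed

context henkin_set
begin

lemma H_axiom_sub: "\<phi> \<in> T \<Longrightarrow> H (sub \<sigma> \<rho> \<phi>)"
  using H_derives[of "[]"] derives_axiom_sub by simp

lemma H_1: "H \<phi> \<Longrightarrow> T; [\<phi>] \<turnstile> \<psi> \<Longrightarrow> H \<psi>"
  using H_derives[of "[\<phi>]"] by simp

lemma H_2: "H \<phi> \<Longrightarrow> H \<psi> \<Longrightarrow> T; [\<phi>, \<psi>] \<turnstile> \<chi> \<Longrightarrow> H \<chi>"
  using H_derives[of "[\<phi>, \<psi>]" \<chi>] by auto

lemma H_mp: "H (\<phi> \<^bold>\<rightarrow> \<psi>) \<Longrightarrow> H \<phi> \<Longrightarrow> H \<psi>"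
  by (erule H_2, assumption, rule derives.ImpE[of _ _ \<phi>]) (simp_all add: derives.Hyp)

lemma H_Neg: "H (\<^bold>\<not> \<phi>) \<longleftrightarrow> \<not> H \<phi>"
  using H_complete[of \<phi>] H_Fls H_mp[of \<phi> Fls] unfolding Neg_def by blast

lemma H_Imp: "H (\<phi> \<^bold>\<rightarrow> \<psi>) \<longleftrightarrow> (H \<phi> \<longrightarrow> H \<psi>)"
proof -
  have "H (\<phi> \<^bold>\<rightarrow> \<psi>)" if "H \<psi>"
    using that by (rule H_1) (simp add: derives.ImpI derives.Hyp)
  moreover have "H (\<phi> \<^bold>\<rightarrow> \<psi>)" if "H (\<^bold>\<not> \<phi>)"
    using that by (rule H_1)
      (rule derives.ImpI, rule derives_FlsE, rule derives_NegE[of _ _ \<phi>]; simp add: derives.Hyp)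
  ultimately show ?thesis using H_mp H_Neg by blast
qed

lemma H_And: "H (\<phi> \<^bold>\<and> \<psi>) \<longleftrightarrow> H \<phi> \<and> H \<psi>"
proof -
  have hyp: "T; [\<phi> \<^bold>\<and> \<psi>] \<turnstile> \<phi> \<^bold>\<and> \<psi>" by (simp add: derives.Hyp)
  have "H \<phi>" "H \<psi>" if "H (\<phi> \<^bold>\<and> \<psi>)"
    using H_1[OF that] derives.AndE1[OF hyp] derives.AndE2[OF hyp] by blast+
  moreover have "H (\<phi> \<^bold>\<and> \<psi>)" if "H \<phi>" "H \<psi>"
    using that by (rule H_2) (simp add: derives.AndI derives.Hyp)
  ultimately show ?thesis by blast
qed

lemma H_Or: "H (\<phi> \<^bold>\<or> \<psi>) \<longleftrightarrow> H \<phi> \<or> H \<psi>"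
proof -
  have "H (\<phi> \<^bold>\<or> \<psi>)" if "H \<phi>"
    using that by (rule H_1) (simp add: derives.OrI1 derives.Hyp)
  moreover have "H (\<phi> \<^bold>\<or> \<psi>)" if "H \<psi>"
    using that by (rule H_1) (simp add: derives.OrI2 derives.Hyp)
  moreover have False if "H (\<phi> \<^bold>\<or> \<psi>)" "H (\<^bold>\<not> \<phi>)" "H (\<^bold>\<not> \<psi>)"
  proof -
    let ?G = "[\<phi> \<^bold>\<or> \<psi>, \<^bold>\<not> \<phi>, \<^bold>\<not> \<psi>]"
    have "T; ?G \<turnstile> Fls"
    proof (rule derives.OrE[of T ?G \<phi> \<psi>])
      show "T; \<phi> # ?G \<turnstile> Fls" by (rule derives_NegE[of _ _ \<phi>]) (simp_all add: derives.Hyp)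
      show "T; \<psi> # ?G \<turnstile> Fls" by (rule derives_NegE[of _ _ \<psi>]) (simp_all add: derives.Hyp)
    qed (simp add: derives.Hyp)
    then show False using H_derives[of ?G Fls] that H_Fls by auto
  qed
  ultimately show ?thesis using H_Neg by blast
qed

lemma H_AllN: "H (AllN \<phi>) \<longleftrightarrow> (\<forall>t. H (instN t \<phi>))"
proof
  assume "H (AllN \<phi>)"
  then show "\<forall>t. H (instN t \<phi>)"
    using H_1[OF _ derives.AllNE[OF derives.Hyp]] by simp
next
  assume *: "\<forall>t. H (instN t \<phi>)"
  show "H (AllN \<phi>)"
  proof (rule ccontr)
    assume "\<not> H (AllN \<phi>)"
    then have "H (\<^bold>\<not> AllN \<phi>)" by (simp add: H_Neg)
    then have "H (ExN (\<^bold>\<not> \<phi>))" by (rule H_1) (simp add: derives_NegAllN derives.Hyp)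
    then obtain t where "H (instN t (\<^bold>\<not> \<phi>))" using H_witness_N by blast
    then show False using * by (simp add: instN_def H_Neg)
  qed
qed

lemma H_AllS: "H (AllS \<phi>) \<longleftrightarrow> (\<forall>j. H (instS j \<phi>))"
proof
  assume "H (AllS \<phi>)"
  then show "\<forall>t. H (instS t \<phi>)"
    using H_1[OF _ derives.AllSE[OF derives.Hyp]] by simp
next
  assume *: "\<forall>t. H (instS t \<phi>)"
  show "H (AllS \<phi>)"
  proof (rule ccontr)
    assume "\<not> H (AllS \<phi>)"
    then have "H (\<^bold>\<not> AllS \<phi>)" by (simp add: H_Neg)
    then have "H (ExS (\<^bold>\<not> \<phi>))" by (rule H_1) (simp add: derives_NegAllS derives.Hyp)
    then obtain t where "H (instS t (\<^bold>\<not> \<phi>))" using H_witness_S by blast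
    then show False using * by (simp add: instS_def H_Neg)
  qed
qed

lemma H_ExN: "H (ExN \<phi>) \<longleftrightarrow> (\<exists>t. H (instN t \<phi>))"
proof
  assume "\<exists>t. H (instN t \<phi>)"
  then obtain t where "H (instN t \<phi>)" ..
  then show "H (ExN \<phi>)"
    by (rule H_1) (rule derives.ExNI[of _ _ t], simp add: derives.Hyp)
qed (rule H_witness_N)

lemma H_ExS: "H (ExS \<phi>) \<longleftrightarrow> (\<exists>j. H (instS j \<phi>))"
proof
  assume "\<exists>j. H (instS j \<phi>)"
  then obtain j where "H (instS j \<phi>)" ..
  then show "H (ExS \<phi>)"
    by (rule H_1) (rule derives.ExSI[of _ _ j], simp add: derives.Hyp)
qed (rule H_witness_S)

lemma H_refl: "H (t \<^bold>= t)"
  using H_derives[of "[]"] derives.ReflN by simp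

lemma H_subst: "H (s \<^bold>= t) \<Longrightarrow> H (instN s \<phi>) \<Longrightarrow> H (instN t \<phi>)"
  by (erule H_2, assumption, rule derives.SubstN[of _ _ s]) (simp_all add: derives.Hyp)

lemma instN_simps [simp]:
  "instN s (t \<^bold>= u) = (tsub (case_nat s NVar) id t \<^bold>= tsub (case_nat s NVar) id u)"
  "instN s (t \<^bold>\<le> u) = (tsub (case_nat s NVar) id t \<^bold>\<le> tsub (case_nat s NVar) id u)"
  "instN s (t \<^bold>\<in> i) = (tsub (case_nat s NVar) id t \<^bold>\<in> i)"
  "tsub (case_nat s NVar) id (up 1 t) = t"
  by (simp_all add: instN_def up_1 tsub_tsub comp_def)

lemma H_sym: "H (s \<^bold>= t) \<Longrightarrow> H (t \<^bold>= s)"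
  using H_subst[of s t "NVar 0 \<^bold>= up 1 s"] H_refl by simp

lemma H_trans: "H (s \<^bold>= t) \<Longrightarrow> H (t \<^bold>= u) \<Longrightarrow> H (s \<^bold>= u)"
  using H_subst[of t u "up 1 s \<^bold>= NVar 0"] by simp

lemma H_add: "H (s \<^bold>= s') \<Longrightarrow> H (t \<^bold>= t') \<Longrightarrow> H (s \<^bold>+ t \<^bold>= s' \<^bold>+ t')"
  using H_subst[of s s' "up 1 s \<^bold>+ up 1 t \<^bold>= NVar 0 \<^bold>+ up 1 t"]
    H_subst[of t t' "up 1 s \<^bold>+ up 1 t \<^bold>= up 1 s' \<^bold>+ NVar 0"] H_refl by simp

lemma H_mul: "H (s \<^bold>= s') \<Longrightarrow> H (t \<^bold>= t') \<Longrightarrow> H (s \<^bold>* t \<^bold>= s' \<^bold>* t')"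
  using H_subst[of s s' "up 1 s \<^bold>* up 1 t \<^bold>= NVar 0 \<^bold>* up 1 t"]
    H_subst[of t t' "up 1 s \<^bold>* up 1 t \<^bold>= up 1 s' \<^bold>* NVar 0"] H_refl by simp

lemma H_le: "H (s \<^bold>= s') \<Longrightarrow> H (t \<^bold>= t') \<Longrightarrow> H (s \<^bold>\<le> t) \<Longrightarrow> H (s' \<^bold>\<le> t')"
  using H_subst[of s s' "NVar 0 \<^bold>\<le> up 1 t"] H_subst[of t t' "up 1 s' \<^bold>\<le> NVar 0"] by simp

lemma H_mem: "H (s \<^bold>= s') \<Longrightarrow> H (s \<^bold>\<in> j) \<Longrightarrow> H (s' \<^bold>\<in> j)"
  using H_subst[of s s' "NVar 0 \<^bold>\<in> j"] by simp

end

section \<open>Two-sorted structures and the term model\<close>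

record ('a, 's) model =
  m_zero :: 'a
  m_one :: 'a
  m_add :: "'a \<Rightarrow> 'a \<Rightarrow> 'a"
  m_mul :: "'a \<Rightarrow> 'a \<Rightarrow> 'a"
  m_le :: "'a \<Rightarrow> 'a \<Rightarrow> bool"
  m_eq :: "'a \<Rightarrow> 'a \<Rightarrow> bool"
  m_len :: "'s \<Rightarrow> 'a"
  m_seq :: "'s \<Rightarrow> 's \<Rightarrow> bool"
  m_mem :: "'a \<Rightarrow> 's \<Rightarrow> bool"

primrec tval :: "('a, 's) model \<Rightarrow> (nat \<Rightarrow> 's) \<Rightarrow> (nat \<Rightarrow> 'a) \<Rightarrow> nterm \<Rightarrow> 'a" where
  "tval M \<mu> \<nu> (NVar i) = \<nu> i"
| "tval M \<mu> \<nu> Zero = m_zero M"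
| "tval M \<mu> \<nu> One = m_one M"
| "tval M \<mu> \<nu> (s \<^bold>+ t) = m_add M (tval M \<mu> \<nu> s) (tval M \<mu> \<nu> t)"
| "tval M \<mu> \<nu> (s \<^bold>* t) = m_mul M (tval M \<mu> \<nu> s) (tval M \<mu> \<nu> t)"
| "tval M \<mu> \<nu> (Len i) = m_len M (\<mu> i)"

primrec sat :: "('a, 's) model \<Rightarrow> (nat \<Rightarrow> 's) \<Rightarrow> (nat \<Rightarrow> 'a) \<Rightarrow> form \<Rightarrow> bool" where
  "sat M \<mu> \<nu> Fls \<longleftrightarrow> False"
| "sat M \<mu> \<nu> (s \<^bold>= t) \<longleftrightarrow> m_eq M (tval M \<mu> \<nu> s) (tval M \<mu> \<nu> t)"
| "sat M \<mu> \<nu> (s \<^bold>\<le> t) \<longleftrightarrow> m_le M (tval M \<mu> \<nu> s) (tval M \<mu> \<nu> t)"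
| "sat M \<mu> \<nu> (EqS i j) \<longleftrightarrow> m_seq M (\<mu> i) (\<mu> j)"
| "sat M \<mu> \<nu> (t \<^bold>\<in> i) \<longleftrightarrow> m_mem M (tval M \<mu> \<nu> t) (\<mu> i)"
| "sat M \<mu> \<nu> (\<phi> \<^bold>\<rightarrow> \<psi>) \<longleftrightarrow> (sat M \<mu> \<nu> \<phi> \<longrightarrow> sat M \<mu> \<nu> \<psi>)"
| "sat M \<mu> \<nu> (\<phi> \<^bold>\<and> \<psi>) \<longleftrightarrow> sat M \<mu> \<nu> \<phi> \<and> sat M \<mu> \<nu> \<psi>"
| "sat M \<mu> \<nu> (\<phi> \<^bold>\<or> \<psi>) \<longleftrightarrow> sat M \<mu> \<nu> \<phi> \<or> sat M \<mu> \<nu> \<psi>"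
| "sat M \<mu> \<nu> (AllN \<phi>) \<longleftrightarrow> (\<forall>a. sat M \<mu> (case_nat a \<nu>) \<phi>)"
| "sat M \<mu> \<nu> (ExN \<phi>) \<longleftrightarrow> (\<exists>a. sat M \<mu> (case_nat a \<nu>) \<phi>)"
| "sat M \<mu> \<nu> (AllS \<phi>) \<longleftrightarrow> (\<forall>X. sat M (case_nat X \<mu>) \<nu> \<phi>)"
| "sat M \<mu> \<nu> (ExS \<phi>) \<longleftrightarrow> (\<exists>X. sat M (case_nat X \<mu>) \<nu> \<phi>)"

definition congruent_model :: "('a, 's) model \<Rightarrow> bool" where
  "congruent_model M \<longleftrightarrow> equivp (m_eq M) \<and>
     (\<forall>a a' b b'. m_eq M a a' \<and> m_eq M b b' \<longrightarrow>
        m_eq M (m_add M a b) (m_add M a' b') \<and> m_eq M (m_mul M a b) (m_mul M a' b') \<and>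
        (m_le M a b \<longrightarrow> m_le M a' b')) \<and>
     (\<forall>a a' X. m_eq M a a' \<and> m_mem M a X \<longrightarrow> m_mem M a' X)"

definition models :: "('a, 's) model \<Rightarrow> form set \<Rightarrow> bool" where
  "models M T \<longleftrightarrow> (\<forall>\<phi>\<in>T. \<forall>\<mu> \<nu>. sat M \<mu> \<nu> \<phi>)"

text \<open>In the term model numbers are the terms and sets are the set variables. An assignment is
  then a substitution, and a formula is true if its substituted form is in \<open>H\<close>.
  Equality stays the relation given by \<open>H\<close>.\<close>

theorem completeness:
  assumes "\<not> proves T \<chi>"
  obtains M :: "(nterm, nat) model" and \<mu> \<nu>
  where "congruent_model M" "models M T" "\<not> sat M \<mu> \<nu> \<chi>"
proof -
  have "\<not> (T; [\<^bold>\<not> \<chi>] \<turnstile> Fls)"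
    using assms derives.Classical unfolding proves_def by blast
  then obtain H where "henkin_set T H" and \<chi>: "H (\<^bold>\<not> \<chi>)"
    by (rule henkin_extension) auto
  interpret henkin_set T H by fact
  define M :: "(nterm, nat) model" where
    "M = \<lparr>m_zero = Zero, m_one = One, m_add = Add, m_mul = Mul, m_le = (\<lambda>s t. H (s \<^bold>\<le> t)),
       m_eq = (\<lambda>s t. H (s \<^bold>= t)), m_len = Len, m_seq = (\<lambda>i j. H (EqS i j)), m_mem = (\<lambda>t i. H (t \<^bold>\<in> i))\<rparr>"
  have tval: "tval M \<mu> \<nu> t = tsub \<nu> \<mu> t" for \<mu> \<nu> t
    by (induction t) (simp_all add: M_def)
  have sat: "sat M \<mu> \<nu> \<phi> \<longleftrightarrow> H (sub \<nu> \<mu> \<phi>)" for \<mu> \<nu> \<phi>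
    by (induction \<phi> arbitrary: \<mu> \<nu>)
      (simp_all add: tval H_Fls H_Imp H_And H_Or H_AllN H_ExN H_AllS H_ExS instN_sub instS_sub,
        simp_all add: M_def)
  have "equivp (m_eq M)"
    by (rule equivpI) (auto simp: M_def reflp_def symp_def transp_def intro: H_refl H_sym H_trans)
  then have "congruent_model M"
    unfolding congruent_model_def by (auto simp: M_def intro: H_add H_mul H_le H_mem)
  moreover have "models M T"
    unfolding models_def sat using H_axiom_sub by blast
  moreover have "\<not> sat M id NVar \<chi>"
    using \<chi> unfolding sat by (simp add: H_Neg)
  ultimately show thesis by (rule that)
qed

declare One_nat_def [simp]


section \<open>Models of \<open>V\<^sup>0\<close>\<close>

lemma tval_tsub: "tval M \<mu> \<nu> (tsub \<sigma> \<rho> t) = tval M (\<mu> \<circ> \<rho>) (\<lambda>i. tval M \<mu> \<nu> (\<sigma> i)) t"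
  by (induction t) auto

lemma tval_up: "tval M \<mu> \<nu> (up k t) = tval M \<mu> (\<lambda>i. \<nu> (i + k)) t"
  by (simp add: up_def tval_tsub)

lemma sat_sub: "sat M \<mu> \<nu> (sub \<sigma> \<rho> \<phi>) = sat M (\<mu> \<circ> \<rho>) (\<lambda>i. tval M \<mu> \<nu> (\<sigma> i)) \<phi>"
proof (induction \<phi> arbitrary: \<mu> \<nu> \<sigma> \<rho>)
  case (AllN \<phi>)
  have "(\<lambda>i. tval M \<mu> (case_nat a \<nu>) (case_nat (NVar 0) (up 1 \<circ> \<sigma>) i)) = case_nat a (\<lambda>i. tval M \<mu> \<nu> (\<sigma> i))" for a
    by (auto simp: fun_eq_iff tval_up split: nat.split)
  then show ?case by (simp add: AllN del: One_nat_def)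
next
  case (ExN \<phi>)
  have "(\<lambda>i. tval M \<mu> (case_nat a \<nu>) (case_nat (NVar 0) (up 1 \<circ> \<sigma>) i)) = case_nat a (\<lambda>i. tval M \<mu> \<nu> (\<sigma> i))" for a
    by (auto simp: fun_eq_iff tval_up split: nat.split)
  then show ?case by (simp add: ExN del: One_nat_def)
next
  case (AllS \<phi>)
  have "case_nat X \<mu> \<circ> case_nat 0 (Suc \<circ> \<rho>) = case_nat X (\<mu> \<circ> \<rho>)" "case_nat X \<mu> \<circ> Suc = \<mu>" for X
    by (auto simp: fun_eq_iff split: nat.split)
  then show ?case by (simp add: AllS tval_tsub comp_def)
next
  case (ExS \<phi>)
  have "case_nat X \<mu> \<circ> case_nat 0 (Suc \<circ> \<rho>) = case_nat X (\<mu> \<circ> \<rho>)" "case_nat X \<mu> \<circ> Suc = \<mu>" for X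
    by (auto simp: fun_eq_iff split: nat.split)
  then show ?case by (simp add: ExS tval_tsub comp_def)
qed (simp_all add: tval_tsub)

lemma sat_liftS: "sat M (case_nat X \<mu>) \<nu> (liftS \<phi>) = sat M \<mu> \<nu> \<phi>"
  by (simp add: liftS_def sat_sub comp_def)

lemma sat_BAll [simp]:
  "sat M \<mu> \<nu> (BAll t \<phi>) \<longleftrightarrow> (\<forall>a. m_le M a (tval M \<mu> \<nu> t) \<longrightarrow> sat M \<mu> (case_nat a \<nu>) \<phi>)"
  by (simp add: BAll_def tval_up)

lemma sat_BEx [simp]:
  "sat M \<mu> \<nu> (BEx t \<phi>) \<longleftrightarrow> (\<exists>a. m_le M a (tval M \<mu> \<nu> t) \<and> sat M \<mu> (case_nat a \<nu>) \<phi>)"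
  by (simp add: BEx_def tval_up)

lemma sat_abbrevs [simp]:
  "sat M \<mu> \<nu> (\<^bold>\<not> \<phi>) \<longleftrightarrow> \<not> sat M \<mu> \<nu> \<phi>"
  "sat M \<mu> \<nu> (\<phi> \<^bold>\<leftrightarrow> \<psi>) \<longleftrightarrow> (sat M \<mu> \<nu> \<phi> \<longleftrightarrow> sat M \<mu> \<nu> \<psi>)"
  "sat M \<mu> \<nu> (s \<^bold>< t) \<longleftrightarrow> m_le M (tval M \<mu> \<nu> s) (tval M \<mu> \<nu> t) \<and> \<not> m_eq M (tval M \<mu> \<nu> s) (tval M \<mu> \<nu> t)"
  by (auto simp: Neg_def Iff_def Lt_def)

lemma sat_comprehension:
  "sat M \<mu> (case_nat a \<nu>) (comprehension \<phi>) \<longleftrightarrow>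
    (\<exists>X. m_le M (m_len M X) a \<and> (\<forall>z. m_le M z a \<and> \<not> m_eq M z a \<longrightarrow>
      (m_mem M z X \<longleftrightarrow> sat M \<mu> (case_nat z (case_nat a \<nu>)) \<phi>)))"
  by (simp add: comprehension_def sat_liftS)

lemma
  assumes "congruent_model M" and "\<And>i. m_eq M (\<nu> i) (\<nu>' i)"
  shows tval_cong: "m_eq M (tval M \<mu> \<nu> t) (tval M \<mu> \<nu>' t)"
    and sat_cong: "sat M \<mu> \<nu> \<phi> \<longleftrightarrow> sat M \<mu> \<nu>' \<phi>"
proof -
  have e: "equivp (m_eq M)"
    and c: "m_eq M a a' \<Longrightarrow> m_eq M b b' \<Longrightarrow> m_eq M (m_add M a b) (m_add M a' b')"
      "m_eq M a a' \<Longrightarrow> m_eq M b b' \<Longrightarrow> m_eq M (m_mul M a b) (m_mul M a' b')"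
      "m_eq M a a' \<Longrightarrow> m_eq M b b' \<Longrightarrow> m_le M a b \<Longrightarrow> m_le M a' b'"
      "m_eq M a a' \<Longrightarrow> m_mem M a X \<Longrightarrow> m_mem M a' X" for a a' b b' X
    using assms(1) unfolding congruent_model_def by blast+
  have refl: "m_eq M a a" for a using e by (rule equivp_reflp)
  have t: "m_eq M (tval M \<mu> \<nu> t) (tval M \<mu> \<nu>' t)" if "\<And>i. m_eq M (\<nu> i) (\<nu>' i)" for \<mu> \<nu> \<nu>' t
    using that by (induction t) (auto intro: c refl)
  then show "m_eq M (tval M \<mu> \<nu> t) (tval M \<mu> \<nu>' t)" using assms(2) .
  have env: "m_eq M (case_nat a \<nu> i) (case_nat a \<nu>' i)" if "\<And>i. m_eq M (\<nu> i) (\<nu>' i)" for a \<nu> \<nu>' i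
    using that refl by (cases i) auto
  show "sat M \<mu> \<nu> \<phi> \<longleftrightarrow> sat M \<mu> \<nu>' \<phi>"
    using assms(2)
  proof (induction \<phi> arbitrary: \<mu> \<nu> \<nu>')
    case (EqN s u)
    then show ?case using t[of \<nu> \<nu>' \<mu> s] t[of \<nu> \<nu>' \<mu> u] e
      by simp (meson equivp_symp equivp_transp)
  next
    case (Le s u)
    then show ?case using t[of \<nu> \<nu>' \<mu> s] t[of \<nu> \<nu>' \<mu> u] e c(3)
      by simp (meson equivp_symp)
  next
    case (Mem s i)
    then show ?case using t[of \<nu> \<nu>' \<mu> s] e c(4)
      by simp (meson equivp_symp)
  next
    case (Imp \<phi> \<psi>)
    show ?case using Imp.IH(1)[of \<nu> \<nu>' \<mu>] Imp.IH(2)[of \<nu> \<nu>' \<mu>] Imp.prems by simp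
  next
    case (And \<phi> \<psi>)
    show ?case using And.IH(1)[of \<nu> \<nu>' \<mu>] And.IH(2)[of \<nu> \<nu>' \<mu>] And.prems by simp
  next
    case (Or \<phi> \<psi>)
    show ?case using Or.IH(1)[of \<nu> \<nu>' \<mu>] Or.IH(2)[of \<nu> \<nu>' \<mu>] Or.prems by simp
  next
    case (AllN \<phi>)
    show ?case using AllN.IH[OF env[OF AllN.prems]] by simp
  next
    case (ExN \<phi>)
    show ?case using ExN.IH[OF env[OF ExN.prems]] by simp
  next
    case (AllS \<phi>)
    show ?case using AllS.IH[OF AllS.prems] by simp
  next
    case (ExS \<phi>)
    show ?case using ExS.IH[OF ExS.prems] by simp
  qed simp_all
qed

text \<open>
  The standard model. The types of numbers and of ring elements are defined from a chosen model and need
  one in any case, also if the theorem is provable and has no countermodel.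
\<close>

primrec sval :: "nterm \<Rightarrow> nat" where
  "sval (NVar i) = i"
| "sval Zero = 0"
| "sval One = 1"
| "sval (s \<^bold>+ t) = sval s + sval t"
| "sval (s \<^bold>* t) = sval s * sval t"
| "sval (Len i) = (if set_decode i = {} then 0 else Suc (Max (set_decode i)))"

text \<open>The carriers are those of the term model. A term stands for its value, with
  \<open>NVar i\<close> as a name of the number \<open>i\<close>, and a natural number stands for
  the finite set of positions of the digit 1 in its binary expansion.\<close>

definition std_model :: "(nterm, nat) model" where
  "std_model = \<lparr>m_zero = Zero, m_one = One, m_add = Add, m_mul = Mul, m_le = (\<lambda>s t. sval s \<le> sval t),
     m_eq = (\<lambda>s t. sval s = sval t), m_len = Len, m_seq = (=), m_mem = (\<lambda>t i. sval t \<in> set_decode i)\<rparr>"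

lemma std_model_simps [simp]:
  "m_zero std_model = Zero" "m_one std_model = One" "m_add std_model = Add" "m_mul std_model = Mul"
  "m_le std_model s t \<longleftrightarrow> sval s \<le> sval t" "m_eq std_model s t \<longleftrightarrow> sval s = sval t" "m_len std_model = Len"
  "m_seq std_model = (=)" "m_mem std_model t i \<longleftrightarrow> sval t \<in> set_decode i"
  by (simp_all add: std_model_def)

lemma std_model_congruent: "congruent_model std_model"
  by (auto simp: congruent_model_def intro!: equivpI reflpI sympI transpI)

lemma std_model_comprehension: "sat std_model \<mu> \<nu> (comprehension \<phi>)"
proof -
  let ?P = "\<lambda>z. sat std_model \<mu> (case_nat z \<nu>) \<phi>"
  define A where "A = {z. z < sval (\<nu> 0) \<and> ?P (NVar z)}"
  have A: "set_decode (set_encode A) = A" "finite A"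
    by (simp_all add: A_def)
  \<comment> \<open>\<open>A\<close> collects values, while the formula is evaluated at terms; by
    congruence \<open>z\<close> can be replaced by the name of its value.\<close>
  have mem: "sval z \<in> A \<longleftrightarrow> ?P z" if "sval z < sval (\<nu> 0)" for z
  proof -
    have "?P z \<longleftrightarrow> ?P (NVar (sval z))"
      by (rule sat_cong[OF std_model_congruent]) (auto split: nat.split)
    then show ?thesis using that by (simp add: A_def)
  qed
  have "Max A < sval (\<nu> 0)" if "A \<noteq> {}"
    using Max_in[OF A(2) that] by (auto simp: A_def)
  then have len: "sval (Len (set_encode A)) \<le> sval (\<nu> 0)"
    by (simp add: A(1) Suc_le_eq)
  have \<nu>: "case_nat (\<nu> 0) (\<lambda>i. \<nu> (Suc i)) = \<nu>"
    by (auto simp: fun_eq_iff split: nat.split)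
  have "sat std_model \<mu> (case_nat (\<nu> 0) (\<lambda>i. \<nu> (Suc i))) (comprehension \<phi>)"
    unfolding sat_comprehension unfolding \<nu>
    by (rule exI[of _ "set_encode A"]) (simp add: A(1) mem len del: sval.simps(6))
  then show ?thesis by (simp add: \<nu>)
qed

lemma std_model_two_BASIC:
  assumes "\<phi> \<in> two_BASIC"
  shows "sat std_model \<mu> \<nu> \<phi>"
proof -
  have mem: "a < sval (Len i)" if "a \<in> set_decode i" for a i
    using that by (auto simp: less_Suc_eq_le)
  have len: "a \<in> set_decode i" if "Suc a = sval (Len i)" for a i
    using that Max_in[of "set_decode i"] by (auto split: if_splits)
  have ext: "i = j" if "sval (Len i) = sval (Len j)"
    "\<forall>a. sval a < sval (Len i) \<longrightarrow> (sval a \<in> set_decode i) = (sval a \<in> set_decode j)" for i j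
  proof -
    have "a \<in> set_decode i \<longleftrightarrow> a \<in> set_decode j" for a
      using that(2)[rule_format, of "NVar a"] that(1) mem[of a i] mem[of a j] by (metis sval.simps(1))
    then have "set_decode i = set_decode j" by blast
    then show ?thesis by (metis set_decode_inverse)
  qed
  show ?thesis
    using assms unfolding two_BASIC_def Let_def
  proof (elim insertE emptyE, goal_cases)
    case 12
    then show ?case by (auto intro!: exI[of _ "NVar (sval (\<nu> 0) - 1)"])
  next
    case 13
    then show ?case using mem by (simp add: less_le del: sval.simps(6))
  next
    case 14
    then show ?case using len by (simp del: sval.simps(6))
  next
    case 15
    then show ?case using ext by (simp add: less_le del: sval.simps(6))
  qed (simp_all, auto)
qed

lemma std_model_V0: "models std_model V0"
  unfolding models_def V0_def
  using std_model_comprehension std_model_two_BASIC by blast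

section \<open>The chosen model, and its numbers as a type\<close>

abbreviation target :: form where
  "target \<equiv> JCT_curve \<^bold>\<leftrightarrow> JCT_corners"

text \<open>The quotient type below needs a closed term. A refutation of \<open>target\<close> is
  demanded only if there is no proof of it, so such a model exists in either case, and truth of
  \<open>target\<close> in this one model already yields a proof.\<close>

definition V0_model :: "(nterm, nat) model" where
  "V0_model = (SOME M. congruent_model M \<and> models M V0 \<and>
     (\<not> proves V0 target \<longrightarrow> (\<exists>\<mu> \<nu>. \<not> sat M \<mu> \<nu> target)))"

lemma V0_model:
  "congruent_model V0_model" "models V0_model V0"
  "\<not> proves V0 target \<Longrightarrow> \<exists>\<mu> \<nu>. \<not> sat V0_model \<mu> \<nu> target"
proof -
  have "\<exists>M :: (nterm, nat) model. congruent_model M \<and> models M V0 \<and>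
     (\<not> proves V0 target \<longrightarrow> (\<exists>\<mu> \<nu>. \<not> sat M \<mu> \<nu> target))"
    using std_model_congruent std_model_V0 completeness by metis
  from someI_ex[OF this, folded V0_model_def]
  show "congruent_model V0_model" "models V0_model V0"
    "\<not> proves V0 target \<Longrightarrow> \<exists>\<mu> \<nu>. \<not> sat V0_model \<mu> \<nu> target"
    by blast+
qed

quotient_type mnum = nterm / "m_eq V0_model"
  using V0_model(1) by (simp add: congruent_model_def)

instantiation mnum :: "{zero, one, plus, times, ord}"
begin

lift_definition zero_mnum :: mnum is "m_zero V0_model" .
lift_definition one_mnum :: mnum is "m_one V0_model" .
lift_definition plus_mnum :: "mnum \<Rightarrow> mnum \<Rightarrow> mnum" is "m_add V0_model"
  using V0_model(1) unfolding congruent_model_def by blast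
lift_definition times_mnum :: "mnum \<Rightarrow> mnum \<Rightarrow> mnum" is "m_mul V0_model"
  using V0_model(1) unfolding congruent_model_def by blast
lift_definition less_eq_mnum :: "mnum \<Rightarrow> mnum \<Rightarrow> bool" is "m_le V0_model"
  using V0_model(1) unfolding congruent_model_def by (meson equivp_symp)

definition less_mnum :: "mnum \<Rightarrow> mnum \<Rightarrow> bool" where
  "less_mnum a b \<longleftrightarrow> a \<le> b \<and> a \<noteq> b"

instance ..

end

lift_definition len :: "nat \<Rightarrow> mnum" is "m_len V0_model" .
lift_definition mem :: "mnum \<Rightarrow> nat \<Rightarrow> bool" is "m_mem V0_model"
  using V0_model(1) unfolding congruent_model_def by (intro ext iffI) (meson equivp_symp)+

definition num_model :: "(mnum, nat) model" where
  "num_model = \<lparr>m_zero = 0, m_one = 1, m_add = (+), m_mul = (*), m_le = (\<le>), m_eq = (=),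
     m_len = len, m_seq = m_seq V0_model, m_mem = mem\<rparr>"

abbreviation ev :: "(nat \<Rightarrow> nat) \<Rightarrow> (nat \<Rightarrow> mnum) \<Rightarrow> nterm \<Rightarrow> mnum" where
  "ev \<equiv> tval num_model"

abbreviation holds :: "(nat \<Rightarrow> nat) \<Rightarrow> (nat \<Rightarrow> mnum) \<Rightarrow> form \<Rightarrow> bool" where
  "holds \<equiv> sat num_model"

lemma num_model_simps [simp]:
  "m_zero num_model = 0" "m_one num_model = 1" "m_add num_model = (+)" "m_mul num_model = (*)"
  "m_le num_model = (\<le>)" "m_eq num_model = (=)" "m_len num_model = len" "m_mem num_model = mem"
  "m_seq num_model = m_seq V0_model"
  by (simp_all add: num_model_def)

lemma ev_abs_num: "ev \<mu> (\<lambda>i. abs_mnum (\<nu> i)) t = abs_mnum (tval V0_model \<mu> \<nu> t)"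
  by (induction t) (simp_all add: zero_mnum.abs_eq one_mnum.abs_eq plus_mnum.abs_eq times_mnum.abs_eq len.abs_eq)

lemma all_num: "(\<forall>a. P a) \<longleftrightarrow> (\<forall>x. P (abs_mnum x))"
  using mnum.abs_induct[of P] by blast

lemma ex_num: "(\<exists>a. P a) \<longleftrightarrow> (\<exists>x. P (abs_mnum x))"
  using all_num[of "\<lambda>a. \<not> P a"] by blast

lemma holds_abs_num: "holds \<mu> (\<lambda>i. abs_mnum (\<nu> i)) \<phi> \<longleftrightarrow> sat V0_model \<mu> \<nu> \<phi>"
proof (induction \<phi> arbitrary: \<mu> \<nu>)
  case (AllN \<phi>)
  have "case_nat (abs_mnum a) (\<lambda>i. abs_mnum (\<nu> i)) = (\<lambda>i. abs_mnum (case_nat a \<nu> i))" for a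
    by (auto split: nat.split)
  then have "holds \<mu> (case_nat (abs_mnum a) (\<lambda>i. abs_mnum (\<nu> i))) \<phi> \<longleftrightarrow> sat V0_model \<mu> (case_nat a \<nu>) \<phi>" for a
    using AllN[of \<mu> "case_nat a \<nu>"] by (simp only:)
  then show ?case by (simp add: all_num)
next
  case (ExN \<phi>)
  have "case_nat (abs_mnum a) (\<lambda>i. abs_mnum (\<nu> i)) = (\<lambda>i. abs_mnum (case_nat a \<nu> i))" for a
    by (auto split: nat.split)
  then have "holds \<mu> (case_nat (abs_mnum a) (\<lambda>i. abs_mnum (\<nu> i))) \<phi> \<longleftrightarrow> sat V0_model \<mu> (case_nat a \<nu>) \<phi>" for a
    using ExN[of \<mu> "case_nat a \<nu>"] by (simp only:)
  then show ?case by (simp add: ex_num)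
qed (simp_all add: ev_abs_num mnum.abs_eq_iff less_eq_mnum.abs_eq mem.abs_eq)

lemma abs_rep_num: "(\<lambda>i. abs_mnum (rep_mnum (\<nu> i))) = \<nu>"
  by (simp add: Quotient3_mnum[THEN Quotient3_abs_rep])

lemma holds_V0: "\<phi> \<in> V0 \<Longrightarrow> holds \<mu> \<nu> \<phi>"
  using holds_abs_num[of \<mu> "\<lambda>i. rep_mnum (\<nu> i)" \<phi>] V0_model(2) by (simp add: abs_rep_num models_def)

lemma proves_target:
  assumes "\<And>\<mu> \<nu>. holds \<mu> \<nu> target"
  shows "proves V0 target"
  using V0_model(3) assms holds_abs_num by blast

lemma comprehension_num:
  assumes "Sigma0B \<phi>"
  shows "\<exists>X. len X \<le> a \<and> (\<forall>z. z < a \<longrightarrow> (mem z X \<longleftrightarrow> holds \<mu> (case_nat z (case_nat a \<nu>)) \<phi>))"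
proof -
  have "holds \<mu> (case_nat a \<nu>) (comprehension \<phi>)"
    using assms by (intro holds_V0) (auto simp: V0_def)
  then show ?thesis unfolding sat_comprehension by (simp add: less_mnum_def)
qed

lemma
  fixes x y :: mnum
  shows num_succ_neq_0: "x + 1 \<noteq> 0"
    and num_succ_inject: "x + 1 = y + 1 \<Longrightarrow> x = y"
    and num_add_0: "x + 0 = x"
    and num_add_succ: "x + (y + 1) = (x + y) + 1"
    and num_mult_0: "x * 0 = 0"
    and num_mult_succ: "x * (y + 1) = x * y + x"
    and num_antisym: "x \<le> y \<Longrightarrow> y \<le> x \<Longrightarrow> x = y"
    and num_le_add: "x \<le> x + y"
    and num_zero_le: "0 \<le> x"
    and num_total: "x \<le> y \<or> y \<le> x"
    and num_le_iff_less_succ: "x \<le> y \<longleftrightarrow> x < y + 1"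
    and num_pred: "x \<noteq> 0 \<Longrightarrow> \<exists>z. z + 1 = x"
    and mem_less_len: "mem y X \<Longrightarrow> y < len X"
    and mem_pred_len: "y + 1 = len X \<Longrightarrow> mem y X"
proof -
  have "\<forall>\<phi>\<in>two_BASIC. holds (\<lambda>_. X) (case_nat x (case_nat y (\<lambda>_. 0))) \<phi>"
    using holds_V0 by (simp add: V0_def)
  then have *: "x + 1 \<noteq> 0 \<and> (x + 1 = y + 1 \<longrightarrow> x = y) \<and> x + 0 = x \<and> x + (y + 1) = (x + y) + 1 \<and>
    x * 0 = 0 \<and> x * (y + 1) = x * y + x \<and> (x \<le> y \<and> y \<le> x \<longrightarrow> x = y) \<and> x \<le> x + y \<and> 0 \<le> x \<and>
    (x \<le> y \<or> y \<le> x) \<and> (x \<le> y \<longleftrightarrow> x < y + 1) \<and> (x \<noteq> 0 \<longrightarrow> (\<exists>z. z \<le> x \<and> z + 1 = x)) \<and>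
    (mem y X \<longrightarrow> y < len X) \<and> (y + 1 = len X \<longrightarrow> mem y X)"
    unfolding two_BASIC_def Let_def by (simp add: less_mnum_def) metis
  show "x + 1 \<noteq> 0" "x + 1 = y + 1 \<Longrightarrow> x = y" "x + 0 = x" "x + (y + 1) = (x + y) + 1"
    "x * 0 = 0" "x * (y + 1) = x * y + x" "x \<le> y \<Longrightarrow> y \<le> x \<Longrightarrow> x = y" "x \<le> x + y" "0 \<le> x"
    "x \<le> y \<or> y \<le> x" "x \<le> y \<longleftrightarrow> x < y + 1" "x \<noteq> 0 \<Longrightarrow> \<exists>z. z + 1 = x"
    "mem y X \<Longrightarrow> y < len X" "y + 1 = len X \<Longrightarrow> mem y X"
    by (insert *) metis+
qed

lemma num_refl: "x \<le> (x :: mnum)"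
  using num_le_add[of x 0] by (simp add: num_add_0)

text \<open>Transitivity of \<open>\<le>\<close> is not an axiom, and the induction principle below has to do without it.\<close>

lemma num_less_imp_succ_le:
  fixes x y :: mnum
  assumes "x < y"
  shows "x + 1 \<le> y"
proof (rule ccontr)
  assume *: "\<not> x + 1 \<le> y"
  have "y \<noteq> 0" using assms num_antisym[of x 0] num_zero_le[of x] by (auto simp: less_mnum_def)
  then obtain z where z: "y = z + 1" using num_pred by blast
  have "x \<le> z" using assms z num_le_iff_less_succ by blast
  have "y \<le> x + 1" using * num_total by blast
  moreover have "y \<noteq> x + 1" using * num_refl by auto
  ultimately have "y < x + 1" by (simp add: less_mnum_def)
  then have "y \<le> x" using num_le_iff_less_succ by blast
  then show False using assms num_antisym by (auto simp: less_mnum_def)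
qed

lemma num_succ_le_succ:
  fixes x y :: mnum
  assumes "x + 1 \<le> y + 1"
  shows "x \<le> y"
proof (rule ccontr)
  assume *: "\<not> x \<le> y"
  then have "y < x" using num_total num_refl unfolding less_mnum_def by metis
  then have "y + 1 \<le> x" by (rule num_less_imp_succ_le)
  then have "y + 1 \<le> x + 1" using num_le_iff_less_succ less_mnum_def by blast
  then show False using assms * num_antisym num_succ_inject num_refl by metis
qed

section \<open>Induction for bounded formulas and the semiring of numbers\<close>

lemma Sigma0B_sub: "Sigma0B \<phi> \<Longrightarrow> Sigma0B (sub \<sigma> \<rho> \<phi>)"
proof (induction arbitrary: \<sigma> \<rho> rule: Sigma0B.induct)
  case (9 \<phi> t)
  have "sub \<sigma> \<rho> (BAll t \<phi>) = BAll (tsub \<sigma> \<rho> t) (sub (case_nat (NVar 0) (up 1 \<circ> \<sigma>)) \<rho> \<phi>)"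
    by (simp add: BAll_def up_1 tsub_tsub comp_def del: One_nat_def)
  then show ?case using 9 by (simp add: Sigma0B.intros)
next
  case (10 \<phi> t)
  have "sub \<sigma> \<rho> (BEx t \<phi>) = BEx (tsub \<sigma> \<rho> t) (sub (case_nat (NVar 0) (up 1 \<circ> \<sigma>)) \<rho> \<phi>)"
    by (simp add: BEx_def up_1 tsub_tsub comp_def del: One_nat_def)
  then show ?case using 10 by (simp add: Sigma0B.intros)
qed (simp_all add: Sigma0B.intros)

text \<open>The length of a nonempty set exceeds its largest element by one. Let \<open>X\<close>
  collect the \<open>z \<le> a\<close> with the property. Its largest element \<open>w\<close> is at
  most \<open>a\<close>, and if it were smaller, the induction step would put \<open>w + 1\<close>
  into \<open>X\<close>, although all elements are below the length \<open>w + 1\<close>.\<close>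

lemma num_induct:
  assumes "Sigma0B \<phi>" and base: "holds \<mu> (case_nat 0 \<nu>) \<phi>"
    and step: "\<And>x. holds \<mu> (case_nat x \<nu>) \<phi> \<Longrightarrow> holds \<mu> (case_nat (x + 1) \<nu>) \<phi>"
  shows "holds \<mu> (case_nat a \<nu>) \<phi>"
proof -
  \<comment> \<open>In a comprehension formula variable 1 is the bound, so the parameters of
    \<open>\<phi>\<close> have to skip it.\<close>
  have "Sigma0B (sub (case_nat (NVar 0) (\<lambda>i. NVar (i + 2))) id \<phi>)"
    using assms(1) by (rule Sigma0B_sub)
  from comprehension_num[OF this, of "a + 1" \<mu> \<nu>]
  obtain X where X: "len X \<le> a + 1"
    "\<And>z. z < a + 1 \<Longrightarrow> mem z X \<longleftrightarrow>
      holds \<mu> (case_nat z (case_nat (a + 1) \<nu>)) (sub (case_nat (NVar 0) (\<lambda>i. NVar (i + 2))) id \<phi>)"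
    by blast
  have env: "(\<lambda>i. ev \<mu> (case_nat z (case_nat (a + 1) \<nu>)) (case_nat (NVar 0) (\<lambda>i. NVar (i + 2)) i)) = case_nat z \<nu>" for z
    by (auto simp: fun_eq_iff split: nat.split)
  have mem: "mem z X \<longleftrightarrow> holds \<mu> (case_nat z \<nu>) \<phi>" if "z \<le> a" for z
    using X(2)[OF num_le_iff_less_succ[THEN iffD1, OF that]] by (simp only: sat_sub env o_id)
  have "mem 0 X" using mem[of 0] base num_zero_le by simp
  then have "0 < len X" by (rule mem_less_len)
  then have "len X \<noteq> 0" by (auto simp: less_mnum_def)
  then obtain w where w: "w + 1 = len X" using num_pred by blast
  then have "mem w X" by (rule mem_pred_len)
  have "w \<le> a" using X(1) w num_succ_le_succ by metis
  then have *: "holds \<mu> (case_nat w \<nu>) \<phi>" using mem[of w] \<open>mem w X\<close> by simp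
  have "w = a"
  proof (rule ccontr)
    assume "w \<noteq> a"
    then have "w + 1 \<le> a" using \<open>w \<le> a\<close> num_less_imp_succ_le by (simp add: less_mnum_def)
    then have "mem (w + 1) X" using mem[of "w + 1"] step[OF *] by simp
    then show False using mem_less_len[of "w + 1" X] w by (simp add: less_mnum_def)
  qed
  then show ?thesis using * by simp
qed

lemma num_induct1:
  assumes "Sigma0B \<phi>" and "\<And>x. P x \<longleftrightarrow> holds (\<lambda>_. 0) (case_nat x \<nu>) \<phi>"
    and "P 0" "\<And>x. P x \<Longrightarrow> P (x + 1)"
  shows "P a"
  using num_induct[OF assms(1), of "\<lambda>_. 0" \<nu> a] assms(2-) by simp

lemma num_add_assoc: "(x + y) + z = x + (y + z)" for x y z :: mnum
  by (rule num_induct1[where a = z and P = "\<lambda>z. (x + y) + z = x + (y + z)" and \<nu> = "case_nat x (case_nat y (\<lambda>_. 0))"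
        and \<phi> = "(NVar 1 \<^bold>+ NVar 2) \<^bold>+ NVar 0 \<^bold>= NVar 1 \<^bold>+ (NVar 2 \<^bold>+ NVar 0)"])
    (simp_all add: Sigma0B.intros num_add_0 num_add_succ)

lemma num_0_add: "0 + x = x" for x :: mnum
  by (rule num_induct1[where a = x and P = "\<lambda>x. 0 + x = x" and \<nu> = "\<lambda>_. 0" and \<phi> = "Zero \<^bold>+ NVar 0 \<^bold>= NVar 0"])
    (simp_all add: Sigma0B.intros num_add_0 num_add_succ)

lemma num_succ_add: "(x + 1) + y = (x + y) + 1" for x y :: mnum
  by (rule num_induct1[where a = y and P = "\<lambda>y. (x + 1) + y = (x + y) + 1" and \<nu> = "\<lambda>_. x"
        and \<phi> = "(NVar 1 \<^bold>+ One) \<^bold>+ NVar 0 \<^bold>= (NVar 1 \<^bold>+ NVar 0) \<^bold>+ One"])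
    (simp_all add: Sigma0B.intros num_add_0 num_add_succ)

lemma num_add_commute: "x + y = y + x" for x y :: mnum
  by (rule num_induct1[where a = y and P = "\<lambda>y. x + y = y + x" and \<nu> = "\<lambda>_. x"
        and \<phi> = "NVar 1 \<^bold>+ NVar 0 \<^bold>= NVar 0 \<^bold>+ NVar 1"])
    (simp_all add: Sigma0B.intros num_add_0 num_0_add num_add_succ num_succ_add)

lemma num_add_left_commute: "x + (y + z) = y + (x + z)" for x y z :: mnum
  by (metis num_add_assoc num_add_commute)

lemma num_0_mult: "0 * x = 0" for x :: mnum
  by (rule num_induct1[where a = x and P = "\<lambda>x. 0 * x = 0" and \<nu> = "\<lambda>_. 0" and \<phi> = "Zero \<^bold>* NVar 0 \<^bold>= Zero"])
    (simp_all add: Sigma0B.intros num_add_0 num_mult_0 num_mult_succ)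

lemma num_succ_mult: "(x + 1) * y = x * y + y" for x y :: mnum
  by (rule num_induct1[where a = y and P = "\<lambda>y. (x + 1) * y = x * y + y" and \<nu> = "\<lambda>_. x"
        and \<phi> = "(NVar 1 \<^bold>+ One) \<^bold>* NVar 0 \<^bold>= NVar 1 \<^bold>* NVar 0 \<^bold>+ NVar 0"])
    (simp_all add: Sigma0B.intros num_add_0 num_mult_0 num_mult_succ num_add_assoc num_add_commute num_add_left_commute)

lemma num_mult_commute: "x * y = y * x" for x y :: mnum
  by (rule num_induct1[where a = y and P = "\<lambda>y. x * y = y * x" and \<nu> = "\<lambda>_. x"
        and \<phi> = "NVar 1 \<^bold>* NVar 0 \<^bold>= NVar 0 \<^bold>* NVar 1"])
    (simp_all add: Sigma0B.intros num_mult_0 num_0_mult num_mult_succ num_succ_mult)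

lemma num_mult_1: "x * 1 = x" for x :: mnum
  using num_mult_succ[of x 0] by (simp add: num_mult_0 num_0_add)

lemma num_distrib: "x * (y + z) = x * y + x * z" for x y z :: mnum
  by (rule num_induct1[where a = z and P = "\<lambda>z. x * (y + z) = x * y + x * z" and \<nu> = "case_nat x (case_nat y (\<lambda>_. 0))"
        and \<phi> = "NVar 1 \<^bold>* (NVar 2 \<^bold>+ NVar 0) \<^bold>= NVar 1 \<^bold>* NVar 2 \<^bold>+ NVar 1 \<^bold>* NVar 0"])
    (simp_all add: Sigma0B.intros num_add_0 num_mult_0 num_add_succ num_mult_succ, simp_all add: num_add_assoc)

lemma num_mult_assoc: "(x * y) * z = x * (y * z)" for x y z :: mnum
  by (rule num_induct1[where a = z and P = "\<lambda>z. (x * y) * z = x * (y * z)" and \<nu> = "case_nat x (case_nat y (\<lambda>_. 0))"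
        and \<phi> = "(NVar 1 \<^bold>* NVar 2) \<^bold>* NVar 0 \<^bold>= NVar 1 \<^bold>* (NVar 2 \<^bold>* NVar 0)"])
    (simp_all add: Sigma0B.intros num_mult_0 num_mult_1 num_distrib)

lemma num_add_cancel: "x + z = y + z \<longleftrightarrow> x = y" for x y z :: mnum
  by (rule num_induct1[where a = z and P = "\<lambda>z. x + z = y + z \<longleftrightarrow> x = y" and \<nu> = "case_nat x (case_nat y (\<lambda>_. 0))"
        and \<phi> = "(NVar 1 \<^bold>+ NVar 0 \<^bold>= NVar 2 \<^bold>+ NVar 0 \<^bold>\<rightarrow> NVar 1 \<^bold>= NVar 2) \<^bold>\<and> (NVar 1 \<^bold>= NVar 2 \<^bold>\<rightarrow> NVar 1 \<^bold>+ NVar 0 \<^bold>= NVar 2 \<^bold>+ NVar 0)"])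
    (auto simp: Sigma0B.intros num_add_0 num_add_succ dest: num_succ_inject)

lemma num_le_iff_add: "x \<le> y \<longleftrightarrow> (\<exists>z. y = x + z)" for x y :: mnum
proof
  \<comment> \<open>Induction is available for bounded formulas, hence the bound on
    \<open>z\<close>.\<close>
  have "x \<le> y \<longrightarrow> (\<exists>z\<le>y. x + z = y)"
  proof (rule num_induct1[where a = y and P = "\<lambda>y. x \<le> y \<longrightarrow> (\<exists>z\<le>y. x + z = y)" and \<nu> = "\<lambda>_. x"
        and \<phi> = "NVar 1 \<^bold>\<le> NVar 0 \<^bold>\<rightarrow> BEx (NVar 0) (NVar 2 \<^bold>+ NVar 0 \<^bold>= NVar 1)"])
    show "x \<le> 0 \<longrightarrow> (\<exists>z\<le>0. x + z = 0)"
      by (intro impI exI[of _ 0]) (simp add: num_refl num_add_0 num_antisym num_zero_le)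
    fix y
    assume IH: "x \<le> y \<longrightarrow> (\<exists>z\<le>y. x + z = y)"
    show "x \<le> y + 1 \<longrightarrow> (\<exists>z\<le>y + 1. x + z = y + 1)"
    proof
      assume "x \<le> y + 1"
      show "\<exists>z\<le>y + 1. x + z = y + 1"
      proof (cases "x = y + 1")
        case True
        then show ?thesis by (intro exI[of _ 0]) (simp add: num_zero_le num_add_0)
      next
        case False
        then have "x \<le> y" using \<open>x \<le> y + 1\<close> num_le_iff_less_succ[of x y] by (metis less_mnum_def)
        then obtain z where "z \<le> y" "x + z = y" using IH by blast
        then have "z + 1 \<le> y + 1" "x + (z + 1) = y + 1"
          using num_less_imp_succ_le[of z "y + 1"] num_le_iff_less_succ[of z y] by (simp_all add: num_add_succ)
        then show ?thesis by blast
      qed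
    qed
  qed (simp_all add: Sigma0B.intros)
  then show "x \<le> y \<Longrightarrow> \<exists>z. y = x + z" by metis
qed (auto simp: num_le_add)

instance mnum :: comm_semiring_1
proof
  fix x y z :: mnum
  show "x + y + z = x + (y + z)" by (rule num_add_assoc)
  show "x + y = y + x" by (rule num_add_commute)
  show "0 + x = x" by (rule num_0_add)
  show "x * y * z = x * (y * z)" by (rule num_mult_assoc)
  show "x * y = y * x" by (rule num_mult_commute)
  show "1 * x = x" using num_mult_succ[of x 0] num_mult_0[of x] by (simp add: num_0_add num_mult_commute)
  show "(x + y) * z = x * z + y * z" by (metis num_distrib num_mult_commute)
  show "0 * x = 0" "x * 0 = 0" by (rule num_0_mult num_mult_0)+
  show "(0 :: mnum) \<noteq> 1" using num_succ_neq_0[of 0] by (simp add: num_0_add)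
qed

instance mnum :: linorder
proof
  fix x y z :: mnum
  show "x < y \<longleftrightarrow> x \<le> y \<and> \<not> y \<le> x" using num_antisym num_refl by (auto simp: less_mnum_def)
  show "x \<le> x" by (rule num_refl)
  show "x \<le> y \<Longrightarrow> y \<le> z \<Longrightarrow> x \<le> z" by (auto simp: num_le_iff_add add.assoc)
  show "x \<le> y \<Longrightarrow> y \<le> x \<Longrightarrow> x = y" by (rule num_antisym)
  show "x \<le> y \<or> y \<le> x" by (rule num_total)
qed

lemma num_add_le_cancel: "x + z \<le> y + z \<longleftrightarrow> x \<le> y" for x y z :: mnum
proof -
  have "(\<exists>w. y + z = x + z + w) \<longleftrightarrow> (\<exists>w. y = x + w)"
    using num_add_cancel[of y z] by (metis add.assoc add.commute)
  then show ?thesis by (simp add: num_le_iff_add)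
qed


section \<open>The ordered ring of a model\<close>

text \<open>Formal differences of numbers, as in the construction of the integers. Negative
  coordinates make the four quadrants interchangeable, and an ordered ring gives access to linear
  arithmetic.\<close>

definition zz_rel :: "mnum \<times> mnum \<Rightarrow> mnum \<times> mnum \<Rightarrow> bool" where
  "zz_rel = (\<lambda>(x, y) (u, v). x + v = u + y)"

lemma zz_rel_iff [simp]: "zz_rel (x, y) (u, v) \<longleftrightarrow> x + v = u + y"
  by (simp add: zz_rel_def)

lifting_forget mnum.lifting

quotient_type zz = "mnum \<times> mnum" / zz_rel
  morphisms Rep_zz Abs_zz
proof (rule equivpI)
  show "reflp zz_rel" by (auto simp: reflp_def)
  show "symp zz_rel" by (auto simp: symp_def)
  show "transp zz_rel"
  proof (rule transpI, clarsimp)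
    fix a b c d e f :: mnum
    assume "a + d = c + b" "c + f = e + d"
    then have "(a + f) + (c + d) = (e + b) + (c + d)" by (metis add.assoc add.commute)
    then show "a + f = e + b" by (simp add: num_add_cancel)
  qed
qed

instantiation zz :: comm_ring_1
begin

lift_definition zero_zz :: zz is "(0, 0)" .
lift_definition one_zz :: zz is "(1, 0)" .
lift_definition plus_zz :: "zz \<Rightarrow> zz \<Rightarrow> zz" is "\<lambda>(x, y) (u, v). (x + u, y + v)"
proof clarsimp
  fix a b c d e f g h :: mnum
  assume *: "a + d = c + b" "e + h = g + f"
  have "a + e + (d + h) = (a + d) + (e + h)" by (simp add: ac_simps)
  also have "\<dots> = c + g + (b + f)" unfolding * by (simp add: ac_simps)
  finally show "a + e + (d + h) = c + g + (b + f)" .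
qed
lift_definition uminus_zz :: "zz \<Rightarrow> zz" is "\<lambda>(x, y). (y, x)"
  by (clarsimp simp: ac_simps)
definition minus_zz :: "zz \<Rightarrow> zz \<Rightarrow> zz" where "minus_zz a b = a + - b"
lift_definition times_zz :: "zz \<Rightarrow> zz \<Rightarrow> zz" is "\<lambda>(x, y) (u, v). (x * u + y * v, x * v + y * u)"
proof clarsimp
  fix s t u v w x y z :: mnum
  assume 1: "s + v = u + t" and 2: "w + z = y + x"
  have "(s * w + t * x) + (u * z + v * y) + (v * w + u * x) = (s + v) * w + (u + t) * x + u * z + v * y"
    by (simp add: algebra_simps)
  also have "\<dots> = (u + t) * w + (s + v) * x + u * z + v * y" by (simp add: 1)
  also have "\<dots> = u * (w + z) + t * w + s * x + v * (y + x)" by (simp add: algebra_simps)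
  also have "\<dots> = u * (y + x) + t * w + s * x + v * (w + z)" by (simp add: 2)
  also have "\<dots> = (u * y + v * z) + (s * x + t * w) + (v * w + u * x)" by (simp add: algebra_simps)
  finally show "(s * w + t * x) + (u * z + v * y) = (u * y + v * z) + (s * x + t * w)"
    by (simp add: num_add_cancel)
qed

instance
proof
  fix a b c :: zz
  show "a + b + c = a + (b + c)" by transfer (clarsimp simp: algebra_simps)
  show "a + b = b + a" by transfer (clarsimp simp: algebra_simps)
  show "0 + a = a" by transfer (clarsimp simp: algebra_simps)
  show "- a + a = 0" by transfer (clarsimp simp: algebra_simps)
  show "a - b = a + - b" by (rule minus_zz_def)
  show "a * b * c = a * (b * c)" by transfer (clarsimp simp: algebra_simps)
  show "a * b = b * a" by transfer (clarsimp simp: algebra_simps)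
  show "1 * a = a" by transfer (clarsimp simp: algebra_simps)
  show "(a + b) * c = a * c + b * c" by transfer (clarsimp simp: algebra_simps)
  show "(0 :: zz) \<noteq> 1" by transfer simp
qed

end

instantiation zz :: linorder
begin

lift_definition less_eq_zz :: "zz \<Rightarrow> zz \<Rightarrow> bool" is "\<lambda>(x, y) (u, v). x + v \<le> u + y"
proof clarsimp
  fix a b c d e f g h :: mnum
  assume *: "a + d = c + b" "e + h = g + f"
  have "a + f \<le> e + b \<longleftrightarrow> (a + f) + (d + h) \<le> (e + b) + (d + h)" by (simp add: num_add_le_cancel)
  also have "(a + f) + (d + h) = (c + h) + (b + f)" using *(1) by (metis add.assoc add.commute)
  also have "(e + b) + (d + h) = (g + d) + (b + f)" using *(2) by (metis add.assoc add.commute)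
  finally show "a + f \<le> e + b \<longleftrightarrow> c + h \<le> g + d" by (simp add: num_add_le_cancel)
qed

definition less_zz :: "zz \<Rightarrow> zz \<Rightarrow> bool" where "less_zz a b \<longleftrightarrow> a \<le> b \<and> \<not> b \<le> a"

instance
proof
  fix a b c :: zz
  show "a < b \<longleftrightarrow> a \<le> b \<and> \<not> b \<le> a" by (rule less_zz_def)
  show "a \<le> a" by transfer clarsimp
  show "a \<le> b \<Longrightarrow> b \<le> c \<Longrightarrow> a \<le> c"
  proof (transfer, clarsimp)
    fix a b c d e f :: mnum
    assume *: "a + d \<le> c + b" "c + f \<le> e + d"
    have "(a + f) + d \<le> (c + f) + b" using num_add_le_cancel[of "a + d" f "c + b"] * by (simp add: ac_simps)
    also have "(c + f) + b \<le> (e + b) + d" using num_add_le_cancel[of "c + f" b "e + d"] * by (simp add: ac_simps)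
    finally show "a + f \<le> e + b" by (simp add: num_add_le_cancel)
  qed
  show "a \<le> b \<Longrightarrow> b \<le> a \<Longrightarrow> a = b" by transfer (auto simp: ac_simps intro: antisym)
  show "a \<le> b \<or> b \<le> a" by transfer (auto simp: ac_simps linear)
qed

end

lift_definition zn :: "mnum \<Rightarrow> zz" is "\<lambda>x. (x, 0)" .

lemma zn_simps [simp]:
  "zn 0 = 0" "zn 1 = 1" "zn (x + y) = zn x + zn y" "zn (x * y) = zn x * zn y"
  "zn x = zn y \<longleftrightarrow> x = y" "zn x \<le> zn y \<longleftrightarrow> x \<le> y" "zn x < zn y \<longleftrightarrow> x < y" "0 \<le> zn x"
proof -
  show le: "zn x \<le> zn y \<longleftrightarrow> x \<le> y" for x y by transfer simp
  show "zn x < zn y \<longleftrightarrow> x < y" by (auto simp: less_zz_def le)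
qed (transfer; simp add: num_zero_le)+

lemma zz_nonnegE:
  assumes "0 \<le> a"
  obtains x where "a = zn x"
proof -
  have "\<exists>x. a = zn x"
    using assms by transfer (auto simp: num_le_iff_add ac_simps)
  then show thesis using that by blast
qed

instantiation zz :: linordered_idom
begin

definition abs_zz :: "zz \<Rightarrow> zz" where "abs_zz a = (if a < 0 then - a else a)"
definition sgn_zz :: "zz \<Rightarrow> zz" where "sgn_zz a = (if a = 0 then 0 else if 0 < a then 1 else - 1)"

instance
proof
  fix a b c :: zz
  show add: "a \<le> b \<Longrightarrow> c + a \<le> c + b" for a b c :: zz
  proof (transfer, clarsimp)
    fix a b c d e f :: mnum
    assume "a + d \<le> c + b"
    then show "e + a + (f + d) \<le> e + c + (f + b)"
      using num_add_le_cancel[of "a + d" "e + f" "c + b"] by (simp add: ac_simps)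
  qed
  show "\<bar>a\<bar> = (if a < 0 then - a else a)" by (rule abs_zz_def)
  show "sgn a = (if a = 0 then 0 else if 0 < a then 1 else - 1)" by (rule sgn_zz_def)
  assume "a < b" "0 < c"
  have "0 \<le> b - a" using add[of a b "- a"] \<open>a < b\<close> by (simp add: less_zz_def)
  then obtain x where x: "b - a = zn x" by (rule zz_nonnegE)
  obtain y where y: "c = zn y" using \<open>0 < c\<close> by (meson less_imp_le zz_nonnegE)
  have "x \<noteq> 0" "y \<noteq> 0" using x y \<open>a < b\<close> \<open>0 < c\<close> by auto
  then obtain x' y' where "x' + 1 = x" "y' + 1 = y" using num_pred by meson
  then have "x * y = (x' * y' + x' + y') + 1" by (auto simp: algebra_simps)
  then have "x * y \<noteq> 0" using num_succ_neq_0 by metis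
  then have "0 < zn (y * x)" by (metis less_le mult.commute zn_simps(1,5,8))
  then have "0 < c * (b - a)" by (simp add: x y)
  then have "c * a < c * a + c * (b - a)"
    using add[of 0 "c * (b - a)" "c * a"] by (simp add: less_le)
  then show "c * a < c * b" by (simp add: algebra_simps)
qed

end

instance zz :: discrete_linordered_semidom
proof
  fix a b :: zz
  show "a < b \<longleftrightarrow> a + 1 \<le> b"
  proof
    assume "a < b"
    then have "0 < b - a" by simp
    then obtain x where x: "b - a = zn x" by (meson less_imp_le zz_nonnegE)
    then have "0 < zn x" using \<open>0 < b - a\<close> by simp
    then have "0 < x" by (metis zn_simps(1,7))
    then have "zn (0 + 1) \<le> zn x" using num_less_imp_succ_le zn_simps(6) by blast
    then have "1 \<le> b - a" by (simp add: x)
    then show "a + 1 \<le> b" by (simp add: algebra_simps)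
  next
    assume "a + 1 \<le> b"
    then show "a < b" using zero_less_one[where 'a = zz] by linarith
  qed
qed


section \<open>Lattice pictures\<close>

text \<open>The geometry is done in any ordered integral domain with nothing between 0 and 1. At
  this generality there is no induction on coordinates: the arguments are case distinctions by
  linear inequalities, with \<open>less_iff_succ_less_eq\<close> bringing in discreteness where it
  matters.\<close>

class discrete_idom = linordered_idom + discrete_linordered_semidom

text \<open>
  A set of grid edges is given by two predicates: \<open>h x y\<close> stands for the edge joining \<open>(x, y)\<close> and
  \<open>(x + 1, y)\<close>, and \<open>v x y\<close> for the edge joining \<open>(x, y)\<close> and \<open>(x, y + 1)\<close>.
\<close>

type_synonym 'a pic = "'a \<Rightarrow> 'a \<Rightarrow> bool"

definition deg :: "'a pic \<Rightarrow> 'a pic \<Rightarrow> 'a::discrete_idom \<Rightarrow> 'a \<Rightarrow> nat" where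
  "deg h v x y = of_bool (h (x - 1) y) + of_bool (h x y) + of_bool (v x (y - 1)) + of_bool (v x y)"

text \<open>No edge runs along an axis; row 0 is met by vertical edges only and column 0 by
  horizontal ones. The quadrants can therefore be moved separately, and only the edges that meet an
  axis need repair.\<close>

definition centred :: "'a::discrete_idom \<Rightarrow> 'a pic \<Rightarrow> 'a pic \<Rightarrow> bool" where
  "centred K h v \<longleftrightarrow>
     (\<forall>x y. h x y \<longrightarrow> - K < x \<and> x + 1 < K \<and> - K < y \<and> y < K \<and> y \<noteq> 0) \<and>
     (\<forall>x y. v x y \<longrightarrow> - K < x \<and> x < K \<and> - K < y \<and> y + 1 < K \<and> x \<noteq> 0)"

text \<open>
  The picture turned inside out. Inside the square \<open>\<bar>x\<bar>, \<bar>y\<bar> < K\<close> the point \<open>(x, y)\<close> is the image of the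
  point \<open>(sgn x * (K - \<bar>y\<bar>), sgn y * (K - \<bar>x\<bar>))\<close>. For \<open>1 \<le> s < K\<close>, the old edges crossing column \<open>0\<close> in row
  \<open>K - s\<close> become the two halves of the arc from \<open>(- s, K - 1)\<close> up to row \<open>K - 1 + s\<close>, across, and down to
  \<open>(s, K - 1)\<close>; the other three sides are symmetric. The horizontal edges listed below are those of the
  upper and lower arcs, followed by those in the square and in the arcs on the left and on the right.
\<close>

definition inv_h :: "'a::discrete_idom \<Rightarrow> 'a pic \<Rightarrow> 'a pic \<Rightarrow> 'a pic" where
  "inv_h K h v x y \<longleftrightarrow>
     (K \<le> y \<and> y \<le> K + K - 2 \<and>
       (0 \<le> x \<and> x \<le> y - K \<and> h 0 (K + K - 1 - y) \<or> x < 0 \<and> K - 1 - y \<le> x \<and> h (-1) (K + K - 1 - y))) \<or>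
     (K \<le> - y \<and> - y \<le> K + K - 2 \<and>
       (0 \<le> x \<and> x \<le> - y - K \<and> h 0 (1 - K - K - y) \<or> x < 0 \<and> K - 1 + y \<le> x \<and> h (-1) (1 - K - K - y))) \<or>
     (0 < y \<and> y < K \<and>
       (1 \<le> x \<and> x \<le> K - 1 \<and> v (K - y) (K - x - 1) \<or> K \<le> x \<and> x < K - 1 + y \<and> v (K - y) 0 \<or>
        x \<le> - 2 \<and> - K \<le> x \<and> v (y - K) (K + x) \<or> x < - K \<and> - x - 1 < K - 1 + y \<and> v (y - K) 0)) \<or>
     (y < 0 \<and> - K < y \<and>
       (1 \<le> x \<and> x \<le> K - 1 \<and> v (K + y) (x - K) \<or> K \<le> x \<and> x < K - 1 - y \<and> v (K + y) (- 1) \<or>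
        x \<le> - 2 \<and> - K \<le> x \<and> v (- y - K) (- 1 - K - x) \<or> x < - K \<and> - x - 1 < K - 1 - y \<and> v (- y - K) (- 1)))"

text \<open>The whole inversion, including the four families of arcs, is symmetric under
  transposition of the plane.\<close>

definition inv_v :: "'a::discrete_idom \<Rightarrow> 'a pic \<Rightarrow> 'a pic \<Rightarrow> 'a pic" where
  "inv_v K h v x y = inv_h K (\<lambda>x y. v y x) (\<lambda>x y. h y x) y x"

section \<open>Symmetries of the inversion and degrees in the inverted picture\<close>

lemma inv_h_flip_y: "inv_h K (\<lambda>x y. h x (- y)) (\<lambda>x y. v x (- 1 - y)) x y \<longleftrightarrow> inv_h K h v x (- y)"
proof -
  have 1: "- y < K \<longleftrightarrow> - K < y" by linarith
  show ?thesis unfolding inv_h_def by (simp add: 1 algebra_simps) argo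
qed

text \<open>A flip exchanges the ends of an edge: the one from \<open>x\<close> to
  \<open>x + 1\<close> becomes the one from \<open>- 1 - x\<close> to \<open>- x\<close>. Flips and
  transposition reduce each computation of a degree to one quadrant and half of one family of
  arcs.\<close>

lemma inv_h_flip_x: "inv_h K (\<lambda>x y. h (- 1 - x) y) (\<lambda>x y. v (- x) y) x y \<longleftrightarrow> inv_h K h v (- 1 - x) y"
proof -
  have 1: "- 1 - x < 0 \<longleftrightarrow> 0 \<le> x" "0 \<le> - 1 - x \<longleftrightarrow> x < 0" "- 1 - x \<le> - 2 \<longleftrightarrow> 1 \<le> x" "1 \<le> - 1 - x \<longleftrightarrow> x \<le> - 2"
    "- K \<le> - 1 - x \<longleftrightarrow> x \<le> K - 1" "- 1 - x \<le> K - 1 \<longleftrightarrow> - K \<le> x"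
    "- 1 - x < - K \<longleftrightarrow> K \<le> x" "K \<le> - 1 - x \<longleftrightarrow> x < - K"
    using less_iff_succ_less_eq[of "-1-x" 0] less_iff_succ_less_eq[of x 0] less_iff_succ_less_eq[of "-1-x" "-K"]
      less_iff_succ_less_eq[of x "- K"] by auto
  have 2: "- K - y = - y - K" "K + x \<le> - y \<longleftrightarrow> K + (x + y) \<le> 0" by auto
  show ?thesis unfolding inv_h_def 1 by (simp add: 2 algebra_simps) argo
qed

lemma inv_v_flip_y: "inv_v K (\<lambda>x y. h x (- y)) (\<lambda>x y. v x (- 1 - y)) x y \<longleftrightarrow> inv_v K h v x (- 1 - y)"
  unfolding inv_v_def by (rule inv_h_flip_x)

lemma inv_v_flip_x: "inv_v K (\<lambda>x y. h (- 1 - x) y) (\<lambda>x y. v (- x) y) x y \<longleftrightarrow> inv_v K h v (- x) y"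
  unfolding inv_v_def by (rule inv_h_flip_y)

definition inv_deg :: "'a::discrete_idom \<Rightarrow> 'a pic \<Rightarrow> 'a pic \<Rightarrow> 'a \<Rightarrow> 'a \<Rightarrow> nat" where
  "inv_deg K h v = deg (inv_h K h v) (inv_v K h v)"

lemma inv_deg_flip_y: "inv_deg K (\<lambda>x y. h x (- y)) (\<lambda>x y. v x (- 1 - y)) x y = inv_deg K h v x (- y)"
  unfolding inv_deg_def deg_def inv_h_flip_y inv_v_flip_y minus_diff_commute[of 1 y] by (simp add: minus_diff_commute[of _ 1])

lemma inv_deg_flip_x: "inv_deg K (\<lambda>x y. h (- 1 - x) y) (\<lambda>x y. v (- x) y) x y = inv_deg K h v (- x) y"
  unfolding inv_deg_def deg_def inv_h_flip_x inv_v_flip_x minus_diff_commute[of 1 x] by (simp add: minus_diff_commute[of _ 1])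

lemma inv_deg_transpose: "inv_deg K (\<lambda>x y. v y x) (\<lambda>x y. h y x) x y = inv_deg K h v y x"
  by (simp add: inv_deg_def deg_def inv_v_def)

lemma deg_flip_y: "deg (\<lambda>x y. h x (- y)) (\<lambda>x y. v x (- 1 - y)) x y = deg h v x (- y)"
  unfolding deg_def minus_diff_commute[of 1 y] by simp

lemma deg_flip_x: "deg (\<lambda>x y. h (- 1 - x) y) (\<lambda>x y. v (- x) y) x y = deg h v (- x) y"
  unfolding deg_def minus_diff_commute[of 1 x] by simp

lemma deg_transpose: "deg (\<lambda>x y. v y x) (\<lambda>x y. h y x) x y = deg h v y x"
  by (simp add: deg_def)

lemma centredD:
  assumes "centred K h v"
  shows "h x y \<Longrightarrow> - K < x \<and> x + 1 < K \<and> - K < y \<and> y < K \<and> y \<noteq> 0"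
    and "v x y \<Longrightarrow> - K < x \<and> x < K \<and> - K < y \<and> y + 1 < K \<and> x \<noteq> 0"
  using assms unfolding centred_def by blast+

lemma centred_transpose: "centred K h v \<Longrightarrow> centred K (\<lambda>x y. v y x) (\<lambda>x y. h y x)"
  unfolding centred_def by auto

lemma centred_flip_y:
  assumes "centred K h v"
  shows "centred K (\<lambda>x y. h x (- y)) (\<lambda>x y. v x (- 1 - y))"
  unfolding centred_def
proof (intro conjI allI impI)
  fix x y
  assume "h x (- y)"
  from centredD(1)[OF assms this] show "- K < x" "x + 1 < K" "- K < y" "y < K" "y \<noteq> 0" by linarith+
next
  fix x y
  assume "v x (- 1 - y)"
  from centredD(2)[OF assms this] show "- K < x" "x < K" "- K < y" "y + 1 < K" "x \<noteq> 0" by linarith+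
qed

lemma centred_flip_x:
  assumes "centred K h v"
  shows "centred K (\<lambda>x y. h (- 1 - x) y) (\<lambda>x y. v (- x) y)"
  using centred_transpose[OF centred_flip_y[OF centred_transpose[OF assms]]] .

text \<open>At the source \<open>(K - y, K - x)\<close> west becomes north and east becomes south,
  and the same with the two axes exchanged, so the four edges at a point are only permuted.\<close>

lemma inv_deg_block_pos:
  assumes c: "centred K h v" and "0 < x" "0 < y" "x < K" "y < K"
  shows "inv_deg K h v x y = deg h v (K - y) (K - x)"
proof -
  have E: "inv_h K h v x y \<longleftrightarrow> v (K - y) (K - x - 1)" if "0 < x" "0 < y" "x < K" "y < K" for h v and x y :: 'a
    using that less_iff_succ_less_eq[of 0 x] less_iff_succ_less_eq[of x K] by (auto simp: inv_h_def)
  have W: "inv_h K h v (x - 1) y \<longleftrightarrow> v (K - y) (K - x)" if "0 < x" "0 < y" "x < K" "y < K" and c: "centred K h v" for h v and x y :: 'a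
  proof (cases "x = 1")
    \<comment> \<open>No edge of the square joins columns 0 and 1, and the old edge that would
      correspond to it reaches row \<open>K\<close>, outside of a centred picture.\<close>
    case True
    then show ?thesis using that centredD(2)[OF c, of "K - y" "K - 1"] by (auto simp: inv_h_def)
  next
    case False
    then have "0 < x - 1" using that less_iff_succ_less_eq[of 0 x] by simp
    then show ?thesis using that E[of "x - 1" y h v] by simp
  qed
  show ?thesis
    using assms E[of x y h v] W[of x y h v] E[of y x "\<lambda>x y. v y x" "\<lambda>x y. h y x"]
      W[of y x "\<lambda>x y. v y x" "\<lambda>x y. h y x", OF _ _ _ _ centred_transpose[OF c]]
    by (simp add: inv_deg_def deg_def inv_v_def)
qed

lemma inv_deg_block:
  assumes c: "centred K h v" and "x \<noteq> 0" "y \<noteq> 0" "\<bar>x\<bar> < K" "\<bar>y\<bar> < K"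
  shows "inv_deg K h v x y = deg h v (sgn x * (K - \<bar>y\<bar>)) (sgn y * (K - \<bar>x\<bar>))"
proof -
  have 1: "inv_deg K h v x y = deg h v (K - \<bar>y\<bar>) (sgn y * (K - \<bar>x\<bar>))"
    if c: "centred K h v" and "0 < x" "y \<noteq> 0" "\<bar>x\<bar> < K" "\<bar>y\<bar> < K" for h v and x y :: 'a
  proof (cases "0 < y")
    case True
    then show ?thesis using inv_deg_block_pos[OF c, of x y] that by simp
  next
    case False
    then have "0 < - y" using that by simp
    then show ?thesis
      using inv_deg_block_pos[OF centred_flip_y[OF c], of x "- y"] that
      unfolding inv_deg_flip_y deg_flip_y by simp
  qed
  show ?thesis
  proof (cases "0 < x")
    case True
    then show ?thesis using 1[OF c, of x y] assms by simp
  next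
    case False
    then have "0 < - x" using assms by simp
    then show ?thesis
      using 1[OF centred_flip_x[OF c], of "- x" y] assms
      unfolding inv_deg_flip_x deg_flip_x by simp
  qed
qed

lemma inv_deg_axis:
  assumes "\<bar>x\<bar> < K" "\<bar>y\<bar> < K" "x = 0 \<or> y = 0"
  shows "inv_deg K h v x y = 0"
proof -
  have *: "inv_deg K h v 0 y = 0" if "\<bar>y\<bar> < K" for h v and y :: 'a
  proof -
    have "1 \<le> K" using that less_iff_succ_less_eq[of 0 K] by linarith
    then show ?thesis using that by (auto simp: inv_deg_def deg_def inv_v_def inv_h_def)
  qed
  show ?thesis
    using assms(3)
  proof
    assume "x = 0"
    then show ?thesis using *[OF assms(2), of h v] by simp
  next
    assume "y = 0"
    then show ?thesis
      using *[OF assms(1), of "\<lambda>x y. v y x" "\<lambda>x y. h y x"] inv_deg_transpose[of K v h 0 x] by simp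
  qed
qed

text \<open>Arc \<open>s\<close> has its right leg in column \<open>s\<close>, from row
  \<open>K - 1\<close> to row \<open>K - 1 + s\<close>, and its top in that last row. So a point of
  this sector can only lie on the top of arc \<open>y - K + 1\<close>, if
  \<open>x \<le> y - K\<close>, or else on the leg of arc \<open>x\<close>; for
  \<open>x = y - K + 1\<close> it is the corner of this arc. The image of a single old edge passes
  through it, except in column 0: there the two halves of an arc meet, and its middle inherits the
  degree of the axis point.\<close>

lemma inv_deg_arc_pos:
  assumes "centred K h v" "0 < K" "K \<le> y" "0 \<le> x" "x \<le> y"
  shows "inv_deg K h v x y =
    (if K \<le> x \<or> K + K - 1 \<le> y then 0
     else if x = 0 then deg h v 0 (K + K - 1 - y)
     else 2 * of_bool (h 0 (if x \<le> y - K then K + K - 1 - y else K - x)))"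
proof -
  have E: "inv_h K h v x y \<longleftrightarrow> y \<le> K + K - 2 \<and> x \<le> y - K \<and> h 0 (K + K - 1 - y)"
    using assms by (auto simp: inv_h_def)
  have W: "inv_h K h v (x - 1) y \<longleftrightarrow> y \<le> K + K - 2 \<and>
      (if x = 0 then h (- 1) (K + K - 1 - y) else x \<le> y - K + 1 \<and> h 0 (K + K - 1 - y))"
    using assms less_iff_succ_less_eq[of 0 x] by (auto simp: inv_h_def)
  have N: "inv_v K h v x y \<longleftrightarrow> 0 < x \<and> x < K \<and> y < K - 1 + x \<and> h 0 (K - x)"
    using assms by (auto simp: inv_v_def inv_h_def)
  have S: "inv_v K h v x (y - 1) \<longleftrightarrow> 0 < x \<and> x < K \<and> y < K + x \<and> h 0 (K - x)"
  proof (cases "y = K")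
    case True
    show ?thesis using assms less_iff_succ_less_eq[of 0 x] less_iff_succ_less_eq[of x K] unfolding True by (auto simp: inv_v_def inv_h_def)
  next
    case False
    then show ?thesis using assms less_iff_succ_less_eq[of K y] less_iff_succ_less_eq[of x K] by (auto simp: inv_v_def inv_h_def)
  qed
  consider "K \<le> x \<or> K + K - 1 \<le> y" | "x = 0" "y < K + K - 1" | "0 < x" "x < K" "y < K + K - 1" "x \<le> y - K"
    | "0 < x" "x < K" "y < K + K - 1" "x = y - K + 1" | "0 < x" "x < K" "y < K + K - 1" "y - K + 1 < x"
    using assms less_iff_succ_less_eq[of "y - K" x] by linarith
  then show ?thesis
  proof cases
    case 1
    then show ?thesis
      using assms less_iff_succ_less_eq[of x K] unfolding inv_deg_def deg_def E W N S by auto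
  next
    case 2
    have "\<not> v 0 w" for w using centredD(2)[OF assms(1)] by blast
    then show ?thesis
      using 2 assms less_iff_succ_less_eq[of y "K + K - 1"] unfolding inv_deg_def deg_def E W N S by auto
  next
    case 3
    then show ?thesis
      using assms less_iff_succ_less_eq[of y "K + K - 1"] unfolding inv_deg_def deg_def E W N S by auto
  next
    case 4
    then have eq: "K + K - 1 - y = K - x" by simp
    have "y \<le> K + K - 2" "\<not> x \<le> y - K" "x \<le> y - K + 1" "y < K + x" "\<not> y < K - 1 + x" "x \<noteq> 0"
      "\<not> (K \<le> x \<or> K + K - 1 \<le> y)"
      using 4 less_iff_succ_less_eq[of y "K + K - 1"] by auto
    then show ?thesis
      using 4(1,2) unfolding inv_deg_def deg_def E W N S eq by simp
  next
    case 5
    then show ?thesis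
      using assms less_iff_succ_less_eq[of "y - K + 1" x] unfolding inv_deg_def deg_def E W N S by auto
  qed
qed

lemma inv_deg_arc:
  assumes "centred K h v" "0 < K" "K \<le> \<bar>y\<bar>" "\<bar>x\<bar> \<le> \<bar>y\<bar>"
  shows "inv_deg K h v x y =
    (if K \<le> \<bar>x\<bar> \<or> K + K - 1 \<le> \<bar>y\<bar> then 0
     else if x = 0 then deg h v 0 (sgn y * (K + K - 1 - \<bar>y\<bar>))
     else 2 * of_bool (h (if 0 < x then 0 else - 1)
       (sgn y * (if \<bar>x\<bar> \<le> \<bar>y\<bar> - K then K + K - 1 - \<bar>y\<bar> else K - \<bar>x\<bar>))))"
proof -
  have 1: "inv_deg K h v x y =
    (if K \<le> x \<or> K + K - 1 \<le> \<bar>y\<bar> then 0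
     else if x = 0 then deg h v 0 (sgn y * (K + K - 1 - \<bar>y\<bar>))
     else 2 * of_bool (h 0 (sgn y * (if x \<le> \<bar>y\<bar> - K then K + K - 1 - \<bar>y\<bar> else K - x))))"
    if c: "centred K h v" and "0 \<le> x" "x \<le> \<bar>y\<bar>" "K \<le> \<bar>y\<bar>" for h v and x y :: 'a
  proof (cases "0 < y")
    case True
    then show ?thesis using inv_deg_arc_pos[OF c assms(2), of y x] that by simp
  next
    case False
    then have "0 < - y" using that assms(2) by linarith
    then show ?thesis
      using inv_deg_arc_pos[OF centred_flip_y[OF c] assms(2), of "- y" x] that
      unfolding inv_deg_flip_y deg_flip_y by simp
  qed
  show ?thesis
  proof (cases "0 \<le> x")
    case True
    then show ?thesis using 1[OF assms(1), of x y] assms by simp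
  next
    case False
    then show ?thesis
      using 1[OF centred_flip_x[OF assms(1)], of "- x" y] assms
      unfolding inv_deg_flip_x deg_flip_x by simp
  qed
qed

lemma inv_deg_arc':
  assumes "centred K h v" "0 < K" "K \<le> \<bar>x\<bar>" "\<bar>y\<bar> \<le> \<bar>x\<bar>"
  shows "inv_deg K h v x y =
    (if K \<le> \<bar>y\<bar> \<or> K + K - 1 \<le> \<bar>x\<bar> then 0
     else if y = 0 then deg h v (sgn x * (K + K - 1 - \<bar>x\<bar>)) 0
     else 2 * of_bool (v (sgn x * (if \<bar>y\<bar> \<le> \<bar>x\<bar> - K then K + K - 1 - \<bar>x\<bar> else K - \<bar>y\<bar>))
       (if 0 < y then 0 else - 1)))"
  using inv_deg_arc[OF centred_transpose[OF assms(1)] assms(2-)]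
  unfolding inv_deg_transpose[of K v h] deg_transpose[of v h] .

text \<open>\<open>(x, y)\<close> is the image of \<open>(u, w)\<close>; points on an axis are mapped to the middle of an arc.\<close>

definition inv_source :: "'a::discrete_idom \<Rightarrow> 'a \<Rightarrow> 'a \<Rightarrow> 'a \<Rightarrow> 'a \<Rightarrow> bool" where
  "inv_source K x y u w \<longleftrightarrow>
     x \<noteq> 0 \<and> y \<noteq> 0 \<and> \<bar>x\<bar> < K \<and> \<bar>y\<bar> < K \<and> u = sgn x * (K - \<bar>y\<bar>) \<and> w = sgn y * (K - \<bar>x\<bar>) \<or>
     x = 0 \<and> u = 0 \<and> K \<le> \<bar>y\<bar> \<and> \<bar>y\<bar> < K + K - 1 \<and> w = sgn y * (K + K - 1 - \<bar>y\<bar>) \<or>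
     y = 0 \<and> w = 0 \<and> K \<le> \<bar>x\<bar> \<and> \<bar>x\<bar> < K + K - 1 \<and> u = sgn x * (K + K - 1 - \<bar>x\<bar>)"

text \<open>Which old point or edge decides the degree at \<open>(x, y)\<close> does not depend on
  the picture. The same case thus applies to blue and red at once, and evenness of degrees and
  disjointness are inherited point by point.\<close>

lemma inv_deg_cases:
  assumes "0 < K"
  obtains (zero) "\<And>h v. centred K h v \<Longrightarrow> inv_deg K h v x y = 0"
  | (vertex) u w where "inv_source K x y u w" "\<And>h v. centred K h v \<Longrightarrow> inv_deg K h v x y = deg h v u w"
  | (h_edge) u w where "\<And>h v. centred K h v \<Longrightarrow> inv_deg K h v x y = 2 * of_bool (h u w)"
  | (v_edge) u w where "\<And>h v. centred K h v \<Longrightarrow> inv_deg K h v x y = 2 * of_bool (v u w)"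
proof -
  consider (axis) "\<bar>x\<bar> < K" "\<bar>y\<bar> < K" "x = 0 \<or> y = 0" | (block) "\<bar>x\<bar> < K" "\<bar>y\<bar> < K" "x \<noteq> 0" "y \<noteq> 0"
    | (arc) "K \<le> \<bar>y\<bar>" "\<bar>x\<bar> \<le> \<bar>y\<bar>" | (arc') "K \<le> \<bar>x\<bar>" "\<bar>y\<bar> \<le> \<bar>x\<bar>"
    by linarith
  then show thesis
  proof cases
    case axis
    then show thesis using inv_deg_axis zero by blast
  next
    case block
    show thesis
    proof (rule vertex)
      show "inv_source K x y (sgn x * (K - \<bar>y\<bar>)) (sgn y * (K - \<bar>x\<bar>))"
        using block unfolding inv_source_def by blast
    qed (use block inv_deg_block in blast)
  next
    case arc
    note D = inv_deg_arc[OF _ assms arc]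
    consider "K \<le> \<bar>x\<bar> \<or> K + K - 1 \<le> \<bar>y\<bar>" | "\<not> (K \<le> \<bar>x\<bar> \<or> K + K - 1 \<le> \<bar>y\<bar>)" "x = 0"
      | "\<not> (K \<le> \<bar>x\<bar> \<or> K + K - 1 \<le> \<bar>y\<bar>)" "x \<noteq> 0" by blast
    then show thesis
    proof cases
      case 1
      then show thesis using D by (intro zero) simp
    next
      case 2
      show thesis
        by (rule vertex[of 0 "sgn y * (K + K - 1 - \<bar>y\<bar>)"]) (use 2 arc D in \<open>auto simp: inv_source_def\<close>)
    next
      case 3
      then show thesis using D by (intro h_edge) simp
    qed
  next
    case arc'
    note D = inv_deg_arc'[OF _ assms arc']
    consider "K \<le> \<bar>y\<bar> \<or> K + K - 1 \<le> \<bar>x\<bar>" | "\<not> (K \<le> \<bar>y\<bar> \<or> K + K - 1 \<le> \<bar>x\<bar>)" "y = 0"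
      | "\<not> (K \<le> \<bar>y\<bar> \<or> K + K - 1 \<le> \<bar>x\<bar>)" "y \<noteq> 0" by blast
    then show thesis
    proof cases
      case 1
      then show thesis using D by (intro zero) simp
    next
      case 2
      show thesis
        by (rule vertex[of "sgn x * (K + K - 1 - \<bar>x\<bar>)" 0]) (use 2 arc' D in \<open>auto simp: inv_source_def\<close>)
    next
      case 3
      then show thesis using D by (intro v_edge) simp
    qed
  qed
qed

section \<open>Paths by their degrees, attached elbows and translations\<close>

definition linked :: "'a pic \<Rightarrow> 'a pic \<Rightarrow> 'a::discrete_idom \<Rightarrow> 'a \<Rightarrow> 'a \<Rightarrow> 'a \<Rightarrow> bool" where
  "linked h v x1 y1 x2 y2 \<longleftrightarrow> deg h v x1 y1 = 1 \<and> deg h v x2 y2 = 1 \<and>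
     (\<forall>x y. (x, y) \<noteq> (x1, y1) \<longrightarrow> (x, y) \<noteq> (x2, y2) \<longrightarrow> deg h v x y = 0 \<or> deg h v x y = 2)"

lemma linked_sym: "linked h v x1 y1 x2 y2 \<Longrightarrow> linked h v x2 y2 x1 y1"
  unfolding linked_def by blast

text \<open>
  The path along row \<open>q\<close> from column \<open>a\<close> to column \<open>b\<close> together with column \<open>p\<close> from row \<open>c\<close> to row
  \<open>d\<close>. It is used with \<open>p\<close> one of \<open>a, b\<close> and \<open>q\<close> one of \<open>c, d\<close>, so that its ends are
  \<open>(a + b - p, q)\<close> and \<open>(p, c + d - q)\<close>.
\<close>

definition elbow_h :: "'a::discrete_idom \<Rightarrow> 'a \<Rightarrow> 'a \<Rightarrow> 'a pic" where
  "elbow_h q a b x y \<longleftrightarrow> y = q \<and> a \<le> x \<and> x < b"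

definition elbow_v :: "'a::discrete_idom \<Rightarrow> 'a \<Rightarrow> 'a \<Rightarrow> 'a pic" where
  "elbow_v p c d x y \<longleftrightarrow> x = p \<and> c \<le> y \<and> y < d"

definition elbow :: "'a::discrete_idom \<Rightarrow> 'a \<Rightarrow> 'a \<Rightarrow> 'a \<Rightarrow> 'a \<Rightarrow> 'a \<Rightarrow> 'a \<Rightarrow> 'a \<Rightarrow> bool" where
  "elbow q a b p c d x y \<longleftrightarrow> y = q \<and> a \<le> x \<and> x \<le> b \<or> x = p \<and> c \<le> y \<and> y \<le> d"

lemma elbow_segment:
  fixes a b t :: "'a :: discrete_idom"
  assumes "a < b"
  shows "of_bool (a \<le> t - 1 \<and> t - 1 < b) + of_bool (a \<le> t \<and> t < b) =
    (if a \<le> t \<and> t \<le> b then if t = a \<or> t = b then 1 else 2 else 0 :: nat)"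
proof -
  have "a \<le> t - 1 \<longleftrightarrow> a < t" "t - 1 < b \<longleftrightarrow> t \<le> b"
    using less_iff_succ_less_eq[of a t] less_iff_succ_less_eq[of "t - 1" b] by auto
  then show ?thesis using assms by auto
qed

lemma deg_elbow:
  assumes "a < b" "c < d" "p = a \<or> p = b" "q = c \<or> q = d"
  shows "deg (elbow_h q a b) (elbow_v p c d) x y =
    (if (x, y) = (a + b - p, q) \<or> (x, y) = (p, c + d - q) then 1 else if elbow q a b p c d x y then 2 else 0)"
proof -
  have "of_bool (elbow_h q a b (x - 1) y) + of_bool (elbow_h q a b x y) =
      (if y = q then if a \<le> x \<and> x \<le> b then if x = a \<or> x = b then 1 else 2 else 0 else 0 :: nat)"
    unfolding elbow_h_def using elbow_segment[OF assms(1), of x] by auto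
  moreover have "of_bool (elbow_v p c d x (y - 1)) + of_bool (elbow_v p c d x y) =
      (if x = p then if c \<le> y \<and> y \<le> d then if y = c \<or> y = d then 1 else 2 else 0 else 0 :: nat)"
    unfolding elbow_v_def using elbow_segment[OF assms(2), of y] by auto
  ultimately have "deg (elbow_h q a b) (elbow_v p c d) x y =
      (if y = q then if a \<le> x \<and> x \<le> b then if x = a \<or> x = b then 1 else 2 else 0 else 0) +
      (if x = p then if c \<le> y \<and> y \<le> d then if y = c \<or> y = d then 1 else 2 else 0 else 0)"
    unfolding deg_def by linarith
  moreover have "a \<le> b" "c \<le> d" "a \<noteq> b" "c \<noteq> d" using assms by auto
  ultimately show ?thesis
    unfolding elbow_def using assms(3,4)
    by (elim disjE; cases "y = q"; cases "x = p"; simp add: less_le)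
qed

lemma deg_eq_0_iff: "deg h v x y = 0 \<longleftrightarrow> \<not> h (x - 1) y \<and> \<not> h x y \<and> \<not> v x (y - 1) \<and> \<not> v x y"
  by (auto simp: deg_def)

text \<open>An edge shared with the elbow would have an end where \<open>deg h v\<close> vanishes:
  of the two ends of an elbow edge in row \<open>q\<close> at most one is exempt from the
  hypothesis, and likewise in column \<open>p\<close>. Hence no edge is counted twice.\<close>

lemma deg_attach:
  assumes "a < b" "c < d" "p = a \<or> p = b" "q = c \<or> q = d"
    and 0: "\<And>x y. elbow q a b p c d x y \<Longrightarrow> (x, y) \<noteq> (a + b - p, q) \<Longrightarrow> (x, y) \<noteq> (p, c + d - q) \<Longrightarrow> deg h v x y = 0"
  shows "deg (\<lambda>x y. h x y \<or> elbow_h q a b x y) (\<lambda>x y. v x y \<or> elbow_v p c d x y) x y =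
    deg h v x y + deg (elbow_h q a b) (elbow_v p c d) x y"
proof -
  have h: "\<not> h x y" if "elbow_h q a b x y" for x y
  proof -
    have "elbow q a b p c d x y" "elbow q a b p c d (x + 1) y" "y = q" "q \<noteq> c + d - q"
      using that assms(1-4) less_iff_succ_less_eq[of x b] by (auto simp: elbow_def elbow_h_def)
    then show ?thesis
      using 0[of x y] 0[of "x + 1" y] deg_eq_0_iff[of h v x y] deg_eq_0_iff[of h v "x + 1" y] by force
  qed
  have v: "\<not> v x y" if "elbow_v p c d x y" for x y
  proof -
    have "elbow q a b p c d x y" "elbow q a b p c d x (y + 1)" "x = p" "p \<noteq> a + b - p"
      using that assms(1-4) less_iff_succ_less_eq[of y d] by (auto simp: elbow_def elbow_v_def)
    then show ?thesis
      using 0[of x y] 0[of x "y + 1"] deg_eq_0_iff[of h v x y] deg_eq_0_iff[of h v x "y + 1"] by force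
  qed
  show ?thesis
    using h[of "x - 1" y] h[of x y] v[of x "y - 1"] v[of x y] unfolding deg_def by auto
qed

text \<open>The old end gains a second edge and the free end of the elbow takes its place. The far
  end \<open>(x2, y2)\<close> is not touched, because its degree 1 excludes it from the
  elbow.\<close>

lemma linked_extend:
  assumes "linked h v x1 y1 x2 y2" and L: "a < b" "c < d" "p = a \<or> p = b" "q = c \<or> q = d"
    and 0: "\<And>x y. elbow q a b p c d x y \<Longrightarrow> (x, y) \<noteq> (x1, y1) \<Longrightarrow> deg h v x y = 0"
    and ends: "(x1, y1) = (a + b - p, q) \<and> (x3, y3) = (p, c + d - q) \<or> (x1, y1) = (p, c + d - q) \<and> (x3, y3) = (a + b - p, q)"
    and ne: "(x1, y1) \<noteq> (x2, y2)"
  shows "linked (\<lambda>x y. h x y \<or> elbow_h q a b x y) (\<lambda>x y. v x y \<or> elbow_v p c d x y) x3 y3 x2 y2"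
proof -
  have D: "deg (\<lambda>x y. h x y \<or> elbow_h q a b x y) (\<lambda>x y. v x y \<or> elbow_v p c d x y) x y = deg h v x y +
      (if (x, y) = (x1, y1) \<or> (x, y) = (x3, y3) then 1 else if elbow q a b p c d x y then 2 else 0)" for x y
  proof -
    have "deg (\<lambda>x y. h x y \<or> elbow_h q a b x y) (\<lambda>x y. v x y \<or> elbow_v p c d x y) x y =
        deg h v x y + deg (elbow_h q a b) (elbow_v p c d) x y"
      by (rule deg_attach[OF L]) (use 0 ends in auto)
    then show ?thesis unfolding deg_elbow[OF L] using ends by auto
  qed
  have e: "elbow q a b p c d x1 y1" "elbow q a b p c d x3 y3" "(x3, y3) \<noteq> (x1, y1)"
    using ends L unfolding elbow_def by auto
  have "\<not> elbow q a b p c d x2 y2"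
    using 0[of x2 y2] assms(1) ne unfolding linked_def by auto
  then show ?thesis
    using assms(1) 0 e unfolding linked_def D by auto
qed


definition boxed :: "'a::discrete_idom \<Rightarrow> 'a pic \<Rightarrow> 'a pic \<Rightarrow> bool" where
  "boxed n h v \<longleftrightarrow>
     (\<forall>x y. h x y \<longrightarrow> 0 \<le> x \<and> x < n \<and> 0 \<le> y \<and> y \<le> n) \<and>
     (\<forall>x y. v x y \<longrightarrow> 0 \<le> x \<and> x \<le> n \<and> 0 \<le> y \<and> y < n)"

lemma boxedD:
  assumes "boxed n h v"
  shows "h x y \<Longrightarrow> 0 \<le> x \<and> x < n \<and> 0 \<le> y \<and> y \<le> n"
    and "v x y \<Longrightarrow> 0 \<le> x \<and> x \<le> n \<and> 0 \<le> y \<and> y < n"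
  using assms unfolding boxed_def by blast+

lemma boxed_deg_0:
  assumes "boxed n h v" "x < 0 \<or> n < x \<or> y < 0 \<or> n < y"
  shows "deg h v x y = 0"
proof -
  have "\<not> h (x - 1) y"
    using boxedD(1)[OF assms(1), of "x - 1" y] assms(2) less_iff_succ_less_eq[of "x - 1" n] by auto
  moreover have "\<not> h x y" using boxedD(1)[OF assms(1), of x y] assms(2) by auto
  moreover have "\<not> v x (y - 1)"
    using boxedD(2)[OF assms(1), of x "y - 1"] assms(2) less_iff_succ_less_eq[of "y - 1" n] by auto
  moreover have "\<not> v x y" using boxedD(2)[OF assms(1), of x y] assms(2) by auto
  ultimately show ?thesis by (simp add: deg_eq_0_iff)
qed

lemma deg_union_0:
  "deg (\<lambda>x y. h x y \<or> h' x y) (\<lambda>x y. v x y \<or> v' x y) x y = 0 \<longleftrightarrow> deg h v x y = 0 \<and> deg h' v' x y = 0"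
  by (auto simp: deg_eq_0_iff)

lemma deg_elbow_0:
  assumes "a < b" "c < d" "p = a \<or> p = b" "q = c \<or> q = d"
  shows "deg (elbow_h q a b) (elbow_v p c d) x y = 0 \<longleftrightarrow> \<not> elbow q a b p c d x y"
  using assms unfolding deg_elbow[OF assms] by (auto simp: elbow_def)

definition shift :: "'a::discrete_idom \<Rightarrow> 'a \<Rightarrow> 'a pic \<Rightarrow> 'a pic" where
  "shift s t h x y = h (x - s) (y - t)"

lemma deg_shift: "deg (shift s t h) (shift s t v) x y = deg h v (x - s) (y - t)"
  by (simp add: deg_def shift_def algebra_simps)

lemma linked_shift:
  assumes "linked h v x1 y1 x2 y2"
  shows "linked (shift s t h) (shift s t v) (x1 + s) (y1 + t) (x2 + s) (y2 + t)"
  using assms unfolding linked_def deg_shift by (auto simp: algebra_simps)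


section \<open>From curves to corners: turning the picture inside out\<close>

text \<open>
  The inverted picture with its two ends prolonged to corners of the square with centre \<open>(0, 0)\<close> and side
  \<open>4 K\<close>.
\<close>

definition blue_h :: "'a::discrete_idom \<Rightarrow> 'a pic \<Rightarrow> 'a pic \<Rightarrow> 'a pic" where
  "blue_h K h v = (\<lambda>x y. (inv_h K h v x y \<or> elbow_h (1 - K) (- K - K) (1 - K) x y) \<or> elbow_h (- K - K) (K - 1) (K + K) x y)"

definition blue_v :: "'a::discrete_idom \<Rightarrow> 'a pic \<Rightarrow> 'a pic \<Rightarrow> 'a pic" where
  "blue_v K h v = (\<lambda>x y. (inv_v K h v x y \<or> elbow_v (- K - K) (1 - K) (K + K) x y) \<or> elbow_v (K - 1) (- K - K) (1 - K) x y)"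

definition red_h :: "'a::discrete_idom \<Rightarrow> 'a pic \<Rightarrow> 'a pic \<Rightarrow> 'a pic" where
  "red_h K h v = (\<lambda>x y. (inv_h K h v x y \<or> elbow_h (K + K) 0 (K + K) x y) \<or> elbow_h (- K - K) (- K - K) 0 x y)"

definition red_v :: "'a::discrete_idom \<Rightarrow> 'a pic \<Rightarrow> 'a pic \<Rightarrow> 'a pic" where
  "red_v K h v = (\<lambda>x y. (inv_v K h v x y \<or> elbow_v 0 (K + K - 2) (K + K) x y) \<or> elbow_v 0 (- K - K) (3 - K - K) x y)"

section \<open>Free routes from the ends of the inverted paths to the corners\<close>

abbreviation "blue_elbow1 K \<equiv> elbow (1 - K) (- K - K) (1 - K) (- K - K) (1 - K) (K + K)"

abbreviation "blue_elbow2 K \<equiv> elbow (- K - K) (K - 1) (K + K) (K - 1) (- K - K) (1 - K)"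

abbreviation "red_elbow1 K \<equiv> elbow (K + K) 0 (K + K) 0 (K + K - 2) (K + K)"

abbreviation "red_elbow2 K \<equiv> elbow (- K - K) (- K - K) 0 0 (- K - K) (3 - K - K)"

text \<open>Origin of the constants: \<open>(- 1, - 1)\<close> and \<open>(1, - 1)\<close> are next
  to the centre and go to the outer corners of their quadrants, while a point \<open>(0, j)\<close>
  of the axis goes to the middle of arc \<open>K - |j|\<close>, in row
  \<open>K + K - 1 - |j|\<close> for positive \<open>j\<close> and in the opposite row for negative
  \<open>j\<close>.\<close>

lemma inv_source_unique:
  assumes "0 < K" "inv_source K x y u w"
  shows "u = - 1 \<Longrightarrow> w = - 1 \<Longrightarrow> x = 1 - K \<and> y = 1 - K"
    and "u = 1 \<Longrightarrow> w = - 1 \<Longrightarrow> x = K - 1 \<and> y = 1 - K"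
    and "u = 0 \<Longrightarrow> w = 1 \<Longrightarrow> x = 0 \<and> y = K + K - 2"
    and "u = 0 \<Longrightarrow> w = - 2 \<Longrightarrow> x = 0 \<and> y = 3 - K - K"
  using assms unfolding inv_source_def by (auto simp: sgn_if abs_if split: if_splits)

lemma inv_deg_ends:
  assumes "centred K h v" "3 \<le> K"
  shows "inv_deg K h v (1 - K) (1 - K) = deg h v (- 1) (- 1)"
    and "inv_deg K h v (K - 1) (1 - K) = deg h v 1 (- 1)"
    and "inv_deg K h v 0 (K + K - 2) = deg h v 0 1"
    and "inv_deg K h v 0 (3 - K - K) = deg h v 0 (- 2)"
    and "inv_deg K h v 0 (2 - K - K) = deg h v 0 (- 1)"
  using assms inv_deg_block[OF assms(1), of "1 - K" "1 - K"] inv_deg_block[OF assms(1), of "K - 1" "1 - K"]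
    inv_deg_arc[OF assms(1), of "K + K - 2" 0] inv_deg_arc[OF assms(1), of "3 - K - K" 0]
    inv_deg_arc[OF assms(1), of "2 - K - K" 0]
  by (simp_all add: abs_if)

lemma inv_deg_far:
  assumes "centred K h v" "0 < K" "K + K - 1 \<le> \<bar>x\<bar> \<or> K + K - 1 \<le> \<bar>y\<bar>"
  shows "inv_deg K h v x y = 0"
proof -
  have "1 \<le> K" using assms(2) less_iff_succ_less_eq[of 0 K] by simp
  then show ?thesis
    using inv_deg_arc[OF assms(1,2), of y x] inv_deg_arc'[OF assms(1,2), of x y] assms(3)
    by (cases "\<bar>x\<bar> \<le> \<bar>y\<bar>") auto
qed

text \<open>The left route along row \<open>1 - K\<close> follows the lower leg of the outermost
  left arc, which is the image of \<open>v (- 1) (- 1)\<close>. The other route, down column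
  \<open>K - 1\<close>, follows the right leg of the outermost lower arc, which is the image of
  \<open>h 0 (- 1)\<close>. Both edges are absent, and beyond the arcs everything is empty.\<close>

lemma blue_routes:
  assumes c: "centred K h v" and K: "3 \<le> K" and v: "\<not> v (- 1) (- 1)" and 0: "deg h v 0 (- 1) = 0"
  shows "blue_elbow1 K x y \<Longrightarrow> (x, y) \<noteq> (1 - K, 1 - K) \<Longrightarrow>
      inv_deg K h v x y = 0"
    and "blue_elbow2 K x y \<Longrightarrow> (x, y) \<noteq> (K - 1, 1 - K) \<Longrightarrow>
      inv_deg K h v x y = 0"
proof -
  have K0: "0 < K" using K by simp
  assume e: "blue_elbow1 K x y" "(x, y) \<noteq> (1 - K, 1 - K)"
  show "inv_deg K h v x y = 0"
  proof (cases "K + K - 1 \<le> \<bar>x\<bar>")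
    case True
    then show ?thesis using inv_deg_far[OF c K0] by blast
  next
    case False
    then have "y = 1 - K" "x < 1 - K" "x \<noteq> - K - K" using e K by (auto simp: elbow_def)
    then have "y = 1 - K" "x \<le> - K" using less_iff_succ_less_eq[of x "1 - K"] by auto
    then show ?thesis using inv_deg_arc'[OF c K0, of x y] K False v by (auto simp: abs_if)
  qed
next
  have h: "\<not> h 0 (- 1)" using 0 by (simp add: deg_eq_0_iff)
  have K0: "0 < K" using K by simp
  assume e: "blue_elbow2 K x y" "(x, y) \<noteq> (K - 1, 1 - K)"
  show "inv_deg K h v x y = 0"
  proof (cases "K + K - 1 \<le> \<bar>y\<bar>")
    case True
    then show ?thesis using inv_deg_far[OF c K0] by blast
  next
    case False
    then have "x = K - 1" "y < 1 - K" "y \<noteq> - K - K" using e K by (auto simp: elbow_def)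
    then have "x = K - 1" "y \<le> - K" using less_iff_succ_less_eq[of y "1 - K"] by auto
    then show ?thesis using inv_deg_arc[OF c K0, of y x] K False h by (auto simp: abs_if)
  qed
qed

text \<open>Above row \<open>K + K - 2\<close> there are no arcs. Below the image of
  \<open>(0, - 2)\<close> only the outermost lower arc remains to be crossed, and this happens at
  its middle, the image of the free point \<open>(0, - 1)\<close>.\<close>

lemma red_routes:
  assumes c: "centred K h v" and K: "3 \<le> K" and 0: "deg h v 0 (- 1) = 0"
  shows "red_elbow1 K x y \<Longrightarrow> (x, y) \<noteq> (0, K + K - 2) \<Longrightarrow> inv_deg K h v x y = 0"
    and "red_elbow2 K x y \<Longrightarrow> (x, y) \<noteq> (0, 3 - K - K) \<Longrightarrow>
      inv_deg K h v x y = 0"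
proof -
  have K0: "0 < K" using K by simp
  assume e: "red_elbow1 K x y" "(x, y) \<noteq> (0, K + K - 2)"
  have "K + K - 1 \<le> y"
    using e K less_iff_succ_less_eq[of "K + K - 2" y] by (auto simp: elbow_def)
  then show "inv_deg K h v x y = 0"
    using inv_deg_far[OF c K0] K by simp
next
  have K0: "0 < K" using K by simp
  assume e: "red_elbow2 K x y" "(x, y) \<noteq> (0, 3 - K - K)"
  show "inv_deg K h v x y = 0"
  proof (cases "K + K - 1 \<le> \<bar>y\<bar>")
    case True
    then show ?thesis using inv_deg_far[OF c K0] by blast
  next
    case False
    have "x = 0" "y < 3 - K - K" "1 - K - K < y" using e K False by (auto simp: elbow_def)
    then have "x = 0" "y = 2 - K - K"
      using less_iff_succ_less_eq[of y "3 - K - K"] less_iff_succ_less_eq[of "1 - K - K" y] by auto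
    then show ?thesis using inv_deg_ends(5)[OF c K] 0 by simp
  qed
qed

text \<open>A point of odd degree in the image stems from an old point, not from an edge, and
  \<open>inv_source_unique\<close> tells which point it is.\<close>

lemma linked_inv_blue:
  assumes c: "centred K h v" and K: "3 \<le> K" and l: "linked h v (- 1) (- 1) 1 (- 1)"
  shows "linked (inv_h K h v) (inv_v K h v) (1 - K) (1 - K) (K - 1) (1 - K)"
proof -
  have K0: "0 < K" using K by simp
  have "inv_deg K h v x y = 0 \<or> inv_deg K h v x y = 2"
    if "(x, y) \<noteq> (1 - K, 1 - K)" "(x, y) \<noteq> (K - 1, 1 - K)" for x y
  proof (cases rule: inv_deg_cases[OF K0, of x y, case_names zero vertex h_edge v_edge])
    case (vertex u w)
    then have "(u, w) \<noteq> (- 1, - 1)" "(u, w) \<noteq> (1, - 1)"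
      using inv_source_unique(1,2)[OF K0 vertex(1)] that by auto
    then show ?thesis using vertex(2)[OF c] l unfolding linked_def by metis
  qed (auto simp: c)
  then show ?thesis
    using l inv_deg_ends(1,2)[OF c K] unfolding linked_def inv_deg_def by simp
qed

lemma linked_inv_red:
  assumes c: "centred K h v" and K: "3 \<le> K" and l: "linked h v 0 1 0 (- 2)"
  shows "linked (inv_h K h v) (inv_v K h v) 0 (K + K - 2) 0 (3 - K - K)"
proof -
  have K0: "0 < K" using K by simp
  have "inv_deg K h v x y = 0 \<or> inv_deg K h v x y = 2"
    if "(x, y) \<noteq> (0, K + K - 2)" "(x, y) \<noteq> (0, 3 - K - K)" for x y
  proof (cases rule: inv_deg_cases[OF K0, of x y, case_names zero vertex h_edge v_edge])
    case (vertex u w)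
    then have "(u, w) \<noteq> (0, 1)" "(u, w) \<noteq> (0, - 2)"
      using inv_source_unique(3,4)[OF K0 vertex(1)] that by auto
    then show ?thesis using vertex(2)[OF c] l unfolding linked_def by metis
  qed (auto simp: c)
  then show ?thesis
    using l inv_deg_ends(3,4)[OF c K] unfolding linked_def inv_deg_def by simp
qed

lemma linked_blue:
  assumes c: "centred K h v" and K: "3 \<le> K" and l: "linked h v (- 1) (- 1) 1 (- 1)"
    and v: "\<not> v (- 1) (- 1)" and 0: "deg h v 0 (- 1) = 0"
  shows "linked (blue_h K h v) (blue_v K h v) (- K - K) (K + K) (K + K) (- K - K)"
proof -
  let ?h = "\<lambda>x y. inv_h K h v x y \<or> elbow_h (1 - K) (- K - K) (1 - K) x y"
  let ?v = "\<lambda>x y. inv_v K h v x y \<or> elbow_v (- K - K) (1 - K) (K + K) x y"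
  have "linked ?h ?v (- K - K) (K + K) (K - 1) (1 - K)"
    by (rule linked_extend[OF linked_inv_blue[OF c K l]])
      (use K blue_routes(1)[OF c K v 0] in \<open>auto simp: inv_deg_def\<close>)
  then have l': "linked ?h ?v (K - 1) (1 - K) (- K - K) (K + K)" by (rule linked_sym)
  have "linked (blue_h K h v) (blue_v K h v) (K + K) (- K - K) (- K - K) (K + K)"
    unfolding blue_h_def blue_v_def
  proof (rule linked_extend[OF l'])
    fix x y
    assume e: "blue_elbow2 K x y" "(x, y) \<noteq> (K - 1, 1 - K)"
    have "\<not> blue_elbow1 K x y"
      using e(1) K unfolding elbow_def by auto
    then have "deg (elbow_h (1 - K) (- K - K) (1 - K)) (elbow_v (- K - K) (1 - K) (K + K)) x y = 0"
      using K by (subst deg_elbow_0) auto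
    then show "deg ?h ?v x y = 0"
      unfolding deg_union_0 using blue_routes(2)[OF c K v 0 e] by (simp add: inv_deg_def)
  qed (use K in auto)
  then show ?thesis by (rule linked_sym)
qed

lemma linked_red:
  assumes c: "centred K h v" and K: "3 \<le> K" and l: "linked h v 0 1 0 (- 2)" and 0: "deg h v 0 (- 1) = 0"
  shows "linked (red_h K h v) (red_v K h v) (- K - K) (- K - K) (K + K) (K + K)"
proof -
  let ?h = "\<lambda>x y. inv_h K h v x y \<or> elbow_h (K + K) 0 (K + K) x y"
  let ?v = "\<lambda>x y. inv_v K h v x y \<or> elbow_v 0 (K + K - 2) (K + K) x y"
  have "linked ?h ?v (K + K) (K + K) 0 (3 - K - K)"
    by (rule linked_extend[OF linked_inv_red[OF c K l]])
      (use K red_routes(1)[OF c K 0] in \<open>auto simp: inv_deg_def\<close>)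
  then have l': "linked ?h ?v 0 (3 - K - K) (K + K) (K + K)" by (rule linked_sym)
  show ?thesis
    unfolding red_h_def red_v_def
  proof (rule linked_extend[OF l'])
    fix x y
    assume e: "red_elbow2 K x y" "(x, y) \<noteq> (0, 3 - K - K)"
    have "\<not> red_elbow1 K x y"
      using e(1) K unfolding elbow_def by auto
    then have "deg (elbow_h (K + K) 0 (K + K)) (elbow_v 0 (K + K - 2) (K + K)) x y = 0"
      using K by (subst deg_elbow_0) auto
    then show "deg ?h ?v x y = 0"
      unfolding deg_union_0 using red_routes(2)[OF c K 0 e] by (simp add: inv_deg_def)
  qed (use K in auto)
qed

lemma deg_blue_0:
  assumes "3 \<le> K"
  shows "deg (blue_h K h v) (blue_v K h v) x y = 0 \<longleftrightarrow> inv_deg K h v x y = 0 \<and>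
    \<not> blue_elbow1 K x y \<and>
    \<not> blue_elbow2 K x y"
  unfolding blue_h_def blue_v_def deg_union_0 inv_deg_def using assms by (subst (1 2) deg_elbow_0) auto

lemma deg_red_0:
  assumes "3 \<le> K"
  shows "deg (red_h K h v) (red_v K h v) x y = 0 \<longleftrightarrow> inv_deg K h v x y = 0 \<and>
    \<not> red_elbow1 K x y \<and>
    \<not> red_elbow2 K x y"
  unfolding red_h_def red_v_def deg_union_0 inv_deg_def using assms by (subst (1 2) deg_elbow_0) auto

lemma boxed_shift:
  assumes "\<And>x y. deg h v x y \<noteq> 0 \<Longrightarrow> - s \<le> x \<and> x \<le> n - s \<and> - t \<le> y \<and> y \<le> n - t"
  shows "boxed n (shift s t h) (shift s t v)"
  unfolding boxed_def
proof (intro conjI allI impI)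
  fix x y
  assume "shift s t h x y"
  then have "deg h v (x - s) (y - t) \<noteq> 0" "deg h v (x - s + 1) (y - t) \<noteq> 0"
    by (simp_all add: deg_eq_0_iff shift_def)
  from this[THEN assms] show "0 \<le> x" "x < n" "0 \<le> y" "y \<le> n"
    using less_iff_succ_less_eq[of x n] by linarith+
next
  fix x y
  assume "shift s t v x y"
  then have "deg h v (x - s) (y - t) \<noteq> 0" "deg h v (x - s) (y - t + 1) \<noteq> 0"
    by (simp_all add: deg_eq_0_iff shift_def)
  from this[THEN assms] show "0 \<le> x" "x \<le> n" "0 \<le> y" "y < n"
    using less_iff_succ_less_eq[of y n] by linarith+
qed

lemma blue_red_bounded:
  assumes c: "centred K h v" and K: "3 \<le> K"
    and "deg (blue_h K h v) (blue_v K h v) x y \<noteq> 0 \<or> deg (red_h K h v) (red_v K h v) x y \<noteq> 0"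
  shows "- (K + K) \<le> x \<and> x \<le> K + K + K + K - (K + K) \<and> - (K + K) \<le> y \<and> y \<le> K + K + K + K - (K + K)"
proof -
  have "\<bar>x\<bar> < K + K - 1" "\<bar>y\<bar> < K + K - 1" if "inv_deg K h v x y \<noteq> 0"
    using inv_deg_far[OF c, of x y] that K by (meson linorder_not_le less_le_trans zero_less_numeral)+
  then show ?thesis
    using assms(3) K unfolding deg_blue_0[OF K] deg_red_0[OF K] elbow_def
    by (cases "inv_deg K h v x y = 0") (auto simp: abs_if split: if_splits)
qed

text \<open>The route lemmas hold for any picture, hence also for that of the other colour: the blue
  routes avoid the red image and conversely. Their starting points are covered by disjointness of
  the old pictures.\<close>

lemma blue_red_disjoint:
  assumes cb: "centred K bh bv" and cr: "centred K rh rv" and K: "3 \<le> K"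
    and lb: "linked bh bv (- 1) (- 1) 1 (- 1)" and lr: "linked rh rv 0 1 0 (- 2)"
    and b: "\<not> bv (- 1) (- 1)" "deg bh bv 0 (- 1) = 0" and r: "deg rh rv 0 (- 1) = 0"
    and disj: "\<And>x y. deg bh bv x y = 0 \<or> deg rh rv x y = 0"
  shows "deg (blue_h K bh bv) (blue_v K bh bv) x y = 0 \<or> deg (red_h K rh rv) (red_v K rh rv) x y = 0"
proof -
  let ?b1 = "blue_elbow1 K x y"
  let ?b2 = "blue_elbow2 K x y"
  let ?r1 = "red_elbow1 K x y"
  let ?r2 = "red_elbow2 K x y"
  have K0: "0 < K" using K by simp
  \<comment> \<open>\<open>(- 1, - 1)\<close> is a blue end, so no red edge reaches it.\<close>
  have r': "\<not> rv (- 1) (- 1)"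
  proof -
    have "deg rh rv (- 1) (- 1) = 0" using disj[of "- 1" "- 1"] lb by (simp add: linked_def)
    then show ?thesis by (simp add: deg_eq_0_iff)
  qed
  note B = deg_blue_0[OF K, of bh bv x y] and R = deg_red_0[OF K, of rh rv x y]
  have inv: "inv_deg K bh bv x y = 0 \<or> inv_deg K rh rv x y = 0"
  proof (cases rule: inv_deg_cases[OF K0, of x y, case_names zero vertex h_edge v_edge])
    case zero
    then show ?thesis using cb by blast
  next
    case (vertex u w)
    then show ?thesis using cb cr disj[of u w] by simp
  next
    case (h_edge u w)
    then show ?thesis using cb cr disj[of u w] deg_eq_0_iff[of bh bv u w] deg_eq_0_iff[of rh rv u w] by auto
  next
    case (v_edge u w)
    then show ?thesis using cb cr disj[of u w] deg_eq_0_iff[of bh bv u w] deg_eq_0_iff[of rh rv u w] by auto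
  qed
  have br: "\<not> (?b1 \<and> ?r1)" "\<not> (?b1 \<and> ?r2)" "\<not> (?b2 \<and> ?r1)" "\<not> (?b2 \<and> ?r2)"
    using K unfolding elbow_def by auto
  have b1: "inv_deg K rh rv x y = 0" if ?b1
    using blue_routes(1)[OF cr K r' r that] inv_deg_ends(1)[OF cr K] disj[of "- 1" "- 1"] lb by (cases "(x, y) = (1 - K, 1 - K)") (auto simp: linked_def)
  have b2: "inv_deg K rh rv x y = 0" if ?b2
    using blue_routes(2)[OF cr K r' r that] inv_deg_ends(2)[OF cr K] disj[of "1" "- 1"] lb by (cases "(x, y) = (K - 1, 1 - K)") (auto simp: linked_def)
  have r1: "inv_deg K bh bv x y = 0" if ?r1
    using red_routes(1)[OF cb K b(2) that] inv_deg_ends(3)[OF cb K] disj[of 0 1] lr by (cases "(x, y) = (0, K + K - 2)") (auto simp: linked_def)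
  have r2: "inv_deg K bh bv x y = 0" if ?r2
    using red_routes(2)[OF cb K b(2) that] inv_deg_ends(4)[OF cb K] disj[of 0 "- 2"] lr by (cases "(x, y) = (0, 3 - K - K)") (auto simp: linked_def)
  show ?thesis
    unfolding B R using inv br b1 b2 r1 r2 by blast
qed


text \<open>
  The picture is recentred at the face with lower left corner \<open>(c, d)\<close>, and an empty row and column
  with number \<open>0\<close> are inserted there, crossed only by the old edges.
\<close>

definition cen :: "'a::discrete_idom \<Rightarrow> 'a \<Rightarrow> 'a" where
  "cen c u = (if 0 \<le> u then u + c else u + c + 1)"

text \<open>\<open>cen\<close> sends both \<open>- 1\<close> and \<open>0\<close> to
  \<open>c\<close>, so an old edge from column \<open>c\<close> to column \<open>c + 1\<close>
  occurs twice, as its halves on either side of the new column 0. The two old columns are now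
  columns \<open>- 1\<close> and \<open>1\<close>.\<close>

definition cen_h :: "'a::discrete_idom \<Rightarrow> 'a \<Rightarrow> 'a pic \<Rightarrow> 'a pic" where
  "cen_h c d h u w \<longleftrightarrow> w \<noteq> 0 \<and> h (cen c u) (cen d w)"

definition cen_v :: "'a::discrete_idom \<Rightarrow> 'a \<Rightarrow> 'a pic \<Rightarrow> 'a pic" where
  "cen_v c d v u w \<longleftrightarrow> u \<noteq> 0 \<and> v (cen c u) (cen d w)"

text \<open>
  With \<open>(c, d)\<close> the middle point, the two points on different sides are \<open>(- 1, 1)\<close> and \<open>(- 1, - 2)\<close> in the new
  coordinates. Cutting the blue edge to the right of \<open>(c, d)\<close> makes \<open>(- 1, - 1)\<close> and \<open>(1, - 1)\<close> the blue ends.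
  Toggling the half edge to the right of either red end moves that end to column \<open>0\<close>, whether or not the
  red path started with that edge.
\<close>

definition cut_h :: "'a pic \<Rightarrow> ('a::discrete_idom) pic" where
  "cut_h h u w \<longleftrightarrow> h u w \<and> \<not> (w = - 1 \<and> (u = - 1 \<or> u = 0))"

definition toggle_h :: "'a pic \<Rightarrow> ('a::discrete_idom) pic" where
  "toggle_h h u w \<longleftrightarrow> h u w \<noteq> (u = - 1 \<and> (w = 1 \<or> w = - 2))"

section \<open>Degrees in the recentred, cut and toggled pictures\<close>

lemma cen_simps [simp]:
  "cen c 0 = c" "cen c 1 = c + 1" "cen c (- 1) = c" "cen c (- 2) = c - 1"
  by (simp_all add: cen_def)

lemma cen_pred: "u \<noteq> 0 \<Longrightarrow> cen c (u - 1) = cen c u - 1"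
  using less_iff_succ_less_eq[of 0 u] by (auto simp: cen_def)

lemma cen_eq_iff:
  assumes "u \<noteq> 0"
  shows "cen c u = c \<longleftrightarrow> u = - 1" "cen c u = c + 1 \<longleftrightarrow> u = 1" "cen c u = c - 1 \<longleftrightarrow> u = - 2"
  using assms less_iff_succ_less_eq[of u 0] less_iff_succ_less_eq[of 0 u] by (auto simp: cen_def)

lemma deg_cen:
  "u \<noteq> 0 \<Longrightarrow> w \<noteq> 0 \<Longrightarrow> deg (cen_h c d h) (cen_v c d v) u w = deg h v (cen c u) (cen d w)"
  "w \<noteq> 0 \<Longrightarrow> deg (cen_h c d h) (cen_v c d v) 0 w = 2 * of_bool (h c (cen d w))"
  "u \<noteq> 0 \<Longrightarrow> deg (cen_h c d h) (cen_v c d v) u 0 = 2 * of_bool (v (cen c u) d)"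
  "deg (cen_h c d h) (cen_v c d v) 0 0 = 0"
  by (simp_all add: deg_def cen_h_def cen_v_def cen_pred)

lemma deg_cen_even:
  assumes "\<And>x y. deg h v x y = 0 \<or> deg h v x y = 2"
  shows "deg (cen_h c d h) (cen_v c d v) u w = 0 \<or> deg (cen_h c d h) (cen_v c d v) u w = 2"
  using assms[of "cen c u" "cen d w"] by (cases "u = 0"; cases "w = 0") (simp_all add: deg_cen)

lemma deg_cen_disjoint:
  assumes "\<And>x y. deg h v x y = 0 \<or> deg h' v' x y = 0"
  shows "deg (cen_h c d h) (cen_v c d v) u w = 0 \<or> deg (cen_h c d h') (cen_v c d v') u w = 0"
  using assms[of "cen c u" "cen d w"] assms[of c "cen d w"] assms[of "cen c u" d]
  by (cases "u = 0"; cases "w = 0") (auto simp: deg_cen deg_eq_0_iff)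

text \<open>New coordinates range at most from \<open>- n - 1\<close> to \<open>n\<close>, the extra
  1 being due to the inserted line, so \<open>n + 2\<close> works for every position of the
  face.\<close>

lemma centred_cen:
  assumes "boxed n h v" "0 \<le> c" "c \<le> n" "0 \<le> d" "d \<le> n"
  shows "centred (n + 2) (cen_h c d h) (cen_v c d v)"
  unfolding centred_def
proof (intro conjI allI impI)
  fix u w
  assume "cen_h c d h u w"
  then have "w \<noteq> 0" "0 \<le> cen c u \<and> cen c u < n \<and> 0 \<le> cen d w \<and> cen d w \<le> n"
    using boxedD(1)[OF assms(1)] by (auto simp: cen_h_def)
  then show "- (n + 2) < u" "u + 1 < n + 2" "- (n + 2) < w" "w < n + 2" "w \<noteq> 0"
    using assms by (auto simp: cen_def split: if_splits)
next
  fix u w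
  assume "cen_v c d v u w"
  then have "u \<noteq> 0" "0 \<le> cen c u \<and> cen c u \<le> n \<and> 0 \<le> cen d w \<and> cen d w < n"
    using boxedD(2)[OF assms(1)] by (auto simp: cen_v_def)
  then show "- (n + 2) < u" "u < n + 2" "- (n + 2) < w" "w + 1 < n + 2" "u \<noteq> 0"
    using assms by (auto simp: cen_def split: if_splits)
qed

lemma deg_cut:
  "deg (cut_h h) v u w = (if (u, w) = (- 1, - 1) then of_bool (h (- 2) (- 1)) + of_bool (v (- 1) (- 2)) + of_bool (v (- 1) (- 1))
    else if (u, w) = (0, - 1) then of_bool (v 0 (- 2)) + of_bool (v 0 (- 1))
    else if (u, w) = (1, - 1) then of_bool (h 1 (- 1)) + of_bool (v 1 (- 2)) + of_bool (v 1 (- 1))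
    else deg h v u w)"
proof -
  consider "u = - 1" "w = - 1" | "u = 0" "w = - 1" | "u = 1" "w = - 1" | "w \<noteq> - 1 \<or> u \<noteq> - 1 \<and> u \<noteq> 0 \<and> u \<noteq> 1"
    by blast
  then show ?thesis
  proof cases
    case 4
    have "u - 1 = - 1 \<longleftrightarrow> u = 0" "u - 1 = 0 \<longleftrightarrow> u = 1" by (simp_all add: algebra_simps)
    with 4 have "cut_h h (u - 1) w = h (u - 1) w" "cut_h h u w = h u w"
      by (auto simp: cut_h_def)
    then have "deg (cut_h h) v u w = deg h v u w" by (simp add: deg_def)
    moreover have "(u, w) \<noteq> (- 1, - 1)" "(u, w) \<noteq> (0, - 1)" "(u, w) \<noteq> (1, - 1)" using 4 by blast+
    ultimately show ?thesis by (simp only: if_False)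
  next
    case 1
    show ?thesis unfolding 1 by (simp add: deg_def cut_h_def)
  next
    case 2
    show ?thesis unfolding 2 by (simp add: deg_def cut_h_def)
  next
    case 3
    show ?thesis unfolding 3 by (simp add: deg_def cut_h_def)
  qed
qed

lemma deg_toggle:
  assumes "\<not> (u = - 1 \<and> (w = 1 \<or> w = - 2))" "\<not> (u = 0 \<and> (w = 1 \<or> w = - 2))"
  shows "deg (toggle_h h) v u w = deg h v u w"
proof -
  have "u - 1 = - 1 \<longleftrightarrow> u = 0" by (simp add: algebra_simps)
  then have "toggle_h h (u - 1) w = h (u - 1) w" "toggle_h h u w = h u w"
    using assms by (auto simp: toggle_h_def)
  then show ?thesis by (simp add: deg_def)
qed

text \<open>The points above and below \<open>(c, d)\<close> are free of blue, so both edges at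
  \<open>(c, d)\<close> are horizontal, and removing the right one leaves it with one edge. Its
  right neighbour had degree 2 and also keeps one.\<close>

lemma linked_cut:
  assumes even: "\<And>x y. deg bh bv x y = 0 \<or> deg bh bv x y = 2"
    and m: "deg bh bv c d = 2" and p: "deg bh bv c (d + 1) = 0" "deg bh bv c (d - 1) = 0"
  shows "linked (cut_h (cen_h c d bh)) (cen_v c d bv) (- 1) (- 1) 1 (- 1)"
    and "deg (cut_h (cen_h c d bh)) (cen_v c d bv) 0 (- 1) = 0"
    and "\<not> cen_v c d bv (- 1) (- 1)"
proof -
  have v: "\<not> bv c d" "\<not> bv c (d - 1)" using p by (simp_all add: deg_eq_0_iff)
  then have h: "bh (c - 1) d" "bh c d" using m by (auto simp: deg_def of_bool_def split: if_splits)
  then have r: "of_bool (bh (c + 1) d) + of_bool (bv (c + 1) (d - 1)) + of_bool (bv (c + 1) d) = (1 :: nat)"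
    using even[of "c + 1" d] by (simp add: deg_def)
  show "linked (cut_h (cen_h c d bh)) (cen_v c d bv) (- 1) (- 1) 1 (- 1)"
    unfolding linked_def deg_cut using deg_cen_even[OF even, of c d] h v r
    by (simp add: cen_h_def cen_v_def)
  show "deg (cut_h (cen_h c d bh)) (cen_v c d bv) 0 (- 1) = 0"
    unfolding deg_cut by (simp add: cen_v_def)
  show "\<not> cen_v c d bv (- 1) (- 1)" using v by (simp add: cen_v_def)
qed

text \<open>On column 0 both halves of an old edge are present or none, so toggling one half leaves
  exactly one there; at the old end it changes degree 1 into 0 or 2. Column 0 is wanted because its
  points are sent to the middles of the upper and lower arcs.\<close>

lemma linked_toggle:
  assumes l: "linked rh rv c (d + 1) c (d - 1)"
  shows "linked (toggle_h (cen_h c d rh)) (cen_v c d rv) 0 1 0 (- 2)"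
proof -
  let ?D = "deg (toggle_h (cen_h c d rh)) (cen_v c d rv)"
  let ?C = "deg (cen_h c d rh) (cen_v c d rv)"
  have e: "?D 0 1 = 1" "?D 0 (- 2) = 1"
    by (simp_all add: deg_def toggle_h_def cen_h_def cen_v_def)
  have C: "?C (- 1) 1 = 1" "?C (- 1) (- 2) = 1"
    using l by (simp_all add: deg_cen linked_def)
  have "?D (- 1) w = ?C (- 1) w + 1 \<or> ?D (- 1) w + 1 = ?C (- 1) w" if "w = 1 \<or> w = - 2" for w
    using that by (cases "cen_h c d rh (- 1) w") (simp_all add: deg_def toggle_h_def)
  from this[of 1] this[of "- 2"]
  have p: "?D (- 1) 1 = 0 \<or> ?D (- 1) 1 = 2" "?D (- 1) (- 2) = 0 \<or> ?D (- 1) (- 2) = 2"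
    unfolding C by linarith+
  have "?D u w = 0 \<or> ?D u w = 2" if "(u, w) \<noteq> (0, 1)" "(u, w) \<noteq> (0, - 2)" for u w
  proof (cases "u = - 1 \<and> (w = 1 \<or> w = - 2)")
    case True
    then show ?thesis using p by auto
  next
    case False
    then have D: "?D u w = ?C u w" using deg_toggle that by blast
    show ?thesis
    proof (cases "u = 0 \<or> w = 0")
      case True
      then show ?thesis unfolding D by (cases "u = 0"; cases "w = 0") (simp_all add: deg_cen)
    next
      case nz: False
      then have "(cen c u, cen d w) \<noteq> (c, d + 1)" "(cen c u, cen d w) \<noteq> (c, d - 1)"
        using False cen_eq_iff[of u c] cen_eq_iff[of w d] by auto
      then show ?thesis unfolding D using nz l by (simp add: deg_cen linked_def)
    qed
  qed
  then show ?thesis unfolding linked_def using e by blast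
qed

text \<open>The toggled half edges lie to the right of the two points on different sides. These have
  blue degree 0, so blue uses neither end of the half edges.\<close>

lemma cut_toggle_disjoint:
  assumes disj: "\<And>x y. deg bh bv x y = 0 \<or> deg rh rv x y = 0"
    and p: "deg bh bv c (d + 1) = 0" "deg bh bv c (d - 1) = 0"
  shows "deg (cut_h (cen_h c d bh)) (cen_v c d bv) u w = 0 \<or> deg (toggle_h (cen_h c d rh)) (cen_v c d rv) u w = 0"
proof -
  have cut: "deg (cut_h (cen_h c d bh)) (cen_v c d bv) u w = 0" if "deg (cen_h c d bh) (cen_v c d bv) u w = 0"
    using that by (auto simp: deg_eq_0_iff cut_h_def)
  have hp: "\<not> bh c (d + 1)" "\<not> bh c (d - 1)" using p by (simp_all add: deg_eq_0_iff)
  show ?thesis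
  proof (cases "(u = - 1 \<or> u = 0) \<and> (w = 1 \<or> w = - 2)")
    case True
    then have "deg (cen_h c d bh) (cen_v c d bv) u w = 0"
      using p hp by (auto simp: deg_cen)
    then show ?thesis using cut by blast
  next
    case False
    then show ?thesis
      using deg_cen_disjoint[OF disj, of c d u w] cut deg_toggle[of u w "cen_h c d rh" "cen_v c d rv"] by auto
  qed
qed

text \<open>\<open>F\<close> selects the colour and the direction of the edges, \<open>G\<close> the
  treatment of the ends. The shift by twice \<open>n + 2\<close> moves the lower left corner of the
  square to the origin.\<close>

definition inside_out ::
    "('a \<Rightarrow> 'a pic \<Rightarrow> 'a pic \<Rightarrow> 'a pic) \<Rightarrow>
     ('a pic \<Rightarrow> 'a pic) \<Rightarrow>
     'a::discrete_idom \<Rightarrow> 'a \<Rightarrow> 'a \<Rightarrow> 'a pic \<Rightarrow> 'a pic \<Rightarrow> 'a pic" where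
  "inside_out F G n c d h v = shift (n + 2 + (n + 2)) (n + 2 + (n + 2)) (F (n + 2) (G (cen_h c d h)) (cen_v c d v))"

theorem curve_to_corners:
  fixes n :: "'a :: discrete_idom"
  assumes "boxed n bh bv" "boxed n rh rv" and c: "0 \<le> c" "c \<le> n" and d: "1 \<le> d" "d + 1 \<le> n"
    and even: "\<And>x y. deg bh bv x y = 0 \<or> deg bh bv x y = 2"
    and m: "deg bh bv c d = 2" and p: "deg bh bv c (d + 1) = 0" "deg bh bv c (d - 1) = 0"
    and l: "linked rh rv c (d + 1) c (d - 1)"
    and disj: "\<And>x y. deg bh bv x y = 0 \<or> deg rh rv x y = 0"
  defines "N \<equiv> n + 2 + (n + 2) + (n + 2) + (n + 2)"
    and "bh' \<equiv> inside_out blue_h cut_h n c d bh bv" and "bv' \<equiv> inside_out blue_v cut_h n c d bh bv"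
    and "rh' \<equiv> inside_out red_h toggle_h n c d rh rv" and "rv' \<equiv> inside_out red_v toggle_h n c d rh rv"
  shows "boxed N bh' bv'" "boxed N rh' rv'" "linked bh' bv' 0 N N 0" "linked rh' rv' 0 0 N N"
    "deg bh' bv' x y = 0 \<or> deg rh' rv' x y = 0"
proof -
  let ?K = "n + 2"
  have K: "3 \<le> ?K" using d by simp
  have d': "0 \<le> d" "d \<le> n" using d by simp_all
  note cb0 = centred_cen[OF assms(1) c d'] and cr0 = centred_cen[OF assms(2) c d']
  have cb: "centred ?K (cut_h (cen_h c d bh)) (cen_v c d bv)"
    using cb0 unfolding centred_def cut_h_def by blast
  have cr: "centred ?K (toggle_h (cen_h c d rh)) (cen_v c d rv)"
    using cr0 d unfolding centred_def toggle_h_def by auto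
  note lb = linked_cut[OF even m p]
  note lr = linked_toggle[OF l]
  \<comment> \<open>Blue passes through the middle point, so red has no edge there. This frees
    \<open>(0, - 1)\<close>, at whose image the lower red route crosses the outermost arc.\<close>
  have "deg rh rv c d = 0" using disj[of c d] m by simp
  then have r: "deg (toggle_h (cen_h c d rh)) (cen_v c d rv) 0 (- 1) = 0"
    by (subst deg_toggle) (simp_all add: deg_cen deg_eq_0_iff)
  show "boxed N bh' bv'"
    unfolding bh'_def bv'_def inside_out_def N_def
    by (rule boxed_shift) (use blue_red_bounded[OF cb K] in auto)
  show "boxed N rh' rv'"
    unfolding rh'_def rv'_def inside_out_def N_def
    by (rule boxed_shift) (use blue_red_bounded[OF cr K] in auto)
  show "linked bh' bv' 0 N N 0"
    using linked_shift[OF linked_blue[OF cb K lb(1,3,2)], of "?K + ?K" "?K + ?K"]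
    unfolding bh'_def bv'_def inside_out_def N_def by (simp add: algebra_simps)
  show "linked rh' rv' 0 0 N N"
    using linked_shift[OF linked_red[OF cr K lr r], of "?K + ?K" "?K + ?K"]
    unfolding rh'_def rv'_def inside_out_def N_def by (simp add: algebra_simps)
  show "deg bh' bv' x y = 0 \<or> deg rh' rv' x y = 0"
    unfolding bh'_def bv'_def rh'_def rv'_def inside_out_def deg_shift
    by (rule blue_red_disjoint[OF cb cr K lb(1) lr lb(3,2) r]) (rule cut_toggle_disjoint[OF disj p])
qed


section \<open>From corners to curves: closing the path\<close>

text \<open>Blue leaves \<open>(0, n)\<close> to the left, goes down column \<open>- 1\<close>,
  along row \<open>- 1\<close> and up to \<open>(n, 0)\<close>. Red leaves \<open>(n, n)\<close> to
  the right, goes down column \<open>n + 1\<close> and back along row \<open>- 2\<close> to column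
  0. Between its ends \<open>(0, 0)\<close> and \<open>(0, - 2)\<close> lies the blue point
  \<open>(0, - 1)\<close>. The shift by \<open>(1, 2)\<close> makes all coordinates
  nonnegative.\<close>

definition close_h :: "'a::discrete_idom \<Rightarrow> 'a pic \<Rightarrow> 'a pic" where
  "close_h n h = shift 1 2 (\<lambda>x y. (h x y \<or> elbow_h n (- 1) 0 x y) \<or> elbow_h (- 1) (- 1) n x y)"

definition close_v :: "'a::discrete_idom \<Rightarrow> 'a pic \<Rightarrow> 'a pic" where
  "close_v n v = shift 1 2 (\<lambda>x y. (v x y \<or> elbow_v (- 1) (- 1) n x y) \<or> elbow_v n (- 1) 0 x y)"

definition extend_h :: "'a::discrete_idom \<Rightarrow> 'a pic \<Rightarrow> 'a pic" where
  "extend_h n h = shift 1 2 (\<lambda>x y. (h x y \<or> elbow_h n n (n + 1) x y) \<or> elbow_h (- 2) 0 (n + 1) x y)"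

definition extend_v :: "'a::discrete_idom \<Rightarrow> 'a pic \<Rightarrow> 'a pic" where
  "extend_v n v = shift 1 2 (\<lambda>x y. (v x y \<or> elbow_v (n + 1) (- 1) n x y) \<or> elbow_v (n + 1) (- 2) (- 1) x y)"

theorem corners_to_curve:
  fixes n :: "'a :: discrete_idom"
  assumes n: "1 \<le> n" and bb: "boxed n bh bv" and br: "boxed n rh rv"
    and lb: "linked bh bv 0 n n 0" and lr: "linked rh rv 0 0 n n"
    and disj: "\<And>x y. deg bh bv x y = 0 \<or> deg rh rv x y = 0"
  defines "bh' \<equiv> close_h n bh" and "bv' \<equiv> close_v n bv" and "rh' \<equiv> extend_h n rh" and "rv' \<equiv> extend_v n rv"
  shows "boxed (n + 2) bh' bv'" "boxed (n + 2) rh' rv'"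
    "deg bh' bv' x y = 0 \<or> deg bh' bv' x y = 2"
    "deg bh' bv' 1 2 = 0" "deg bh' bv' 1 0 = 0" "deg bh' bv' 1 1 = 2" "linked rh' rv' 1 2 1 0"
    "deg bh' bv' x y = 0 \<or> deg rh' rv' x y = 0"
proof -
  have b_out: "deg bh bv x y = 0" if "x < 0 \<or> n < x \<or> y < 0 \<or> n < y" for x y
    using boxed_deg_0[OF bb that] .
  have b_in: "deg bh bv x y = 0 \<or> 0 \<le> x \<and> x \<le> n \<and> 0 \<le> y \<and> y \<le> n" for x y
    using b_out[of x y] by (meson not_less)
  have r_out: "deg rh rv x y = 0" if "x < 0 \<or> n < x \<or> y < 0 \<or> n < y" for x y
    using boxed_deg_0[OF br that] .
  have r_in: "deg rh rv x y = 0 \<or> 0 \<le> x \<and> x \<le> n \<and> 0 \<le> y \<and> y \<le> n" for x y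
    using r_out[of x y] by (meson not_less)
  let ?bh1 = "\<lambda>x y. bh x y \<or> elbow_h n (- 1) 0 x y" and ?bv1 = "\<lambda>x y. bv x y \<or> elbow_v (- 1) (- 1) n x y"
  let ?bh2 = "\<lambda>x y. ?bh1 x y \<or> elbow_h (- 1) (- 1) n x y" and ?bv2 = "\<lambda>x y. ?bv1 x y \<or> elbow_v n (- 1) 0 x y"
  let ?rh1 = "\<lambda>x y. rh x y \<or> elbow_h n n (n + 1) x y" and ?rv1 = "\<lambda>x y. rv x y \<or> elbow_v (n + 1) (- 1) n x y"
  let ?rh2 = "\<lambda>x y. ?rh1 x y \<or> elbow_h (- 2) 0 (n + 1) x y" and ?rv2 = "\<lambda>x y. ?rv1 x y \<or> elbow_v (n + 1) (- 2) (- 1) x y"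
  let ?eb1 = "elbow n (- 1) 0 (- 1) (- 1) n" and ?eb2 = "elbow (- 1) (- 1) n n (- 1) 0"
  let ?er1 = "elbow n n (n + 1) (n + 1) (- 1) n" and ?er2 = "elbow (- 2) 0 (n + 1) (n + 1) (- 2) (- 1)"
  have B: "deg ?bh2 ?bv2 x y = 0 \<longleftrightarrow> deg bh bv x y = 0 \<and> \<not> ?eb1 x y \<and> \<not> ?eb2 x y" for x y
    unfolding deg_union_0 using n by (subst (1 2) deg_elbow_0) auto
  have R: "deg ?rh2 ?rv2 x y = 0 \<longleftrightarrow> deg rh rv x y = 0 \<and> \<not> ?er1 x y \<and> \<not> ?er2 x y" for x y
    unfolding deg_union_0 using n by (subst (1 2) deg_elbow_0) auto
  have eb1: "deg bh bv x y = 0" if "?eb1 x y" "(x, y) \<noteq> (0, n)" for x y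
  proof -
    have "x < 0" using that n by (auto simp: elbow_def)
    then show ?thesis using b_out by blast
  qed
  have eb2: "deg bh bv x y = 0" if "?eb2 x y" "(x, y) \<noteq> (n, 0)" for x y
  proof -
    have "y < 0" using that n by (auto simp: elbow_def)
    then show ?thesis using b_out by blast
  qed
  have er1: "deg rh rv x y = 0" if "?er1 x y" "(x, y) \<noteq> (n, n)" for x y
  proof -
    have "n < x" using that n less_iff_succ_less_eq[of n x] by (auto simp: elbow_def)
    then show ?thesis using r_out by blast
  qed
  have er2: "deg rh rv x y = 0" if "?er2 x y" for x y
  proof -
    have "y < 0" using that n by (auto simp: elbow_def)
    then show ?thesis using r_out by blast
  qed
  have lb1: "linked ?bh1 ?bv1 (- 1) (- 1) n 0"
    by (rule linked_extend[OF lb]) (use n eb1 in auto)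
  have eb12: "deg ?bh1 ?bv1 x y = 0" if "?eb2 x y" "(x, y) \<noteq> (- 1, - 1)" "(x, y) \<noteq> (n, 0)" for x y
  proof -
    have "\<not> ?eb1 x y" using that n by (auto simp: elbow_def)
    then show ?thesis unfolding deg_union_0 using n eb2[OF that(1,3)] by (subst deg_elbow_0) auto
  qed
  \<comment> \<open>This elbow is attached at both of its ends and closes the path, so
    \<open>linked_extend\<close> does not apply and the degrees are added directly.\<close>
  have b2: "deg ?bh2 ?bv2 x y = deg ?bh1 ?bv1 x y +
      (if (x, y) = (- 1, - 1) \<or> (x, y) = (n, 0) then 1 else if ?eb2 x y then 2 else 0)" for x y
  proof -
    have "deg ?bh2 ?bv2 x y = deg ?bh1 ?bv1 x y + deg (elbow_h (- 1) (- 1) n) (elbow_v n (- 1) 0) x y"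
      by (rule deg_attach) (use n eb12 in auto)
    moreover have "deg (elbow_h (- 1) (- 1) n) (elbow_v n (- 1) 0) x y =
        (if (x, y) = (- 1, - 1) \<or> (x, y) = (n, 0) then 1 else if ?eb2 x y then 2 else 0)"
      using n by (subst deg_elbow) auto
    ultimately show ?thesis by simp
  qed
  have even: "deg ?bh2 ?bv2 x y = 0 \<or> deg ?bh2 ?bv2 x y = 2" for x y
  proof -
    consider "(x, y) = (- 1, - 1) \<or> (x, y) = (n, 0)" | "(x, y) \<noteq> (- 1, - 1)" "(x, y) \<noteq> (n, 0)" "?eb2 x y"
      | "(x, y) \<noteq> (- 1, - 1)" "(x, y) \<noteq> (n, 0)" "\<not> ?eb2 x y" by blast
    then show ?thesis
    proof cases
      case 1
      then show ?thesis using lb1 unfolding b2 linked_def by auto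
    next
      case 2
      then show ?thesis using eb12[OF 2(3,1,2)] unfolding b2 by simp
    next
      case 3
      then show ?thesis using lb1 unfolding b2 linked_def by auto
    qed
  qed
  have lr1: "linked ?rh1 ?rv1 (n + 1) (- 1) 0 0"
    by (rule linked_extend[OF linked_sym[OF lr]]) (use n er1 in auto)
  have lr2: "linked ?rh2 ?rv2 0 (- 2) 0 0"
  proof (rule linked_extend[OF lr1])
    fix x y
    assume e: "?er2 x y" "(x, y) \<noteq> (n + 1, - 1)"
    then have "\<not> ?er1 x y" using n by (auto simp: elbow_def)
    then show "deg ?rh1 ?rv1 x y = 0"
      unfolding deg_union_0 using n er2[OF e(1)] by (subst deg_elbow_0) auto
  qed (use n in auto)
  have disj2: "deg ?bh2 ?bv2 x y = 0 \<or> deg ?rh2 ?rv2 x y = 0" for x y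
  proof -
    have "\<not> (?eb1 x y \<and> ?er1 x y)" "\<not> (?eb1 x y \<and> ?er2 x y)" "\<not> (?eb2 x y \<and> ?er1 x y)" "\<not> (?eb2 x y \<and> ?er2 x y)"
      using n unfolding elbow_def by auto
    moreover have "deg rh rv x y = 0" if "?eb1 x y"
    proof (cases "(x, y) = (0, n)")
      case True
      then show ?thesis using disj[of 0 n] lb by (simp add: linked_def)
    next
      case False
      then have "x < 0" using that n by (auto simp: elbow_def)
      then show ?thesis using r_out by blast
    qed
    moreover have "deg rh rv x y = 0" if "?eb2 x y"
    proof (cases "(x, y) = (n, 0)")
      case True
      then show ?thesis using disj[of n 0] lb by (simp add: linked_def)
    next
      case False
      then have "y < 0" using that n by (auto simp: elbow_def)
      then show ?thesis using r_out by blast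
    qed
    moreover have "deg bh bv x y = 0" if "?er1 x y"
    proof (cases "(x, y) = (n, n)")
      case True
      then show ?thesis using disj[of n n] lr by (simp add: linked_def)
    next
      case False
      then have "n < x" using that n less_iff_succ_less_eq[of n x] by (auto simp: elbow_def)
      then show ?thesis using b_out by blast
    qed
    moreover have "deg bh bv x y = 0" if "?er2 x y"
    proof -
      have "y < 0" using that n by (auto simp: elbow_def)
      then show ?thesis using b_out by blast
    qed
    ultimately show ?thesis unfolding B R using disj[of x y] by blast
  qed
  note defs = bh'_def bv'_def rh'_def rv'_def close_h_def close_v_def extend_h_def extend_v_def
  show "boxed (n + 2) bh' bv'"
    unfolding defs
  proof (rule boxed_shift)
    fix x y
    assume "deg ?bh2 ?bv2 x y \<noteq> 0"
    then show "- 1 \<le> x \<and> x \<le> n + 2 - 1 \<and> - 2 \<le> y \<and> y \<le> n + 2 - 2"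
      using b_in[of x y] n unfolding B elbow_def by auto
  qed
  show "boxed (n + 2) rh' rv'"
    unfolding defs
  proof (rule boxed_shift)
    fix x y
    assume "deg ?rh2 ?rv2 x y \<noteq> 0"
    then show "- 1 \<le> x \<and> x \<le> n + 2 - 1 \<and> - 2 \<le> y \<and> y \<le> n + 2 - 2"
      using r_in[of x y] n unfolding R elbow_def by auto
  qed
  show "deg bh' bv' x y = 0 \<or> deg bh' bv' x y = 2"
    unfolding defs deg_shift by (rule even)
  show "deg bh' bv' x y = 0 \<or> deg rh' rv' x y = 0"
    unfolding defs deg_shift by (rule disj2)
  have "deg bh bv 0 0 = 0" using disj[of 0 0] lr by (simp add: linked_def)
  then show "deg bh' bv' 1 2 = 0"
    unfolding defs deg_shift B using n by (auto simp: elbow_def)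
  show "deg bh' bv' 1 0 = 0"
    unfolding defs deg_shift B using n b_out[of 0 "- 2"] by (auto simp: elbow_def)
  have "deg ?bh2 ?bv2 0 (- 1) \<noteq> 0"
    unfolding B using n by (auto simp: elbow_def)
  then show "deg bh' bv' 1 1 = 2"
    unfolding defs deg_shift using even[of 0 "- 1"] by simp
  show "linked rh' rv' 1 2 1 0"
    using linked_shift[OF linked_sym[OF lr2], of 1 2] unfolding defs by simp
qed


instance zz :: discrete_idom ..

section \<open>Edge sets of the model as pictures\<close>

declare One_nat_def [simp del]

lemma zn_2 [simp]: "zn 2 = 2"
  using zn_simps(3)[of 1 1] by simp

text \<open>Inverse of \<open>zn\<close> on nonnegative elements, arbitrary elsewhere;
  \<open>edge_h\<close> and \<open>edge_v\<close> exclude negative coordinates explicitly.\<close>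

definition nm :: "zz \<Rightarrow> mnum" where
  "nm a = (SOME x. zn x = a)"

lemma nm_zn [simp]: "nm (zn x) = x"
  by (simp add: nm_def)

lemma zn_nm [simp]: "0 \<le> a \<Longrightarrow> zn (nm a) = a"
  by (auto elim: zz_nonnegE)

section \<open>Codes of edges, and degrees as numbers of incident codes\<close>

definition pr :: "mnum \<Rightarrow> mnum \<Rightarrow> mnum" where
  "pr x y = (x + y) * (x + y + 1) + (1 + 1) * y"

text \<open>Codes with \<open>x + y = s\<close> lie between \<open>s * (s + 1)\<close> and
  \<open>s * (s + 1) + 2 * s\<close>, and the next diagonal starts 2 above that, at
  \<open>(s + 1) * (s + 2)\<close>.\<close>

lemma pr_less:
  fixes x y u v :: mnum
  assumes "x + y < u + v"
  shows "pr x y < pr u v"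
proof -
  define s t where "s = zn (x + y)" and "t = zn (u + v)"
  have "s < t" using assms unfolding s_def t_def by (rule zn_simps(7)[THEN iffD2])
  then have "s + 1 \<le> t" by (simp only: less_iff_succ_less_eq)
  have "0 \<le> s" "zn y \<le> s" "0 \<le> zn v" unfolding s_def by simp_all
  have "(s + 1) * (s + 1 + 1) \<le> t * (t + 1)"
    using \<open>s + 1 \<le> t\<close> \<open>0 \<le> s\<close> by (intro mult_mono) auto
  then have "s * (s + 1) + (1 + 1) * zn y < t * (t + 1) + (1 + 1) * zn v"
  proof -
    have "(s + 1) * (s + 1 + 1) = s * (s + 1) + s + s + 2" by (simp add: algebra_simps)
    moreover have "(1 + 1) * zn y = zn y + zn y" "(1 + 1) * zn v = zn v + zn v" by simp_all
    ultimately show ?thesis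
      using \<open>(s + 1) * (s + 1 + 1) \<le> t * (t + 1)\<close> \<open>zn y \<le> s\<close> \<open>0 \<le> zn v\<close> by linarith
  qed
  then have "zn (pr x y) < zn (pr u v)" by (simp add: pr_def s_def t_def)
  then show ?thesis by simp
qed

lemma pr_inject [simp]: "pr x y = pr u v \<longleftrightarrow> x = u \<and> y = v"
proof
  assume eq: "pr x y = pr u v"
  then have s: "x + y = u + v" using pr_less[of x y u v] pr_less[of u v x y] by (metis less_irrefl linorder_neqE)
  then have "zn ((1 + 1) * y) = zn ((1 + 1) * v)"
    using arg_cong[OF eq, of zn] unfolding pr_def s by simp
  then have "y = v" by simp
  then show "x = u \<and> y = v" using s num_add_cancel by blast
qed simp

lemma pr_mono: "x \<le> u \<Longrightarrow> y \<le> v \<Longrightarrow> pr x y \<le> pr u v"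
proof -
  assume "x \<le> u" "y \<le> v"
  then have "zn (pr x y) \<le> zn (pr u v)"
    unfolding pr_def zn_simps by (intro add_mono mult_mono mult_left_mono add_nonneg_nonneg) simp_all
  then show ?thesis by simp
qed

definition hc :: "mnum \<Rightarrow> mnum \<Rightarrow> mnum" where "hc x y = pr (pr x y) (pr (x + 1) y)"
definition vc :: "mnum \<Rightarrow> mnum \<Rightarrow> mnum" where "vc x y = pr (pr x y) (pr x (y + 1))"

lemma num_neq_succ [simp]: "x + 1 \<noteq> x" "x \<noteq> x + 1" for x :: mnum
  using num_add_cancel[of 1 x 0] num_succ_neq_0[of 0] by (auto simp: add.commute)

lemma code_inject [simp]:
  "hc x y = hc u v \<longleftrightarrow> x = u \<and> y = v" "vc x y = vc u v \<longleftrightarrow> x = u \<and> y = v" "hc x y \<noteq> vc u v" "vc x y \<noteq> hc u v"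
  by (auto simp: hc_def vc_def)

definition es :: "mnum \<Rightarrow> nat \<Rightarrow> bool" where
  "es N X \<longleftrightarrow> (\<forall>e. mem e X \<longrightarrow> (\<exists>x y. (x + 1 \<le> N \<and> y \<le> N \<and> e = hc x y) \<or> (x \<le> N \<and> y + 1 \<le> N \<and> e = vc x y)))"

definition edge_h :: "nat \<Rightarrow> zz \<Rightarrow> zz \<Rightarrow> bool" where
  "edge_h X a b \<longleftrightarrow> 0 \<le> a \<and> 0 \<le> b \<and> mem (hc (nm a) (nm b)) X"

definition edge_v :: "nat \<Rightarrow> zz \<Rightarrow> zz \<Rightarrow> bool" where
  "edge_v X a b \<longleftrightarrow> 0 \<le> a \<and> 0 \<le> b \<and> mem (vc (nm a) (nm b)) X"

abbreviation dg :: "nat \<Rightarrow> zz \<Rightarrow> zz \<Rightarrow> nat" where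
  "dg X \<equiv> deg (edge_h X) (edge_v X)"

lemma edge_h_zn [simp]: "edge_h X (zn x) (zn y) \<longleftrightarrow> mem (hc x y) X" "edge_v X (zn x) (zn y) \<longleftrightarrow> mem (vc x y) X"
  by (simp_all add: edge_h_def edge_v_def)

lemma es_hc: "es N X \<Longrightarrow> mem (hc x y) X \<Longrightarrow> x + 1 \<le> N \<and> y \<le> N"
  unfolding es_def by fastforce

lemma es_vc: "es N X \<Longrightarrow> mem (vc x y) X \<Longrightarrow> x \<le> N \<and> y + 1 \<le> N"
  unfolding es_def by fastforce

lemma zn_less_iff: "x + 1 \<le> y \<longleftrightarrow> zn x < zn y"
  unfolding less_iff_succ_less_eq[of "zn x"] using zn_simps(6)[of "x + 1" y] by simp

lemma es_boxed:
  assumes "es N X"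
  shows "boxed (zn N) (edge_h X) (edge_v X)"
  unfolding boxed_def
proof (intro conjI allI impI)
  fix a b
  assume *: "edge_h X a b"
  then show nn: "0 \<le> a" "0 \<le> b" by (simp_all add: edge_h_def)
  have "nm a + 1 \<le> N \<and> nm b \<le> N" using * es_hc[OF assms, of "nm a" "nm b"] by (simp add: edge_h_def)
  then have "zn (nm a) < zn N \<and> zn (nm b) \<le> zn N" by (simp only: zn_less_iff zn_simps)
  then show "a < zn N" "b \<le> zn N" using nn by auto
next
  fix a b
  assume *: "edge_v X a b"
  then show nn: "0 \<le> a" "0 \<le> b" by (simp_all add: edge_v_def)
  have "nm a \<le> N \<and> nm b + 1 \<le> N" using * es_vc[OF assms, of "nm a" "nm b"] by (simp add: edge_v_def)
  then have "zn (nm a) \<le> zn N \<and> zn (nm b) < zn N" by (simp only: zn_less_iff zn_simps)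
  then show "a \<le> zn N" "b < zn N" using nn by auto
qed

definition incident :: "nat \<Rightarrow> mnum \<Rightarrow> mnum \<Rightarrow> mnum \<Rightarrow> bool" where
  "incident X x y e \<longleftrightarrow> mem e X \<and>
     (e = hc x y \<or> e = vc x y \<or> (\<exists>u. x = u + 1 \<and> e = hc u y) \<or> (\<exists>w. y = w + 1 \<and> e = vc x w))"

lemma zz_pred: "edge_h X (zn x - 1) b \<longleftrightarrow> (\<exists>u. x = u + 1 \<and> edge_h X (zn u) b)"
  "edge_v X a (zn y - 1) \<longleftrightarrow> (\<exists>w. y = w + 1 \<and> edge_v X a (zn w))"
proof -
  have *: "x = nm (zn x - 1) + 1" if "0 \<le> zn x - 1" for x
  proof -
    have "zn x = zn (nm (zn x - 1) + 1)" using that by simp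
    then show ?thesis by (rule zn_simps(5)[THEN iffD1])
  qed
  show "edge_h X (zn x - 1) b \<longleftrightarrow> (\<exists>u. x = u + 1 \<and> edge_h X (zn u) b)"
  proof
    assume "edge_h X (zn x - 1) b"
    moreover from this have "0 \<le> zn x - 1" by (simp add: edge_h_def)
    ultimately show "\<exists>u. x = u + 1 \<and> edge_h X (zn u) b" using *[of x] by (intro exI[of _ "nm (zn x - 1)"]) simp
  qed auto
  show "edge_v X a (zn y - 1) \<longleftrightarrow> (\<exists>w. y = w + 1 \<and> edge_v X a (zn w))"
  proof
    assume "edge_v X a (zn y - 1)"
    moreover from this have "0 \<le> zn y - 1" by (simp add: edge_v_def)
    ultimately show "\<exists>w. y = w + 1 \<and> edge_v X a (zn w)" using *[of y] by (intro exI[of _ "nm (zn y - 1)"]) simp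
  qed auto
qed

text \<open>A point has four candidate edges. Distinctness is asked of those that are present, since
  at the border of the grid the code written for a missing left or lower edge is arbitrary.\<close>

lemma count_four:
  assumes "\<And>e. P e \<longleftrightarrow> A \<and> e = a \<or> B \<and> e = b \<or> C \<and> e = c \<or> D \<and> e = d"
    and "A \<Longrightarrow> B \<Longrightarrow> a \<noteq> b" "A \<Longrightarrow> C \<Longrightarrow> a \<noteq> c" "A \<Longrightarrow> D \<Longrightarrow> a \<noteq> d" "B \<Longrightarrow> C \<Longrightarrow> b \<noteq> c" "B \<Longrightarrow> D \<Longrightarrow> b \<noteq> d" "C \<Longrightarrow> D \<Longrightarrow> c \<noteq> d"
  defines "n \<equiv> of_bool A + of_bool B + of_bool C + of_bool D :: nat"
  shows "(\<forall>e. \<not> P e) \<longleftrightarrow> n = 0"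
    and "(\<exists>e. P e \<and> (\<forall>f. P f \<longrightarrow> f = e)) \<longleftrightarrow> n = 1"
    and "(\<exists>e f. f \<noteq> e \<and> P f \<and> P e \<and> (\<forall>g. P g \<longrightarrow> g = f \<or> g = e)) \<longleftrightarrow> n = 2"
  using assms(2-7) unfolding n_def assms(1)
  by (cases A; cases B; cases C; cases D; simp; metis)+

lemma incident_deg:
  "(\<forall>e. \<not> incident X x y e) \<longleftrightarrow> dg X (zn x) (zn y) = 0"
  "(\<exists>e. incident X x y e \<and> (\<forall>f. incident X x y f \<longrightarrow> f = e)) \<longleftrightarrow> dg X (zn x) (zn y) = 1"
  "(\<exists>e f. f \<noteq> e \<and> incident X x y f \<and> incident X x y e \<and> (\<forall>g. incident X x y g \<longrightarrow> g = f \<or> g = e)) \<longleftrightarrow> dg X (zn x) (zn y) = 2"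
proof -
  let ?l = "hc (nm (zn x - 1)) y" and ?b = "vc x (nm (zn y - 1))"
  have inc: "incident X x y e \<longleftrightarrow> edge_h X (zn x - 1) (zn y) \<and> e = ?l \<or> edge_h X (zn x) (zn y) \<and> e = hc x y \<or>
      edge_v X (zn x) (zn y - 1) \<and> e = ?b \<or> edge_v X (zn x) (zn y) \<and> e = vc x y" for e
    unfolding zz_pred edge_h_zn incident_def by auto
  have ne: "edge_h X (zn x - 1) (zn y) \<Longrightarrow> nm (zn x - 1) \<noteq> x" "edge_v X (zn x) (zn y - 1) \<Longrightarrow> nm (zn y - 1) \<noteq> y"
    unfolding zz_pred by auto
  note 1 = count_four[of "incident X x y" "edge_h X (zn x - 1) (zn y)" ?l "edge_h X (zn x) (zn y)" "hc x y"
      "edge_v X (zn x) (zn y - 1)" ?b "edge_v X (zn x) (zn y)" "vc x y", OF inc]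
  show "(\<forall>e. \<not> incident X x y e) \<longleftrightarrow> dg X (zn x) (zn y) = 0"
    unfolding deg_def by (rule 1(1)) (simp_all add: ne del: edge_h_zn)
  show "(\<exists>e. incident X x y e \<and> (\<forall>f. incident X x y f \<longrightarrow> f = e)) \<longleftrightarrow> dg X (zn x) (zn y) = 1"
    unfolding deg_def by (rule 1(2)) (simp_all add: ne del: edge_h_zn)
  show "(\<exists>e f. f \<noteq> e \<and> incident X x y f \<and> incident X x y e \<and> (\<forall>g. incident X x y g \<longrightarrow> g = f \<or> g = e)) \<longleftrightarrow> dg X (zn x) (zn y) = 2"
    unfolding deg_def by (rule 1(3)) (simp_all add: ne del: edge_h_zn)
qed


section \<open>Meaning of the formulas\<close>

lemma ev_up [simp]:
  "tval M \<mu> (case_nat a \<nu>) (up 1 t) = tval M \<mu> \<nu> t"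
  "tval M \<mu> (case_nat a (case_nat b \<nu>)) (up 2 t) = tval M \<mu> \<nu> t"
  "tval M \<mu> (case_nat a (case_nat b (case_nat c \<nu>))) (up 3 t) = tval M \<mu> \<nu> t"
  "tval M \<mu> (case_nat a (case_nat b (case_nat c (case_nat d \<nu>)))) (up 4 t) = tval M \<mu> \<nu> t"
  by (simp_all add: tval_up eval_nat_numeral One_nat_def)

lemma case_nat_1 [simp]: "case_nat a f 1 = f 0"
  by (simp add: One_nat_def)

lemma ev_pair [simp]: "ev \<mu> \<nu> (pair s t) = pr (ev \<mu> \<nu> s) (ev \<mu> \<nu> t)"
  by (simp add: pair_def pr_def)

lemma holds_edge_code [simp]: "holds \<mu> \<nu> (edge_code e x y u v) \<longleftrightarrow>
    (ev \<mu> \<nu> u = ev \<mu> \<nu> x + 1 \<and> ev \<mu> \<nu> v = ev \<mu> \<nu> y \<and> ev \<mu> \<nu> e = hc (ev \<mu> \<nu> x) (ev \<mu> \<nu> y)) \<or>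
    (ev \<mu> \<nu> u = ev \<mu> \<nu> x \<and> ev \<mu> \<nu> v = ev \<mu> \<nu> y + 1 \<and> ev \<mu> \<nu> e = vc (ev \<mu> \<nu> x) (ev \<mu> \<nu> y))"
  by (auto simp: edge_code_def hc_def vc_def)

lemma num_le_succ: "x + 1 \<le> N \<Longrightarrow> x \<le> (N :: mnum)"
  using num_le_add[of x 1] by (meson order_trans)

lemma mem_le_len: "mem e X \<Longrightarrow> e \<le> len X"
  using mem_less_len less_imp_le by blast

lemma holds_edge_set: "holds \<mu> \<nu> (edge_set n E) \<longleftrightarrow> es (ev \<mu> \<nu> n) (\<mu> E)"
proof -
  have "holds \<mu> \<nu> (edge_set n E) \<longleftrightarrow> (\<forall>e. mem e (\<mu> E) \<longrightarrow> (\<exists>x\<le>ev \<mu> \<nu> n. \<exists>y\<le>ev \<mu> \<nu> n. \<exists>u\<le>ev \<mu> \<nu> n. \<exists>v\<le>ev \<mu> \<nu> n.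
      u = x + 1 \<and> v = y \<and> e = hc x y \<or> u = x \<and> v = y + 1 \<and> e = vc x y))"
    using mem_le_len by (auto simp: edge_set_def)
  also have "\<dots> \<longleftrightarrow> es (ev \<mu> \<nu> n) (\<mu> E)"
  proof
    assume R: "es (ev \<mu> \<nu> n) (\<mu> E)"
    show "\<forall>e. mem e (\<mu> E) \<longrightarrow> (\<exists>x\<le>ev \<mu> \<nu> n. \<exists>y\<le>ev \<mu> \<nu> n. \<exists>u\<le>ev \<mu> \<nu> n. \<exists>v\<le>ev \<mu> \<nu> n.
      u = x + 1 \<and> v = y \<and> e = hc x y \<or> u = x \<and> v = y + 1 \<and> e = vc x y)"
    proof (intro allI impI)
      fix e
      assume "mem e (\<mu> E)"
      then obtain x y where "x + 1 \<le> ev \<mu> \<nu> n \<and> y \<le> ev \<mu> \<nu> n \<and> e = hc x y \<or> x \<le> ev \<mu> \<nu> n \<and> y + 1 \<le> ev \<mu> \<nu> n \<and> e = vc x y"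
        using R unfolding es_def by blast
      then show "\<exists>x\<le>ev \<mu> \<nu> n. \<exists>y\<le>ev \<mu> \<nu> n. \<exists>u\<le>ev \<mu> \<nu> n. \<exists>v\<le>ev \<mu> \<nu> n.
          u = x + 1 \<and> v = y \<and> e = hc x y \<or> u = x \<and> v = y + 1 \<and> e = vc x y"
        using num_le_succ[of x] num_le_succ[of y] by blast
    qed
  qed (auto simp: es_def)
  finally show ?thesis .
qed

lemma holds_inc:
  assumes "es (ev \<mu> \<nu> n) (\<mu> E)"
  shows "holds \<mu> \<nu> (inc n E e x y) \<longleftrightarrow> incident (\<mu> E) (ev \<mu> \<nu> x) (ev \<mu> \<nu> y) (ev \<mu> \<nu> e)"
proof -
  let ?N = "ev \<mu> \<nu> n" and ?x = "ev \<mu> \<nu> x" and ?y = "ev \<mu> \<nu> y" and ?e = "ev \<mu> \<nu> e"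
  have "holds \<mu> \<nu> (inc n E e x y) \<longleftrightarrow> mem ?e (\<mu> E) \<and> (\<exists>u\<le>?N. \<exists>v\<le>?N.
      ((u = ?x + 1 \<and> v = ?y \<and> ?e = hc ?x ?y) \<or> (u = ?x \<and> v = ?y + 1 \<and> ?e = vc ?x ?y)) \<or>
      ((?x = u + 1 \<and> ?y = v \<and> ?e = hc u v) \<or> (?x = u \<and> ?y = v + 1 \<and> ?e = vc u v)))"
    by (simp add: inc_def)
  also have "\<dots> \<longleftrightarrow> incident (\<mu> E) ?x ?y ?e"
  proof
    assume "incident (\<mu> E) ?x ?y ?e"
    then have m: "mem ?e (\<mu> E)"
      and c: "?e = hc ?x ?y \<or> ?e = vc ?x ?y \<or> (\<exists>u. ?x = u + 1 \<and> ?e = hc u ?y) \<or> (\<exists>w. ?y = w + 1 \<and> ?e = vc ?x w)"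
      unfolding incident_def by blast+
    have h: "u + 1 \<le> ?N \<and> u \<le> ?N \<and> w \<le> ?N" if "?e = hc u w" for u w
      using es_hc[OF assms] m num_le_succ unfolding that by blast
    have v: "u \<le> ?N \<and> w + 1 \<le> ?N \<and> w \<le> ?N" if "?e = vc u w" for u w
      using es_vc[OF assms] m num_le_succ unfolding that by blast
    from c show "mem ?e (\<mu> E) \<and> (\<exists>u\<le>?N. \<exists>v\<le>?N.
      ((u = ?x + 1 \<and> v = ?y \<and> ?e = hc ?x ?y) \<or> (u = ?x \<and> v = ?y + 1 \<and> ?e = vc ?x ?y)) \<or>
      ((?x = u + 1 \<and> ?y = v \<and> ?e = hc u v) \<or> (?x = u \<and> ?y = v + 1 \<and> ?e = vc u v)))"
    proof (elim disjE exE conjE)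
      assume "?e = hc ?x ?y"
      with m h[OF this] show ?thesis by blast
    next
      assume "?e = vc ?x ?y"
      with m v[OF this] show ?thesis by blast
    next
      fix u
      assume "?x = u + 1" "?e = hc u ?y"
      with m h[OF this(2)] show ?thesis by blast
    next
      fix w
      assume "?y = w + 1" "?e = vc ?x w"
      with m v[OF this(2)] show ?thesis by blast
    qed
  qed (auto simp: incident_def)
  finally show ?thesis .
qed

lemma
  assumes "es (ev \<mu> \<nu> n) (\<mu> E)"
  shows holds_deg0: "holds \<mu> \<nu> (deg0 n E x y) \<longleftrightarrow> dg (\<mu> E) (zn (ev \<mu> \<nu> x)) (zn (ev \<mu> \<nu> y)) = 0"
    and holds_deg1: "holds \<mu> \<nu> (deg1 n E x y) \<longleftrightarrow> dg (\<mu> E) (zn (ev \<mu> \<nu> x)) (zn (ev \<mu> \<nu> y)) = 1"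
    and holds_deg2: "holds \<mu> \<nu> (deg2 n E x y) \<longleftrightarrow> dg (\<mu> E) (zn (ev \<mu> \<nu> x)) (zn (ev \<mu> \<nu> y)) = 2"
    and holds_deg_ge1: "holds \<mu> \<nu> (deg_ge1 n E x y) \<longleftrightarrow> dg (\<mu> E) (zn (ev \<mu> \<nu> x)) (zn (ev \<mu> \<nu> y)) \<noteq> 0"
proof -
  let ?I = "incident (\<mu> E) (ev \<mu> \<nu> x) (ev \<mu> \<nu> y)"
  have b: "?I e \<Longrightarrow> e \<le> len (\<mu> E)" for e
    unfolding incident_def using mem_le_len by blast
  have "holds \<mu> \<nu> (deg0 n E x y) \<longleftrightarrow> (\<forall>e. \<not> ?I e)"
    using b by (auto simp: deg0_def holds_inc assms)
  then show "holds \<mu> \<nu> (deg0 n E x y) \<longleftrightarrow> dg (\<mu> E) (zn (ev \<mu> \<nu> x)) (zn (ev \<mu> \<nu> y)) = 0"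
    by (simp only: incident_deg)
  have "holds \<mu> \<nu> (deg_ge1 n E x y) \<longleftrightarrow> \<not> (\<forall>e. \<not> ?I e)"
    using b by (auto simp: deg_ge1_def holds_inc assms)
  then show "holds \<mu> \<nu> (deg_ge1 n E x y) \<longleftrightarrow> dg (\<mu> E) (zn (ev \<mu> \<nu> x)) (zn (ev \<mu> \<nu> y)) \<noteq> 0"
    by (simp only: incident_deg)
  have "holds \<mu> \<nu> (deg1 n E x y) \<longleftrightarrow> (\<exists>e. ?I e \<and> (\<forall>f. ?I f \<longrightarrow> f = e))"
    using b by (auto simp: deg1_def holds_inc assms)
  then show "holds \<mu> \<nu> (deg1 n E x y) \<longleftrightarrow> dg (\<mu> E) (zn (ev \<mu> \<nu> x)) (zn (ev \<mu> \<nu> y)) = 1"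
    by (simp only: incident_deg)
  have "holds \<mu> \<nu> (deg2 n E x y) \<longleftrightarrow> (\<exists>e f. f \<noteq> e \<and> ?I f \<and> ?I e \<and> (\<forall>g. ?I g \<longrightarrow> g = f \<or> g = e))"
    using b by (simp add: deg2_def holds_inc assms) metis
  then show "holds \<mu> \<nu> (deg2 n E x y) \<longleftrightarrow> dg (\<mu> E) (zn (ev \<mu> \<nu> x)) (zn (ev \<mu> \<nu> y)) = 2"
    by (simp only: incident_deg)
qed

text \<open>Formulas quantify over grid points, pictures over the whole ring. Outside of the grid
  the degree is 0, and \<open>P 0\<close> covers these points.\<close>

lemma all_points:
  assumes "es N X" "P 0"
  shows "(\<forall>x\<le>N. \<forall>y\<le>N. Q (zn x) (zn y) \<longrightarrow> P (dg X (zn x) (zn y))) \<longleftrightarrow> (\<forall>a b. Q a b \<longrightarrow> P (dg X a b))"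
proof
  assume *: "\<forall>x\<le>N. \<forall>y\<le>N. Q (zn x) (zn y) \<longrightarrow> P (dg X (zn x) (zn y))"
  show "\<forall>a b. Q a b \<longrightarrow> P (dg X a b)"
  proof (intro allI impI)
    fix a b
    assume "Q a b"
    show "P (dg X a b)"
    proof (cases "dg X a b = 0")
      case False
      then have nn: "0 \<le> a" "a \<le> zn N" "0 \<le> b" "b \<le> zn N"
        using boxed_deg_0[OF es_boxed[OF assms(1)], of a b] by (meson not_less)+
      then obtain x y where "a = zn x" "b = zn y" by (meson zz_nonnegE)
      then show ?thesis using * nn \<open>Q a b\<close> by simp
    qed (simp add: assms)
  qed
qed blast

lemma holds_connects: "holds \<mu> \<nu> (connects n E x1 y1 x2 y2) \<longleftrightarrow> es (ev \<mu> \<nu> n) (\<mu> E) \<and>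
    linked (edge_h (\<mu> E)) (edge_v (\<mu> E)) (zn (ev \<mu> \<nu> x1)) (zn (ev \<mu> \<nu> y1)) (zn (ev \<mu> \<nu> x2)) (zn (ev \<mu> \<nu> y2))"
proof (cases "es (ev \<mu> \<nu> n) (\<mu> E)")
  case True
  show ?thesis
    using all_points[OF True, of "\<lambda>k. k = 0 \<or> k = 2" "\<lambda>a b. (a, b) \<noteq> (zn (ev \<mu> \<nu> x1), zn (ev \<mu> \<nu> y1)) \<and> (a, b) \<noteq> (zn (ev \<mu> \<nu> x2), zn (ev \<mu> \<nu> y2))"]
    by (auto simp: connects_def holds_edge_set holds_deg0 holds_deg1 holds_deg2 True linked_def)
qed (simp add: connects_def holds_edge_set)

lemma holds_curve: "holds \<mu> \<nu> (curve n E) \<longleftrightarrow> es (ev \<mu> \<nu> n) (\<mu> E) \<and> (\<exists>e. mem e (\<mu> E)) \<and>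
    (\<forall>a b. dg (\<mu> E) a b = 0 \<or> dg (\<mu> E) a b = 2)"
proof (cases "es (ev \<mu> \<nu> n) (\<mu> E)")
  case True
  show ?thesis
    using all_points[OF True, of "\<lambda>k. k = 0 \<or> k = 2" "\<lambda>a b. True"] mem_le_len
    by (auto simp: curve_def holds_edge_set holds_deg0 holds_deg2 True)
qed (simp add: curve_def holds_edge_set)

lemma holds_intersect:
  assumes "es (ev \<mu> \<nu> n) (\<mu> E)" "es (ev \<mu> \<nu> n) (\<mu> F)"
  shows "holds \<mu> \<nu> (intersect n E F) \<longleftrightarrow> (\<exists>a b. dg (\<mu> E) a b \<noteq> 0 \<and> dg (\<mu> F) a b \<noteq> 0)"
  using all_points[OF assms(1), of "\<lambda>k. k = 0" "\<lambda>a b. dg (\<mu> F) a b \<noteq> 0"]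
  by (auto simp: intersect_def holds_deg_ge1 assms)

lemma holds_different_sides:
  assumes "es (ev \<mu> \<nu> n) (\<mu> E)"
  shows "holds \<mu> \<nu> (different_sides n E x1 y1 x2 y2) \<longleftrightarrow>
    (let x1 = zn (ev \<mu> \<nu> x1); y1 = zn (ev \<mu> \<nu> y1); x2 = zn (ev \<mu> \<nu> x2); y2 = zn (ev \<mu> \<nu> y2) in
      x1 = x2 \<and> (y1 = y2 + 2 \<or> y2 = y1 + 2) \<and> dg (\<mu> E) x1 y1 = 0 \<and> dg (\<mu> E) x2 y2 = 0 \<and>
      (\<exists>z\<le>ev \<mu> \<nu> n. zn z + zn z = y1 + y2 \<and> dg (\<mu> E) x1 (zn z) = 2))"
proof -
  have zz: "zn a + zn b = zn c + zn d \<longleftrightarrow> a + b = c + d" "zn a = zn b + 2 \<longleftrightarrow> a = b + (1 + 1)" for a b c d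
    using zn_simps(5)[of "a + b" "c + d"] zn_simps(5)[of "a" "b + (1 + 1)"] by (simp_all del: zn_simps(5))
  show ?thesis
    unfolding Let_def zz zn_simps
    by (simp add: different_sides_def holds_deg0 holds_deg2 assms)
qed


section \<open>Definable pictures\<close>

text \<open>
  Definability of terms, formulas, ring elements and pictures from the sets \<open>\<mu>\<close>. Number parameters are
  supplied as lengths of sets, so the variables \<open>\<nu>\<close> are all proper arguments.
\<close>

definition dt :: "(nat \<Rightarrow> nat) \<Rightarrow> ((nat \<Rightarrow> mnum) \<Rightarrow> mnum) \<Rightarrow> bool" where
  "dt \<mu> f \<longleftrightarrow> (\<exists>t. \<forall>\<nu>. f \<nu> = ev \<mu> \<nu> t)"

definition df :: "(nat \<Rightarrow> nat) \<Rightarrow> ((nat \<Rightarrow> mnum) \<Rightarrow> bool) \<Rightarrow> bool" where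
  "df \<mu> P \<longleftrightarrow> (\<exists>\<phi>. Sigma0B \<phi> \<and> (\<forall>\<nu>. P \<nu> \<longleftrightarrow> holds \<mu> \<nu> \<phi>))"

definition dz :: "(nat \<Rightarrow> nat) \<Rightarrow> ((nat \<Rightarrow> mnum) \<Rightarrow> zz) \<Rightarrow> bool" where
  "dz \<mu> f \<longleftrightarrow> (\<exists>p q. dt \<mu> p \<and> dt \<mu> q \<and> (\<forall>\<nu>. f \<nu> = zn (p \<nu>) - zn (q \<nu>)))"

text \<open>Asking for all definable coordinates, instead of two variables, lets pictures be
  composed with changes of coordinates without substituting into formulas.\<close>

definition dp :: "(nat \<Rightarrow> nat) \<Rightarrow> (zz \<Rightarrow> zz \<Rightarrow> bool) \<Rightarrow> bool" where
  "dp \<mu> h \<longleftrightarrow> (\<forall>f g. dz \<mu> f \<longrightarrow> dz \<mu> g \<longrightarrow> df \<mu> (\<lambda>\<nu>. h (f \<nu>) (g \<nu>)))"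

lemma dt_intros:
  "dt \<mu> (\<lambda>\<nu>. \<nu> i)" "dt \<mu> (\<lambda>\<nu>. 0)" "dt \<mu> (\<lambda>\<nu>. 1)" "dt \<mu> (\<lambda>\<nu>. len (\<mu> j))"
  "dt \<mu> f \<Longrightarrow> dt \<mu> g \<Longrightarrow> dt \<mu> (\<lambda>\<nu>. f \<nu> + g \<nu>)"
  "dt \<mu> f \<Longrightarrow> dt \<mu> g \<Longrightarrow> dt \<mu> (\<lambda>\<nu>. f \<nu> * g \<nu>)"
  "dt \<mu> f \<Longrightarrow> dt \<mu> (\<lambda>\<nu>. f (\<lambda>i. \<nu> (Suc i)))"
proof -
  show "dt \<mu> (\<lambda>\<nu>. \<nu> i)" unfolding dt_def by (rule exI[of _ "NVar i"]) simp
  show "dt \<mu> (\<lambda>\<nu>. 0)" unfolding dt_def by (rule exI[of _ Zero]) simp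
  show "dt \<mu> (\<lambda>\<nu>. 1)" unfolding dt_def by (rule exI[of _ One]) simp
  show "dt \<mu> (\<lambda>\<nu>. len (\<mu> j))" unfolding dt_def by (rule exI[of _ "Len j"]) simp
  show "dt \<mu> f \<Longrightarrow> dt \<mu> g \<Longrightarrow> dt \<mu> (\<lambda>\<nu>. f \<nu> + g \<nu>)" unfolding dt_def by (metis num_model_simps(3) tval.simps(4))
  show "dt \<mu> f \<Longrightarrow> dt \<mu> g \<Longrightarrow> dt \<mu> (\<lambda>\<nu>. f \<nu> * g \<nu>)" unfolding dt_def by (metis num_model_simps(4) tval.simps(5))
  show "dt \<mu> f \<Longrightarrow> dt \<mu> (\<lambda>\<nu>. f (\<lambda>i. \<nu> (Suc i)))"
    unfolding dt_def by (auto simp: tval_up One_nat_def intro: exI[of _ "up 1 _"])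
qed

lemma df_intros:
  "dt \<mu> f \<Longrightarrow> dt \<mu> g \<Longrightarrow> df \<mu> (\<lambda>\<nu>. f \<nu> = g \<nu>)"
  "dt \<mu> f \<Longrightarrow> dt \<mu> g \<Longrightarrow> df \<mu> (\<lambda>\<nu>. f \<nu> \<le> g \<nu>)"
  "dt \<mu> f \<Longrightarrow> df \<mu> (\<lambda>\<nu>. mem (f \<nu>) (\<mu> j))"
  "df \<mu> P \<Longrightarrow> df \<mu> Q \<Longrightarrow> df \<mu> (\<lambda>\<nu>. P \<nu> \<and> Q \<nu>)"
  "df \<mu> P \<Longrightarrow> df \<mu> Q \<Longrightarrow> df \<mu> (\<lambda>\<nu>. P \<nu> \<or> Q \<nu>)"
  "df \<mu> P \<Longrightarrow> df \<mu> (\<lambda>\<nu>. \<not> P \<nu>)"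
proof -
  have atom: "df \<mu> P" if "Sigma0B \<phi>" "\<And>\<nu>. P \<nu> \<longleftrightarrow> holds \<mu> \<nu> \<phi>" for P \<phi>
    using that unfolding df_def by blast
  show "df \<mu> (\<lambda>\<nu>. f \<nu> = g \<nu>)" "df \<mu> (\<lambda>\<nu>. f \<nu> \<le> g \<nu>)" if fg: "dt \<mu> f" "dt \<mu> g"
  proof -
    obtain s t where "\<And>\<nu>. f \<nu> = ev \<mu> \<nu> s" "\<And>\<nu>. g \<nu> = ev \<mu> \<nu> t" using fg unfolding dt_def by blast
    then show "df \<mu> (\<lambda>\<nu>. f \<nu> = g \<nu>)" "df \<mu> (\<lambda>\<nu>. f \<nu> \<le> g \<nu>)"
      using atom[OF Sigma0B.intros(2)[of s t]] atom[OF Sigma0B.intros(3)[of s t]] by simp_all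
  qed
  show "df \<mu> (\<lambda>\<nu>. mem (f \<nu>) (\<mu> j))" if f: "dt \<mu> f"
  proof -
    obtain s where "\<And>\<nu>. f \<nu> = ev \<mu> \<nu> s" using f unfolding dt_def by blast
    then show ?thesis using atom[OF Sigma0B.intros(5)[of s j]] by simp
  qed
  show "df \<mu> P \<Longrightarrow> df \<mu> Q \<Longrightarrow> df \<mu> (\<lambda>\<nu>. P \<nu> \<and> Q \<nu>)"
    unfolding df_def by (metis Sigma0B.intros(7) sat.simps(7))
  show "df \<mu> P \<Longrightarrow> df \<mu> Q \<Longrightarrow> df \<mu> (\<lambda>\<nu>. P \<nu> \<or> Q \<nu>)"
    unfolding df_def by (metis Sigma0B.intros(8) sat.simps(8))
  show "df \<mu> P \<Longrightarrow> df \<mu> (\<lambda>\<nu>. \<not> P \<nu>)"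
    unfolding df_def by (metis Neg_def Sigma0B.intros(1,6) sat_abbrevs(1))
qed

lemma df_bex:
  assumes "dt \<mu> f" "df \<mu> (\<lambda>\<nu>. Q (\<nu> 0) (\<lambda>i. \<nu> (Suc i)))"
  shows "df \<mu> (\<lambda>\<nu>. \<exists>a\<le>f \<nu>. Q a \<nu>)"
proof -
  obtain t where t: "\<And>\<nu>. f \<nu> = ev \<mu> \<nu> t" using assms(1) unfolding dt_def by blast
  obtain \<phi> where \<phi>: "Sigma0B \<phi>" "\<And>\<nu>. Q (\<nu> 0) (\<lambda>i. \<nu> (Suc i)) \<longleftrightarrow> holds \<mu> \<nu> \<phi>"
    using assms(2) unfolding df_def by blast
  have "(\<exists>a\<le>f \<nu>. Q a \<nu>) \<longleftrightarrow> holds \<mu> \<nu> (BEx t \<phi>)" for \<nu>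
    using \<phi>(2)[of "case_nat _ \<nu>"] by (simp add: t)
  then show ?thesis unfolding df_def using \<phi>(1) Sigma0B.intros(10) by blast
qed

lemma dz_zn: "dt \<mu> f \<Longrightarrow> dz \<mu> (\<lambda>\<nu>. zn (f \<nu>))"
  unfolding dz_def using dt_intros(2)[of \<mu>] by (intro exI[of _ f] exI[of _ "\<lambda>_. 0"]) simp

lemma dz_intros:
  "dz \<mu> (\<lambda>\<nu>. 0)" "dz \<mu> (\<lambda>\<nu>. 1)" "dz \<mu> (\<lambda>\<nu>. 2)" "dz \<mu> (\<lambda>\<nu>. 3)"
  "dz \<mu> f \<Longrightarrow> dz \<mu> g \<Longrightarrow> dz \<mu> (\<lambda>\<nu>. f \<nu> + g \<nu>)"
  "dz \<mu> f \<Longrightarrow> dz \<mu> g \<Longrightarrow> dz \<mu> (\<lambda>\<nu>. f \<nu> - g \<nu>)"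
  "dz \<mu> f \<Longrightarrow> dz \<mu> (\<lambda>\<nu>. - f \<nu>)"
proof -
  show 0: "dz \<mu> (\<lambda>\<nu>. 0)" and 1: "dz \<mu> (\<lambda>\<nu>. 1)"
    using dz_zn[OF dt_intros(2)] dz_zn[OF dt_intros(3)] by simp_all
  show add: "dz \<mu> f \<Longrightarrow> dz \<mu> g \<Longrightarrow> dz \<mu> (\<lambda>\<nu>. f \<nu> + g \<nu>)" for f g
  proof -
    assume "dz \<mu> f" "dz \<mu> g"
    then obtain p q p' q' where "dt \<mu> p" "dt \<mu> q" "dt \<mu> p'" "dt \<mu> q'" "\<And>\<nu>. f \<nu> = zn (p \<nu>) - zn (q \<nu>)" "\<And>\<nu>. g \<nu> = zn (p' \<nu>) - zn (q' \<nu>)"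
      unfolding dz_def by blast
    then show ?thesis
      unfolding dz_def by (intro exI[of _ "\<lambda>\<nu>. p \<nu> + p' \<nu>"] exI[of _ "\<lambda>\<nu>. q \<nu> + q' \<nu>"]) (simp add: dt_intros)
  qed
  show neg: "dz \<mu> f \<Longrightarrow> dz \<mu> (\<lambda>\<nu>. - f \<nu>)" for f
  proof -
    assume "dz \<mu> f"
    then obtain p q where "dt \<mu> p" "dt \<mu> q" "\<And>\<nu>. f \<nu> = zn (p \<nu>) - zn (q \<nu>)"
      unfolding dz_def by blast
    then show ?thesis
      unfolding dz_def by (intro exI[of _ q] exI[of _ p]) simp
  qed
  show "dz \<mu> f \<Longrightarrow> dz \<mu> g \<Longrightarrow> dz \<mu> (\<lambda>\<nu>. f \<nu> - g \<nu>)"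
    using add[OF _ neg] by simp
  show 2: "dz \<mu> (\<lambda>\<nu>. 2)" using add[OF 1 1] by simp
  show "dz \<mu> (\<lambda>\<nu>. 3)" using add[OF 1 2] by simp
qed

text \<open>Moving the subtracted terms to the other side turns a comparison in the ring into one
  between terms of the language.\<close>

lemma dz_diff:
  assumes "dz \<mu> f" "dz \<mu> g"
  obtains p q where "dt \<mu> p" "dt \<mu> q" "\<And>\<nu>. f \<nu> \<le> g \<nu> \<longleftrightarrow> p \<nu> \<le> q \<nu>" "\<And>\<nu>. f \<nu> = g \<nu> \<longleftrightarrow> p \<nu> = q \<nu>"
proof -
  obtain p q p' q' where *: "dt \<mu> p" "dt \<mu> q" "dt \<mu> p'" "dt \<mu> q'" "\<And>\<nu>. f \<nu> = zn (p \<nu>) - zn (q \<nu>)" "\<And>\<nu>. g \<nu> = zn (p' \<nu>) - zn (q' \<nu>)"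
    using assms unfolding dz_def by blast
  show thesis
  proof (rule that)
    show "dt \<mu> (\<lambda>\<nu>. p \<nu> + q' \<nu>)" "dt \<mu> (\<lambda>\<nu>. p' \<nu> + q \<nu>)" using * by (simp_all add: dt_intros)
    fix \<nu>
    show "f \<nu> \<le> g \<nu> \<longleftrightarrow> p \<nu> + q' \<nu> \<le> p' \<nu> + q \<nu>"
      using zn_simps(6)[of "p \<nu> + q' \<nu>" "p' \<nu> + q \<nu>"] unfolding *(5,6) by (simp add: algebra_simps del: zn_simps(6))
    show "f \<nu> = g \<nu> \<longleftrightarrow> p \<nu> + q' \<nu> = p' \<nu> + q \<nu>"
      using zn_simps(5)[of "p \<nu> + q' \<nu>" "p' \<nu> + q \<nu>"] unfolding *(5,6) by (simp add: algebra_simps del: zn_simps(5))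
  qed
qed

lemma df_zz:
  "dz \<mu> f \<Longrightarrow> dz \<mu> g \<Longrightarrow> df \<mu> (\<lambda>\<nu>. f \<nu> \<le> g \<nu>)"
  "dz \<mu> f \<Longrightarrow> dz \<mu> g \<Longrightarrow> df \<mu> (\<lambda>\<nu>. f \<nu> = g \<nu>)"
  "dz \<mu> f \<Longrightarrow> dz \<mu> g \<Longrightarrow> df \<mu> (\<lambda>\<nu>. f \<nu> < g \<nu>)"
proof -
  show le: "dz \<mu> f \<Longrightarrow> dz \<mu> g \<Longrightarrow> df \<mu> (\<lambda>\<nu>. f \<nu> \<le> g \<nu>)" for f g
    by (erule (1) dz_diff) (simp add: df_intros)
  show "dz \<mu> f \<Longrightarrow> dz \<mu> g \<Longrightarrow> df \<mu> (\<lambda>\<nu>. f \<nu> = g \<nu>)"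
    by (erule (1) dz_diff) (simp add: df_intros)
  show "dz \<mu> f \<Longrightarrow> dz \<mu> g \<Longrightarrow> df \<mu> (\<lambda>\<nu>. f \<nu> < g \<nu>)"
    using df_intros(6)[OF le] by (simp add: not_le)
qed

lemma dpI: "(\<And>f g. dz \<mu> f \<Longrightarrow> dz \<mu> g \<Longrightarrow> df \<mu> (\<lambda>\<nu>. h (f \<nu>) (g \<nu>))) \<Longrightarrow> dp \<mu> h"
  unfolding dp_def by blast

lemma dpD: "dp \<mu> h \<Longrightarrow> dz \<mu> f \<Longrightarrow> dz \<mu> g \<Longrightarrow> df \<mu> (\<lambda>\<nu>. h (f \<nu>) (g \<nu>))"
  unfolding dp_def by blast

lemmas d_intros = df_intros(4-6) df_zz dz_intros dpD

text \<open>The language has no subtraction: a nonnegative difference of \<open>p\<close> and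
  \<open>q\<close> is the number \<open>a\<close> with \<open>a + q = p\<close>. It is at most
  \<open>p\<close>, so a bounded quantifier finds it.\<close>

lemma dp_code:
  assumes code: "\<And>p q. dt \<mu> p \<Longrightarrow> dt \<mu> q \<Longrightarrow> dt \<mu> (\<lambda>\<nu>. C (p \<nu>) (q \<nu>))"
  shows "dp \<mu> (\<lambda>a b. 0 \<le> a \<and> 0 \<le> b \<and> mem (C (nm a) (nm b)) (\<mu> j))"
proof (rule dpI)
  fix f g
  assume "dz \<mu> f" "dz \<mu> g"
  then obtain p q p' q' where *: "dt \<mu> p" "dt \<mu> q" "dt \<mu> p'" "dt \<mu> q'" "\<And>\<nu>. f \<nu> = zn (p \<nu>) - zn (q \<nu>)" "\<And>\<nu>. g \<nu> = zn (p' \<nu>) - zn (q' \<nu>)"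
    unfolding dz_def by blast
  have nn: "0 \<le> zn x - zn y \<longleftrightarrow> (\<exists>a\<le>x. a + y = x)" "a + y = x \<Longrightarrow> nm (zn x - zn y) = a" for x y a
  proof -
    show "nm (zn x - zn y) = a" if "a + y = x" using that by auto
    show "0 \<le> zn x - zn y \<longleftrightarrow> (\<exists>a\<le>x. a + y = x)"
      by (simp add: num_le_iff_add) (metis add.commute)
  qed
  have "(0 \<le> f \<nu> \<and> 0 \<le> g \<nu> \<and> mem (C (nm (f \<nu>)) (nm (g \<nu>))) (\<mu> j)) \<longleftrightarrow>
      (\<exists>a\<le>p \<nu>. a + q \<nu> = p \<nu> \<and> (\<exists>b\<le>p' \<nu>. b + q' \<nu> = p' \<nu> \<and> mem (C a b) (\<mu> j)))" for \<nu>
  proof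
    assume L: "0 \<le> f \<nu> \<and> 0 \<le> g \<nu> \<and> mem (C (nm (f \<nu>)) (nm (g \<nu>))) (\<mu> j)"
    then obtain a b where "a \<le> p \<nu>" "a + q \<nu> = p \<nu>" "b \<le> p' \<nu>" "b + q' \<nu> = p' \<nu>"
      unfolding *(5,6) nn(1) by blast
    with L show "\<exists>a\<le>p \<nu>. a + q \<nu> = p \<nu> \<and> (\<exists>b\<le>p' \<nu>. b + q' \<nu> = p' \<nu> \<and> mem (C a b) (\<mu> j))"
      using nn(2)[of a "q \<nu>" "p \<nu>"] nn(2)[of b "q' \<nu>" "p' \<nu>"] unfolding *(5,6) by (metis (no_types))
  next
    assume "\<exists>a\<le>p \<nu>. a + q \<nu> = p \<nu> \<and> (\<exists>b\<le>p' \<nu>. b + q' \<nu> = p' \<nu> \<and> mem (C a b) (\<mu> j))"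
    then obtain a b where "a \<le> p \<nu>" "a + q \<nu> = p \<nu>" "b \<le> p' \<nu>" "b + q' \<nu> = p' \<nu>" "mem (C a b) (\<mu> j)" by blast
    then show "0 \<le> f \<nu> \<and> 0 \<le> g \<nu> \<and> mem (C (nm (f \<nu>)) (nm (g \<nu>))) (\<mu> j)"
      using nn(2)[of a "q \<nu>" "p \<nu>"] nn(2)[of b "q' \<nu>" "p' \<nu>"] unfolding *(5,6) nn(1) by (metis (no_types))
  qed
  moreover have "df \<mu> (\<lambda>\<nu>. \<exists>a\<le>p \<nu>. a + q \<nu> = p \<nu> \<and> (\<exists>b\<le>p' \<nu>. b + q' \<nu> = p' \<nu> \<and> mem (C a b) (\<mu> j)))"
    by (intro df_bex df_intros dt_intros code *(1-4))
  ultimately show "df \<mu> (\<lambda>\<nu>. 0 \<le> f \<nu> \<and> 0 \<le> g \<nu> \<and> mem (C (nm (f \<nu>)) (nm (g \<nu>))) (\<mu> j))"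
    by simp
qed

lemma dt_pr: "dt \<mu> p \<Longrightarrow> dt \<mu> q \<Longrightarrow> dt \<mu> (\<lambda>\<nu>. pr (p \<nu>) (q \<nu>))"
  unfolding pr_def by (intro dt_intros)

lemma dt_codes:
  "dt \<mu> p \<Longrightarrow> dt \<mu> q \<Longrightarrow> dt \<mu> (\<lambda>\<nu>. hc (p \<nu>) (q \<nu>))"
  "dt \<mu> p \<Longrightarrow> dt \<mu> q \<Longrightarrow> dt \<mu> (\<lambda>\<nu>. vc (p \<nu>) (q \<nu>))"
  unfolding hc_def vc_def by (intro dt_pr dt_intros; assumption)+

lemma dp_edge_h: "dp \<mu> (edge_h (\<mu> j))" and dp_edge_v: "dp \<mu> (edge_v (\<mu> j))"
  unfolding edge_h_def[abs_def] edge_v_def[abs_def]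
  by (rule dp_code[where C = hc], erule (1) dt_codes) (rule dp_code[where C = vc], erule (1) dt_codes)

lemma dp_or: "dp \<mu> h \<Longrightarrow> dp \<mu> h' \<Longrightarrow> dp \<mu> (\<lambda>x y. h x y \<or> h' x y)"
  by (rule dpI, intro d_intros)

lemma dp_transpose: "dp \<mu> h \<Longrightarrow> dp \<mu> (\<lambda>x y. h y x)"
  by (rule dpI, rule dpD)

lemma dp_shift: "dz \<mu> (\<lambda>_. s) \<Longrightarrow> dz \<mu> (\<lambda>_. t) \<Longrightarrow> dp \<mu> h \<Longrightarrow> dp \<mu> (shift s t h)"
  unfolding shift_def[abs_def] by (rule dpI, intro d_intros)

lemma dp_elbow_h: "dz \<mu> (\<lambda>_. q) \<Longrightarrow> dz \<mu> (\<lambda>_. a) \<Longrightarrow> dz \<mu> (\<lambda>_. b) \<Longrightarrow> dp \<mu> (elbow_h q a b)"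
  unfolding elbow_h_def[abs_def] by (rule dpI, intro d_intros)

lemma dp_elbow_v: "dz \<mu> (\<lambda>_. q) \<Longrightarrow> dz \<mu> (\<lambda>_. a) \<Longrightarrow> dz \<mu> (\<lambda>_. b) \<Longrightarrow> dp \<mu> (elbow_v q a b)"
  unfolding elbow_v_def[abs_def] by (rule dpI, intro d_intros)

lemma dp_inv_h: "dz \<mu> (\<lambda>_. K) \<Longrightarrow> dp \<mu> h \<Longrightarrow> dp \<mu> v \<Longrightarrow> dp \<mu> (inv_h K h v)"
  unfolding inv_h_def[abs_def] by (rule dpI, intro d_intros)

lemma dp_inv_v: "dz \<mu> (\<lambda>_. K) \<Longrightarrow> dp \<mu> h \<Longrightarrow> dp \<mu> v \<Longrightarrow> dp \<mu> (inv_v K h v)"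
  unfolding inv_v_def[abs_def]
  by (rule dp_transpose[of \<mu> "inv_h K (\<lambda>x y. v y x) (\<lambda>x y. h y x)"], rule dp_inv_h) (simp_all add: dp_transpose)

lemma dp_cen: "dz \<mu> (\<lambda>_. c) \<Longrightarrow> dz \<mu> (\<lambda>_. d) \<Longrightarrow> dp \<mu> h \<Longrightarrow> dp \<mu> (\<lambda>u w. h (cen c u) (cen d w))"
proof -
  \<comment> \<open>\<open>cen\<close> is a case distinction and not a difference of terms, so it is
    resolved into the four quadrants.\<close>
  have *: "h (cen c u) (cen d w) \<longleftrightarrow>
      0 \<le> u \<and> (0 \<le> w \<and> h (u + c) (w + d) \<or> w < 0 \<and> h (u + c) (w + d + 1)) \<or>
      u < 0 \<and> (0 \<le> w \<and> h (u + c + 1) (w + d) \<or> w < 0 \<and> h (u + c + 1) (w + d + 1))" for u w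
    unfolding cen_def by auto
  show "dz \<mu> (\<lambda>_. c) \<Longrightarrow> dz \<mu> (\<lambda>_. d) \<Longrightarrow> dp \<mu> h \<Longrightarrow> dp \<mu> (\<lambda>u w. h (cen c u) (cen d w))"
    unfolding * by (rule dpI, intro d_intros)
qed

lemma dp_cen_h: "dz \<mu> (\<lambda>_. c) \<Longrightarrow> dz \<mu> (\<lambda>_. d) \<Longrightarrow> dp \<mu> h \<Longrightarrow> dp \<mu> (cen_h c d h)"
  unfolding cen_h_def[abs_def] by (rule dpI, intro d_intros dpD[OF dp_cen])

lemma dp_cen_v: "dz \<mu> (\<lambda>_. c) \<Longrightarrow> dz \<mu> (\<lambda>_. d) \<Longrightarrow> dp \<mu> v \<Longrightarrow> dp \<mu> (cen_v c d v)"
  unfolding cen_v_def[abs_def] by (rule dpI, intro d_intros dpD[OF dp_cen])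

lemma dp_cut_h: "dp \<mu> h \<Longrightarrow> dp \<mu> (cut_h h)"
  unfolding cut_h_def[abs_def] by (rule dpI, intro d_intros)

lemma dp_toggle_h: "dp \<mu> h \<Longrightarrow> dp \<mu> (toggle_h h)"
proof -
  have *: "toggle_h h u w \<longleftrightarrow> h u w \<and> \<not> (u = - 1 \<and> (w = 1 \<or> w = - 2)) \<or> \<not> h u w \<and> u = - 1 \<and> (w = 1 \<or> w = - 2)" for u w
    unfolding toggle_h_def by auto
  show "dp \<mu> h \<Longrightarrow> dp \<mu> (toggle_h h)"
    unfolding dp_def * by (intro allI impI d_intros) (auto simp: dp_def)
qed

lemmas dp_intros = dp_or dp_shift dp_elbow_h dp_elbow_v dp_inv_h dp_inv_v dp_cen_h dp_cen_v dp_cut_h dp_toggle_h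

lemma dp_pictures:
  assumes "dz \<mu> (\<lambda>_. n)" "dp \<mu> h" "dp \<mu> v"
  shows "dp \<mu> (close_h n h)" "dp \<mu> (close_v n v)" "dp \<mu> (extend_h n h)" "dp \<mu> (extend_v n v)"
    and "dz \<mu> (\<lambda>_. c) \<Longrightarrow> dz \<mu> (\<lambda>_. d) \<Longrightarrow> dp \<mu> (inside_out blue_h cut_h n c d h v)"
    and "dz \<mu> (\<lambda>_. c) \<Longrightarrow> dz \<mu> (\<lambda>_. d) \<Longrightarrow> dp \<mu> (inside_out blue_v cut_h n c d h v)"
    and "dz \<mu> (\<lambda>_. c) \<Longrightarrow> dz \<mu> (\<lambda>_. d) \<Longrightarrow> dp \<mu> (inside_out red_h toggle_h n c d h v)"
    and "dz \<mu> (\<lambda>_. c) \<Longrightarrow> dz \<mu> (\<lambda>_. d) \<Longrightarrow> dp \<mu> (inside_out red_v toggle_h n c d h v)"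
  unfolding close_h_def close_v_def extend_h_def extend_v_def inside_out_def blue_h_def blue_v_def red_h_def red_v_def
  by (intro dp_intros dz_intros assms; assumption)+

lemma picture_exists:
  assumes "dt \<mu> (\<lambda>_. M)" "dp \<mu> h" "dp \<mu> v" and box: "boxed (zn M) h v"
  obtains X where "es M X" "edge_h X = h" "edge_v X = v"
proof -
  let ?P = "\<lambda>e. \<exists>x\<le>M. \<exists>y\<le>M. e = hc x y \<and> h (zn x) (zn y) \<or> e = vc x y \<and> v (zn x) (zn y)"
  have "df \<mu> (\<lambda>\<nu>. ?P (\<nu> 0))"
    by (intro df_bex assms(1) df_intros dt_intros dt_codes dpD[OF assms(2)] dpD[OF assms(3)] dz_zn)
  then obtain \<phi> where \<phi>: "Sigma0B \<phi>" "\<And>\<nu>. ?P (\<nu> 0) \<longleftrightarrow> holds \<mu> \<nu> \<phi>"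
    unfolding df_def by blast
  \<comment> \<open>Both ends of an edge of the grid have codes at most \<open>pr M M\<close>, so
    this bound is above the codes of all edges.\<close>
  let ?a = "pr (pr M M) (pr M M) + 1"
  obtain X where X: "len X \<le> ?a" "\<And>e. e < ?a \<Longrightarrow> mem e X \<longleftrightarrow> ?P e"
    using comprehension_num[OF \<phi>(1), of ?a \<mu> "\<lambda>_. 0"] \<phi>(2)[of "case_nat _ _"] by auto
  have h: "x + 1 \<le> M \<and> y \<le> M" if "h (zn x) (zn y)" for x y
    using boxedD(1)[OF box that] unfolding zn_less_iff by simp
  have v: "x \<le> M \<and> y + 1 \<le> M" if "v (zn x) (zn y)" for x y
    using boxedD(2)[OF box that] unfolding zn_less_iff by simp
  have hb: "hc x y < ?a" if "h (zn x) (zn y)" for x y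
    using h[OF that] num_le_succ[of x M] unfolding hc_def num_le_iff_less_succ[symmetric] by (intro pr_mono) auto
  have vb: "vc x y < ?a" if "v (zn x) (zn y)" for x y
    using v[OF that] num_le_succ[of y M] unfolding vc_def num_le_iff_less_succ[symmetric] by (intro pr_mono) auto
  have mem: "mem e X \<longleftrightarrow> ?P e" for e
  proof (cases "e < ?a")
    case False
    then have "\<not> ?P e" using hb vb by blast
    moreover have "\<not> mem e X" using False mem_less_len[of e X] X(1) by (meson less_le_trans)
    ultimately show ?thesis by blast
  qed (rule X(2))
  have "es M X"
    unfolding es_def mem using h v by blast
  moreover have "edge_h X a b \<longleftrightarrow> h a b" for a b
  proof (cases "0 \<le> a \<and> 0 \<le> b")
    case True
    then obtain x y where "a = zn x" "b = zn y" by (meson zz_nonnegE)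
    then show ?thesis using h[of x y] num_le_succ[of x M] by (auto simp: mem)
  qed (use boxedD(1)[OF box] in \<open>auto simp: edge_h_def\<close>)
  moreover have "edge_v X a b \<longleftrightarrow> v a b" for a b
  proof (cases "0 \<le> a \<and> 0 \<le> b")
    case True
    then obtain x y where "a = zn x" "b = zn y" by (meson zz_nonnegE)
    then show ?thesis using v[of x y] num_le_succ[of y M] by (auto simp: mem)
  qed (use boxedD(2)[OF box] in \<open>auto simp: edge_v_def\<close>)
  ultimately show thesis using that[of X] by blast
qed

text \<open>For nonzero \<open>a\<close> the set with the single element \<open>a - 1\<close> has
  length \<open>a\<close>. This lets the size of the grid and the middle point enter definitions as
  set parameters.\<close>

lemma len_surj: "\<exists>Z. len Z = a"
proof (cases "a = 0")
  case True
  obtain Z where "len Z \<le> a"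
    using comprehension_num[of Fls a] Sigma0B.intros(1) by blast
  then show ?thesis using True num_zero_le[of "len Z"] by (intro exI[of _ Z]) (simp add: antisym)
next
  case False
  then obtain b where b: "b + 1 = a" using num_pred by blast
  obtain Z where Z: "len Z \<le> a" "\<And>z. z < a \<Longrightarrow> mem z Z \<longleftrightarrow> holds (\<lambda>_. 0) (case_nat z (case_nat a (\<lambda>_. 0))) (NVar 0 \<^bold>+ One \<^bold>= NVar 1)"
    using comprehension_num[of "NVar 0 \<^bold>+ One \<^bold>= NVar 1" a "\<lambda>_. 0" "\<lambda>_. 0"] Sigma0B.intros(2) by blast
  have "b < a" using num_le_iff_less_succ[of b b] b by simp
  then have "mem b Z" using Z(2) b by simp
  then have "b + 1 \<le> len Z" by (intro num_less_imp_succ_le mem_less_len)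
  then show ?thesis using Z(1) b by (intro exI[of _ Z]) (simp add: antisym)
qed


section \<open>The equivalence\<close>

lemma holds_JCT_corners: "holds \<mu> \<nu> JCT_corners \<longleftrightarrow> (\<forall>N X Y. es N X \<longrightarrow> es N Y \<longrightarrow>
    linked (edge_h X) (edge_v X) 0 (zn N) (zn N) 0 \<longrightarrow> linked (edge_h Y) (edge_v Y) 0 0 (zn N) (zn N) \<longrightarrow>
    (\<exists>a b. dg X a b \<noteq> 0 \<and> dg Y a b \<noteq> 0))"
  by (auto simp: JCT_corners_def Let_def holds_connects holds_intersect)

lemma holds_JCT_curve: "holds \<mu> \<nu> JCT_curve \<longleftrightarrow> (\<forall>N X Y. \<forall>x1\<le>N. \<forall>y1\<le>N. \<forall>x2\<le>N. \<forall>y2\<le>N.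
    es N X \<longrightarrow> es N Y \<longrightarrow> (\<exists>e. mem e X) \<longrightarrow> (\<forall>a b. dg X a b = 0 \<or> dg X a b = 2) \<longrightarrow>
    zn x1 = zn x2 \<longrightarrow> zn y1 = zn y2 + 2 \<or> zn y2 = zn y1 + 2 \<longrightarrow> dg X (zn x1) (zn y1) = 0 \<longrightarrow> dg X (zn x2) (zn y2) = 0 \<longrightarrow>
    (\<exists>z\<le>N. zn z + zn z = zn y1 + zn y2 \<and> dg X (zn x1) (zn z) = 2) \<longrightarrow>
    linked (edge_h Y) (edge_v Y) (zn x1) (zn y1) (zn x2) (zn y2) \<longrightarrow>
    (\<exists>a b. dg X a b \<noteq> 0 \<and> dg Y a b \<noteq> 0))"
proof -
  have "(holds \<mu>' \<nu>' (curve (NVar 4) 1) \<longrightarrow> holds \<mu>' \<nu>' (different_sides (NVar 4) 1 (NVar 3) (NVar 2) (NVar 1) (NVar 0)) \<longrightarrow>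
      holds \<mu>' \<nu>' (connects (NVar 4) 0 (NVar 3) (NVar 2) (NVar 1) (NVar 0)) \<longrightarrow> holds \<mu>' \<nu>' (intersect (NVar 4) 1 0)) \<longleftrightarrow>
    (es N X \<longrightarrow> es N Y \<longrightarrow> (\<exists>e. mem e X) \<longrightarrow> (\<forall>a b. dg X a b = 0 \<or> dg X a b = 2) \<longrightarrow>
      zn x1 = zn x2 \<longrightarrow> zn y1 = zn y2 + 2 \<or> zn y2 = zn y1 + 2 \<longrightarrow> dg X (zn x1) (zn y1) = 0 \<longrightarrow> dg X (zn x2) (zn y2) = 0 \<longrightarrow>
      (\<exists>z\<le>N. zn z + zn z = zn y1 + zn y2 \<and> dg X (zn x1) (zn z) = 2) \<longrightarrow>
      linked (edge_h Y) (edge_v Y) (zn x1) (zn y1) (zn x2) (zn y2) \<longrightarrow>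
      (\<exists>a b. dg X a b \<noteq> 0 \<and> dg Y a b \<noteq> 0))"
    if "\<mu>' = case_nat Y (case_nat X \<mu>)" "\<nu>' = case_nat y2 (case_nat x2 (case_nat y1 (case_nat x1 (case_nat N \<nu>))))"
    for \<mu>' \<nu>' N X Y x1 y1 x2 y2
  proof -
    have v: "\<mu>' 0 = Y" "\<mu>' 1 = X" "ev \<mu>' \<nu>' (NVar 4) = N" "ev \<mu>' \<nu>' (NVar 3) = x1" "ev \<mu>' \<nu>' (NVar 2) = y1"
      "ev \<mu>' \<nu>' (NVar 1) = x2" "ev \<mu>' \<nu>' (NVar 0) = y2"
      unfolding that by simp_all
    show ?thesis
    proof (cases "es N X \<and> es N Y")
      case True
      have es: "es (ev \<mu>' \<nu>' (NVar 4)) (\<mu>' 1)" "es (ev \<mu>' \<nu>' (NVar 4)) (\<mu>' 0)" unfolding v using True by blast+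
      show ?thesis
        unfolding holds_curve holds_connects holds_different_sides[OF es(1)] holds_intersect[OF es] v Let_def
        using True by blast
    next
      case False
      then show ?thesis unfolding holds_curve holds_connects v by blast
    qed
  qed
  note inner = this[OF refl refl]
  have "holds \<mu> \<nu> JCT_curve \<longleftrightarrow> (\<forall>N X Y. \<forall>x1\<le>N. \<forall>y1\<le>N. \<forall>x2\<le>N. \<forall>y2\<le>N.
      (let \<mu>' = case_nat Y (case_nat X \<mu>); \<nu>' = case_nat y2 (case_nat x2 (case_nat y1 (case_nat x1 (case_nat N \<nu>)))) in
      holds \<mu>' \<nu>' (curve (NVar 4) 1) \<longrightarrow> holds \<mu>' \<nu>' (different_sides (NVar 4) 1 (NVar 3) (NVar 2) (NVar 1) (NVar 0)) \<longrightarrow>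
      holds \<mu>' \<nu>' (connects (NVar 4) 0 (NVar 3) (NVar 2) (NVar 1) (NVar 0)) \<longrightarrow> holds \<mu>' \<nu>' (intersect (NVar 4) 1 0)))"
    unfolding JCT_curve_def Let_def by simp blast
  then show ?thesis
    unfolding Let_def inner .
qed

lemma corners_imp_curve:
  assumes "holds \<mu> \<nu> JCT_corners"
  shows "holds \<mu> \<nu> JCT_curve"
  unfolding holds_JCT_curve
proof (intro allI impI)
  fix N X Y x1 y1 x2 y2
  assume b: "x1 \<le> N" "y1 \<le> N" "x2 \<le> N" "y2 \<le> N" and es: "es N X" "es N Y"
    and even: "\<forall>a b. dg X a b = 0 \<or> dg X a b = 2"
    and x: "zn x1 = zn x2" and y: "zn y1 = zn y2 + 2 \<or> zn y2 = zn y1 + 2"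
    and p: "dg X (zn x1) (zn y1) = 0" "dg X (zn x2) (zn y2) = 0"
    and m: "\<exists>z\<le>N. zn z + zn z = zn y1 + zn y2 \<and> dg X (zn x1) (zn z) = 2"
    and l: "linked (edge_h Y) (edge_v Y) (zn x1) (zn y1) (zn x2) (zn y2)"
  obtain z where z: "z \<le> N" "zn z + zn z = zn y1 + zn y2" "dg X (zn x1) (zn z) = 2" using m by blast
  let ?n = "zn N" and ?c = "zn x1" and ?d = "zn z"
  have "zn y1 = ?d + 1 \<and> zn y2 = ?d - 1 \<or> zn y1 = ?d - 1 \<and> zn y2 = ?d + 1"
    using y z(2) by auto
  then have q: "dg X ?c (?d + 1) = 0" "dg X ?c (?d - 1) = 0" "linked (edge_h Y) (edge_v Y) ?c (?d + 1) ?c (?d - 1)"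
    "0 \<le> ?d - 1" "?d + 1 \<le> ?n"
    using p l x linked_sym[OF l] b zn_simps(6)[of y1 N] zn_simps(6)[of y2 N] zn_simps(8)[of y1] zn_simps(8)[of y2]
    by (auto simp del: zn_simps(6,8))
  show "\<exists>a b. dg X a b \<noteq> 0 \<and> dg Y a b \<noteq> 0"
  proof (rule ccontr)
    assume "\<not> (\<exists>a b. dg X a b \<noteq> 0 \<and> dg Y a b \<noteq> 0)"
    then have disj: "\<And>a b. dg X a b = 0 \<or> dg Y a b = 0" by blast
    obtain Zn Zc Zd where Z: "len Zn = N" "len Zc = x1" "len Zd = z" using len_surj by metis
    \<comment> \<open>All parameters of the construction as sets: the two edge sets, and sets whose
      lengths are the grid size and the coordinates of the middle point.\<close>
    define \<kappa> where "\<kappa> = (\<lambda>i :: nat. if i = 0 then X else if i = 1 then Y else if i = 2 then Zn else if i = 3 then Zc else Zd)"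
    have \<kappa>: "\<kappa> 0 = X" "\<kappa> 1 = Y" "\<kappa> 2 = Zn" "\<kappa> 3 = Zc" "\<kappa> 4 = Zd" by (simp_all add: \<kappa>_def)
    have dN: "dt \<kappa> (\<lambda>_. N)" and dc: "dt \<kappa> (\<lambda>_. x1)" and dd: "dt \<kappa> (\<lambda>_. z)"
      using dt_intros(4)[of \<kappa> 2] dt_intros(4)[of \<kappa> 3] dt_intros(4)[of \<kappa> 4] unfolding \<kappa> Z by blast+
    have dpX: "dp \<kappa> (edge_h X)" "dp \<kappa> (edge_v X)" "dp \<kappa> (edge_h Y)" "dp \<kappa> (edge_v Y)"
      using dp_edge_h[of \<kappa> 0] dp_edge_v[of \<kappa> 0] dp_edge_h[of \<kappa> 1] dp_edge_v[of \<kappa> 1] unfolding \<kappa> by blast+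
    define M where "M = N + (1 + 1) + (N + (1 + 1)) + (N + (1 + 1)) + (N + (1 + 1))"
    have dM: "dt \<kappa> (\<lambda>_. M)" unfolding M_def by (intro dt_intros(3,5) dN)
    have M: "zn M = ?n + 2 + (?n + 2) + (?n + 2) + (?n + 2)" unfolding M_def by simp
    have d1: "1 \<le> ?d" using q(4) by simp
    note T = curve_to_corners[OF es_boxed[OF es(1)] es_boxed[OF es(2)] _ _ d1 q(5) even[rule_format] z(3) q(1,2,3) disj, folded M]
    have c: "0 \<le> ?c" "?c \<le> ?n" using b by simp_all
    obtain X' where X': "es M X'" "edge_h X' = inside_out blue_h cut_h ?n ?c ?d (edge_h X) (edge_v X)"
        "edge_v X' = inside_out blue_v cut_h ?n ?c ?d (edge_h X) (edge_v X)"
      by (rule picture_exists[OF dM dp_pictures(5,6)[OF dz_zn[OF dN] dpX(1,2) dz_zn[OF dc] dz_zn[OF dd]] T(1)[OF c]])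
    obtain Y' where Y': "es M Y'" "edge_h Y' = inside_out red_h toggle_h ?n ?c ?d (edge_h Y) (edge_v Y)"
        "edge_v Y' = inside_out red_v toggle_h ?n ?c ?d (edge_h Y) (edge_v Y)"
      by (rule picture_exists[OF dM dp_pictures(7,8)[OF dz_zn[OF dN] dpX(3,4) dz_zn[OF dc] dz_zn[OF dd]] T(2)[OF c]])
    have "\<exists>a b. dg X' a b \<noteq> 0 \<and> dg Y' a b \<noteq> 0"
      using assms[unfolded holds_JCT_corners, rule_format, OF X'(1) Y'(1)] T(3,4)[OF c] unfolding X'(2,3) Y'(2,3) by blast
    then obtain a b where "dg X' a b \<noteq> 0" "dg Y' a b \<noteq> 0" by blast
    then show False using T(5)[OF c, of a b] unfolding X'(2,3) Y'(2,3) by simp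
  qed
qed

lemma curve_imp_corners:
  assumes "holds \<mu> \<nu> JCT_curve"
  shows "holds \<mu> \<nu> JCT_corners"
  unfolding holds_JCT_corners
proof (intro allI impI)
  fix N X Y
  assume es: "es N X" "es N Y" and l: "linked (edge_h X) (edge_v X) 0 (zn N) (zn N) 0" "linked (edge_h Y) (edge_v Y) 0 0 (zn N) (zn N)"
  show "\<exists>a b. dg X a b \<noteq> 0 \<and> dg Y a b \<noteq> 0"
  proof (rule ccontr)
    assume "\<not> (\<exists>a b. dg X a b \<noteq> 0 \<and> dg Y a b \<noteq> 0)"
    then have disj: "\<And>a b. dg X a b = 0 \<or> dg Y a b = 0" by blast
    \<comment> \<open>A grid with a single point has no edge, so no path can end in it.\<close>
    have "zn N \<noteq> 0"
    proof
      assume 0: "zn N = 0"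
      have "dg X 0 0 = 0"
        unfolding deg_eq_0_iff using boxedD[OF es_boxed[OF es(1)]] unfolding 0 by (meson leD)
      then show False using l(1) unfolding 0 linked_def by simp
    qed
    then have n: "1 \<le> zn N"
      using less_iff_succ_less_eq[of 0 "zn N"] by (simp add: less_le)
    obtain Zn where Z: "len Zn = N" using len_surj by metis
    define \<kappa> where "\<kappa> = (\<lambda>i :: nat. if i = 0 then X else if i = 1 then Y else Zn)"
    have \<kappa>: "\<kappa> 0 = X" "\<kappa> 1 = Y" "\<kappa> 2 = Zn" by (simp_all add: \<kappa>_def)
    have dN: "dt \<kappa> (\<lambda>_. N)"
      using dt_intros(4)[of \<kappa> 2] unfolding \<kappa> Z .
    have dpX: "dp \<kappa> (edge_h X)" "dp \<kappa> (edge_v X)" "dp \<kappa> (edge_h Y)" "dp \<kappa> (edge_v Y)"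
      using dp_edge_h[of \<kappa> 0] dp_edge_v[of \<kappa> 0] dp_edge_h[of \<kappa> 1] dp_edge_v[of \<kappa> 1] unfolding \<kappa> by blast+
    define M where "M = N + (1 + 1)"
    have dM: "dt \<kappa> (\<lambda>_. M)" unfolding M_def by (intro dt_intros(3,5) dN)
    have M: "zn M = zn N + 2" unfolding M_def by simp
    note T = corners_to_curve[OF n es_boxed[OF es(1)] es_boxed[OF es(2)] l disj, folded M]
    obtain X' where X': "es M X'" "edge_h X' = close_h (zn N) (edge_h X)" "edge_v X' = close_v (zn N) (edge_v X)"
      by (rule picture_exists[OF dM dp_pictures(1,2)[OF dz_zn[OF dN] dpX(1,2)] T(1)])
    obtain Y' where Y': "es M Y'" "edge_h Y' = extend_h (zn N) (edge_h Y)" "edge_v Y' = extend_v (zn N) (edge_v Y)"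
      by (rule picture_exists[OF dM dp_pictures(3,4)[OF dz_zn[OF dN] dpX(3,4)] T(2)])
    have "dg X' 1 1 \<noteq> 0" using T(6) unfolding X'(2,3) by simp
    then have ne: "\<exists>e. mem e X'" unfolding deg_eq_0_iff edge_h_def edge_v_def by blast
    have le: "0 \<le> M" "1 \<le> M" "1 + 1 \<le> M"
      using num_zero_le[of M] num_le_add[of 1 "N + 1"] num_le_add[of "1 + 1" N]
      unfolding M_def by (simp_all only: ac_simps)
    have "\<exists>a b. dg X' a b \<noteq> 0 \<and> dg Y' a b \<noteq> 0"
    \<comment> \<open>After the shift the points on different sides are \<open>(1, 2)\<close> and
      \<open>(1, 0)\<close>, with \<open>(1, 1)\<close> in the middle.\<close>
    proof (rule assms[unfolded holds_JCT_curve, rule_format, of 1 M "1 + 1" 1 0])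
      show "dg X' a b = 0 \<or> dg X' a b = 2" for a b using T(3) unfolding X'(2,3) .
      show "dg X' (zn 1) (zn (1 + 1)) = 0" "dg X' (zn 1) (zn 0) = 0" using T(4,5) unfolding X'(2,3) by simp_all
      show "\<exists>z\<le>M. zn z + zn z = zn (1 + 1) + zn 0 \<and> dg X' (zn 1) (zn z) = 2"
        using T(6) le unfolding X'(2,3) by (intro exI[of _ 1]) simp
      show "linked (edge_h Y') (edge_v Y') (zn 1) (zn (1 + 1)) (zn 1) (zn 0)" using T(7) unfolding Y'(2,3) by simp
    qed (use le X'(1) Y'(1) ne in simp_all)
    then obtain a b where "dg X' a b \<noteq> 0" "dg Y' a b \<noteq> 0" by blast
    then show False using T(8)[of a b] unfolding X'(2,3) Y'(2,3) by simp
  qed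
qed

theorem theorem5p1:
  shows "proves V0 (JCT_curve \<^bold>\<leftrightarrow> JCT_corners)"
  by (rule proves_target) (use corners_imp_curve curve_imp_corners in auto)

end
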